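(* Let $\Theta$ be a positive real random variable on $(\Omega,\Sigma,P)$, $D\in\mathfrak B(\mathbb R)$ with $\Theta(\Omega)\subseteq D$, $h:D\to\mathbb R$ Borel, $N$ a $P$-eMRP$(\mathbf K(h(\Theta)))$, and $\{P_\theta\}_{\theta\in D}$ a disintegration of $P$ over $P_\Theta$ consistent with $\Theta$ such that $N$, $h$, $\{P_\theta\}_{\theta\in D}$ satisfy Standing Assumption A (with null set $L_h$ and function $p_h$). Suppose there is a $P_\Theta$-null set $L_0\in\mathfrak B(D)$ such that $h$ restricted to $D\setminus L_0$ is injective. Put $O_h:=L_0\cup L_h$, define $\widehat\Theta:=p_h\circ\Theta$ on $\Theta^{-1}(D\setminus O_h)$ and extend it arbitrarily to a measurable real function on $\Omega$ (still denoted $\widehat\Theta$). For $A\in\Sigma$ put $Q_{\hat\theta}(A):=P_{p_h^{-1}(\hat\theta)}(A)$ if $\hat\theta\in p_h(D\setminus O_h)$ and $Q_{\hat\theta}(A):=P(A)$ otherwise. Then $\{Q_{\hat\theta}\}_{\hat\theta\in\mathbb R}$ is a disintegration of $P$ over $P_{\widehat\Theta}$ consistent with $\widehat\Theta$, and the following are equivalent: (i) $N$ is a $P$-MPP$(\widehat\Theta)$; (ii) $N$ is a $P$-MPP$(\{Q_{\hat\theta}\}_{\hat\theta\in\mathbb R},P_{\widehat\Theta})$; (iii) $N$ is a $Q_{\hat\theta}$-PP$(\hat\theta)$ for $P_{\widehat\Theta}$-almost all $\hat\theta\in\mathbb R$; (iv) $N$ is a $P$-MPP$(P_{\widehat\T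heta})$.
   Context: Counting process: a family $N=\{N_t\}_{t\in[0,\infty)}$ of measurable maps into $\overline{\mathbb R}$ whose paths take values in $\mathbb N_0\cup\{\infty\}$, are right-continuous, have jumps of size at most one, vanish at $0$ and increase to $\infty$; $T_0=0$, $T_n=\inf\{t:N_t\ge n\}$, $W_n=T_n-T_{n-1}$. $\mathbf P(\lambda)$ Poisson law, $\mathbf{Exp}(\lambda)$ exponential law with density $\lambda e^{-\lambda t}$; $Q$-PP$(\theta)$ means Poisson process with rate $\theta$ under $Q$. $P_{X|\Theta}$: conditional distribution of $X$ given $\sigma(\Theta)$; conditional independence given $\Theta$ means factorization of $P(\bigcap_j\{X_{i_j}\le x_j\}\mid\sigma(\Theta))$ a.s. $P$-MPP$(\Theta)$ (for $P_\Theta((0,\infty))=1$): $N$ has $P$-conditionally (given $\Theta$) independent and conditionally stationary increments (increment vectors over $t_0<\dots<t_m$ and over the shifted times $t_j+h$ have the same conditional law given $\sigma(\Theta)$), and $P_{N_t|\Theta}=\mathbf P(\Theta t)$ a.s. for each $t>0$. $P$-MPP$(\{P_{\tilde y}\}_{\tilde y\in\tilde\Upsilon},\nu)$: $\{P_{\tilde y}\}$ probability measures on $\Sigma$, $\nu$ a probability measure on the $\sigma$-algebra generated by $\tilde y\mapsto P_{\tilde y}(E)$, $E\in\Sigma$; for some positive measurable $\alpha$ and $\nu$-a.a. $\tilde y$, $W$ is $P_{\tilde y}$-independent with $(P_{\tilde y})_{W_n}=\mathbf{Exp}(\alpha(\tilde y))$; and $P(\bigcap_{k=1}^r\{W_k\le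 w_k\})=\int\prod_{k=1}^rP_{\tilde y}(\{W_k\le w_k\})\nu(d\tilde y)$ for all $r$ and $w_k>0$. $P$-MPP$(U)$: $P(\bigcap_{j=1}^m\{N_{t_j}-N_{t_{j-1}}=\kappa_j\})=\int_{(0,\infty)}\prod_{j=1}^me^{-\theta(t_j-t_{j-1})}\frac{(\theta(t_j-t_{j-1}))^{\kappa_j}}{\kappa_j!}U(d\theta)$ for all $0=t_0<\dots<t_m$, $\kappa_j\in\mathbb N_0$. Disintegration of $P$ over a probability $Q$ on $\mathfrak B(D)$: probabilities $\{P_\theta\}$ on $\Sigma$ with $\theta\mapsto P_\theta(E)$ measurable and $\int P_\theta(E)Q(d\theta)=P(E)$; consistent with $\Theta$ (where $P_\Theta=Q$) if for each Borel $B$, $P_\theta(\Theta^{-1}(B))=1$ for $Q$-a.e. $\theta\in B$. $P$-eMRP$(\mathbf K(h(\Theta)))$: $\{\mathbf K(s)\}$ a measurably parametrized family of distributions on $\mathfrak B(\mathbb R)$; $W$ is $P$-conditionally independent given $\Theta$ and $P_{W_n|\Theta}=\mathbf K(h(\Theta))$ for all $n$. Standing Assumption A (for $N$, $h$, $\{P_\theta\}_{\theta\in D}$): with $F_{h(\theta)}(t):=P_\theta(\{W_n\le t\})$ (independent of $n$, since $(P_\theta)_{W_n}=\mathbf K(h(\theta))$ for all $n$, $\theta\in D$), there is a $P_\Theta$-null set $L_h\in\mathfrak B(D)$ such that for $\theta\in D\setminus L_h$: $F_{h(\theta)}$ is continuously differentiable on $(0,\infty)$, $0<F'_{h(\theta)}(t)<C(h(\theta))$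 for all $t>0$ for some $C\in\mathcal L^1(P_{h(\Theta)})$, and $p_h(\theta):=\lim_{t\to0}F'_{h(\theta)}(t)$ defines a positive injective function on $D\setminus L_h$. *)

theory Defs
  imports "HOL-Probability.Probability"
begin

definition counting_process :: "'a measure \<Rightarrow> (real \<Rightarrow> 'a \<Rightarrow> ereal) \<Rightarrow> bool" where
  "counting_process M N \<longleftrightarrow>
     (\<forall>t\<ge>0. N t \<in> borel_measurable M) \<and>
     (\<forall>\<omega>\<in>space M.
        N 0 \<omega> = 0 \<and>
        (\<forall>t\<ge>0. N t \<omega> \<in> range (\<lambda>n::nat. ereal (real n)) \<union> {\<infinity>}) \<and>
        mono_on {0..} (\<lambda>t. N t \<omega>) \<and>
        (\<forall>t\<ge>0. ((\<lambda>s. N s \<omega>) \<longlongrightarrow> N t \<omega>) (at_right t)) \<and>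
        (\<forall>t>0. N t \<omega> \<le> (SUP s\<in>{0..<t}. N s \<omega>) + 1) \<and>
        ((\<lambda>t. N t \<omega>) \<longlongrightarrow> \<infinity>) at_top)"

definition arrival :: "(real \<Rightarrow> 'a \<Rightarrow> ereal) \<Rightarrow> nat \<Rightarrow> 'a \<Rightarrow> real" where
  "arrival N n \<omega> = Inf {t. 0 \<le> t \<and> ereal (real n) \<le> N t \<omega>}"

definition interarrival :: "(real \<Rightarrow> 'a \<Rightarrow> ereal) \<Rightarrow> nat \<Rightarrow> 'a \<Rightarrow> real" where
  "interarrival N n \<omega> = arrival N n \<omega> - arrival N (n - 1) \<omega>"

definition time_grid :: "nat \<Rightarrow> (nat \<Rightarrow> real) \<Rightarrow> bool" where
  "time_grid m t \<longleftrightarrow> 1 \<le> m \<and> t 0 = 0 \<and> (\<forall>j<m. t j < t (Suc j))"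

definition incr :: "(real \<Rightarrow> 'a \<Rightarrow> ereal) \<Rightarrow> (nat \<Rightarrow> real) \<Rightarrow> nat \<Rightarrow> 'a \<Rightarrow> ereal" where
  "incr N t j \<omega> = N (t j) \<omega> - N (t (j - 1)) \<omega>"

definition incr_vec :: "(real \<Rightarrow> 'a \<Rightarrow> ereal) \<Rightarrow> (nat \<Rightarrow> real) \<Rightarrow> nat \<Rightarrow> 'a \<Rightarrow> nat \<Rightarrow> ereal" where
  "incr_vec N t m \<omega> = (\<lambda>j\<in>{1..m}. incr N t j \<omega>)"

definition poisson_law :: "real \<Rightarrow> ereal measure" where
  "poisson_law l = distr (density (count_space UNIV)
       (\<lambda>k::nat. ennreal (exp (- l) * l ^ k / fact k))) borel (\<lambda>k. ereal (real k))"

definition exp_law :: "real \<Rightarrow> real measure" where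
  "exp_law l = density lborel (exponential_density l)"

definition cprob :: "'a measure \<Rightarrow> ('a \<Rightarrow> real) \<Rightarrow> 'a set \<Rightarrow> 'a \<Rightarrow> real" where
  "cprob M \<Theta> A = real_cond_exp M (vimage_algebra (space M) \<Theta> borel) (indicator A)"

definition cond_indep :: "'a measure \<Rightarrow> ('a \<Rightarrow> real) \<Rightarrow> ('i \<Rightarrow> 'a \<Rightarrow> 'b::linorder) \<Rightarrow> 'i set \<Rightarrow> bool" where
  "cond_indep M \<Theta> X I \<longleftrightarrow>
     (\<forall>J. J \<subseteq> I \<longrightarrow> finite J \<longrightarrow> J \<noteq> {} \<longrightarrow> (\<forall>x::'i \<Rightarrow> 'b.
        AE \<omega> in M. cprob M \<Theta> (\<Inter>j\<in>J. {\<omega>\<in>space M. X j \<omega> \<le> x j}) \<omega>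
                   = (\<Prod>j\<in>J. cprob M \<Theta> {\<omega>\<in>space M. X j \<omega> \<le> x j} \<omega>)))"

definition cond_law :: "'a measure \<Rightarrow> ('a \<Rightarrow> real) \<Rightarrow> 'b measure \<Rightarrow> ('a \<Rightarrow> 'b) \<Rightarrow> ('a \<Rightarrow> 'b measure) \<Rightarrow> bool" where
  "cond_law M \<Theta> S X K \<longleftrightarrow>
     (\<forall>B\<in>sets S. AE \<omega> in M. cprob M \<Theta> (X -` B \<inter> space M) \<omega> = measure (K \<omega>) B)"

definition cond_law_eq :: "'a measure \<Rightarrow> ('a \<Rightarrow> real) \<Rightarrow> 'b measure \<Rightarrow> ('a \<Rightarrow> 'b) \<Rightarrow> ('a \<Rightarrow> 'b) \<Rightarrow> bool" where
  "cond_law_eq M \<Theta> S X Y \<longleftrightarrow>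
     (\<forall>B\<in>sets S. AE \<omega> in M. cprob M \<Theta> (X -` B \<inter> space M) \<omega> = cprob M \<Theta> (Y -` B \<inter> space M) \<omega>)"

definition MPP_Theta :: "'a measure \<Rightarrow> (real \<Rightarrow> 'a \<Rightarrow> ereal) \<Rightarrow> ('a \<Rightarrow> real) \<Rightarrow> bool" where
  "MPP_Theta M N \<Theta> \<longleftrightarrow>
     (AE \<omega> in M. 0 < \<Theta> \<omega>) \<and>
     (\<forall>m t. time_grid m t \<longrightarrow> cond_indep M \<Theta> (incr N t) {1..m}) \<and>
     (\<forall>m t h. time_grid m t \<longrightarrow> 0 < h \<longrightarrow>
        cond_law_eq M \<Theta> (PiM {1..m} (\<lambda>_. borel)) (incr_vec N t m) (incr_vec N (\<lambda>j. t j + h) m)) \<and>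
     (\<forall>t>0. cond_law M \<Theta> borel (N t) (\<lambda>\<omega>. poisson_law (\<Theta> \<omega> * t)))"

definition PP :: "'a measure \<Rightarrow> (real \<Rightarrow> 'a \<Rightarrow> ereal) \<Rightarrow> real \<Rightarrow> bool" where
  "PP Q N \<theta> \<longleftrightarrow>
     (\<forall>m t. time_grid m t \<longrightarrow> prob_space.indep_vars Q (\<lambda>_. borel) (incr N t) {1..m}) \<and>
     (\<forall>m t h. time_grid m t \<longrightarrow> 0 < h \<longrightarrow>
        distr Q (PiM {1..m} (\<lambda>_. borel)) (incr_vec N t m)
          = distr Q (PiM {1..m} (\<lambda>_. borel)) (incr_vec N (\<lambda>j. t j + h) m)) \<and>
     (\<forall>t>0. distr Q borel (N t) = poisson_law (\<theta> * t))"

definition MPP_mix :: "'a measure \<Rightarrow> (real \<Rightarrow> 'a \<Rightarrow> ereal) \<Rightarrow> (real \<Rightarrow> 'a measure) \<Rightarrow> real measure \<Rightarrow> bool" where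
  "MPP_mix M N Pf \<nu> \<longleftrightarrow>
     (\<exists>\<alpha>. \<alpha> \<in> borel_measurable borel \<and> (\<forall>y. 0 < \<alpha> y) \<and>
        (AE y in \<nu>. prob_space (Pf y) \<and>
            prob_space.indep_vars (Pf y) (\<lambda>_. borel) (interarrival N) {1..} \<and>
            (\<forall>n\<ge>1. distr (Pf y) borel (interarrival N n) = exp_law (\<alpha> y)))) \<and>
     (\<forall>r\<ge>1. \<forall>w::nat \<Rightarrow> real. (\<forall>k\<in>{1..r}. 0 < w k) \<longrightarrow>
        measure M (\<Inter>k\<in>{1..r}. {\<omega>\<in>space M. interarrival N k \<omega> \<le> w k})
          = (\<integral>y. (\<Prod>k\<in>{1..r}. measure (Pf y) {\<omega>\<in>space M. interarrival N k \<omega> \<le> w k}) \<partial>\<nu>))"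

definition MPP_U :: "'a measure \<Rightarrow> (real \<Rightarrow> 'a \<Rightarrow> ereal) \<Rightarrow> real measure \<Rightarrow> bool" where
  "MPP_U M N U \<longleftrightarrow>
     (\<forall>m t (\<kappa>::nat \<Rightarrow> nat). time_grid m t \<longrightarrow>
        measure M (\<Inter>j\<in>{1..m}. {\<omega>\<in>space M. incr N t j \<omega> = ereal (real (\<kappa> j))})
          = (LINT \<theta>:{0<..}|U. (\<Prod>j\<in>{1..m}.
               exp (- \<theta> * (t j - t (j - 1))) * (\<theta> * (t j - t (j - 1))) ^ \<kappa> j / fact (\<kappa> j))))"

definition disintegration :: "'a measure \<Rightarrow> real measure \<Rightarrow> real set \<Rightarrow> (real \<Rightarrow> 'a measure) \<Rightarrow> bool" where
  "disintegration M Q D Pf \<longleftrightarrow>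
     (\<forall>\<theta>\<in>D. prob_space (Pf \<theta>) \<and> sets (Pf \<theta>) = sets M) \<and>
     (\<forall>E\<in>sets M. (\<lambda>\<theta>. measure (Pf \<theta>) E) \<in> borel_measurable (restrict_space borel D)) \<and>
     (\<forall>E\<in>sets M. (LINT \<theta>:D|Q. measure (Pf \<theta>) E) = measure M E)"

definition consistent :: "'a measure \<Rightarrow> real measure \<Rightarrow> real set \<Rightarrow> (real \<Rightarrow> 'a measure) \<Rightarrow> ('a \<Rightarrow> real) \<Rightarrow> bool" where
  "consistent M Q D Pf \<Theta> \<longleftrightarrow>
     (\<forall>B\<in>sets borel. B \<subseteq> D \<longrightarrow>
        (AE \<theta> in Q. \<theta> \<in> B \<longrightarrow> measure (Pf \<theta>) (\<Theta> -` B \<inter> space M) = 1))"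

definition meas_kernel :: "(real \<Rightarrow> real measure) \<Rightarrow> bool" where
  "meas_kernel K \<longleftrightarrow>
     (\<forall>s. prob_space (K s) \<and> sets (K s) = sets borel) \<and>
     (\<forall>B\<in>sets borel. (\<lambda>s. measure (K s) B) \<in> borel_measurable borel)"

definition eMRP :: "'a measure \<Rightarrow> (real \<Rightarrow> 'a \<Rightarrow> ereal) \<Rightarrow> ('a \<Rightarrow> real) \<Rightarrow> (real \<Rightarrow> real) \<Rightarrow> (real \<Rightarrow> real measure) \<Rightarrow> bool" where
  "eMRP M N \<Theta> h K \<longleftrightarrow>
     meas_kernel K \<and>
     cond_indep M \<Theta> (interarrival N) {1..} \<and>
     (\<forall>n\<ge>1. cond_law M \<Theta> borel (interarrival N n) (\<lambda>\<omega>. K (h (\<Theta> \<omega>))))"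

definition standing_A :: "'a measure \<Rightarrow> (real \<Rightarrow> 'a \<Rightarrow> ereal) \<Rightarrow> ('a \<Rightarrow> real) \<Rightarrow> (real \<Rightarrow> real)
      \<Rightarrow> (real \<Rightarrow> 'a measure) \<Rightarrow> real set \<Rightarrow> (real \<Rightarrow> real measure) \<Rightarrow> real set \<Rightarrow> (real \<Rightarrow> real) \<Rightarrow> bool" where
  "standing_A M N \<Theta> h Pf D K Lh ph \<longleftrightarrow>
     (\<forall>\<theta>\<in>D. \<forall>n\<ge>1. distr (Pf \<theta>) borel (interarrival N n) = K (h \<theta>)) \<and>
     Lh \<in> sets borel \<and> Lh \<subseteq> D \<and> measure (distr M borel \<Theta>) Lh = 0 \<and>
     (\<exists>C. integrable (distr M borel (\<lambda>\<omega>. h (\<Theta> \<omega>))) C \<and>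
        (\<forall>\<theta>\<in>D - Lh.
           let F = (\<lambda>t. measure (Pf \<theta>) {\<omega>\<in>space M. interarrival N 1 \<omega> \<le> t}) in
             (\<forall>t>0. F differentiable at t) \<and>
             continuous_on {0<..} (deriv F) \<and>
             (\<forall>t>0. 0 < deriv F t \<and> deriv F t < C (h \<theta>)) \<and>
             (deriv F \<longlongrightarrow> ph \<theta>) (at_right 0))) \<and>
     (\<forall>\<theta>\<in>D - Lh. 0 < ph \<theta>) \<and> inj_on ph (D - Lh)"

end

theory Submission
  imports Defs
begin

text \<open>
  Under almost every kernel \<open>Q y\<close> the process is a renewal process whose interarrival density tends to \<open>y\<close>
  at \<open>0\<close>: conditional independence given \<open>\<Theta>\<close> becomes, through the consistent disintegration, independence
  under the kernels. Each of the four conditions is equivalent to the interarrival times being exponential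
  with parameter \<open>y\<close> under almost every \<open>Q y\<close>, which makes \<open>N\<close> a Poisson process by conditioning on the
  first arrival. Only the condition on the mixing law \<open>U\<close> is unconditional. There the
  finite-dimensional distributions determine the unconditional law of the interarrival times, which is thus
  a mixture both of products of exponential laws and of products of the kernels' interarrival laws.
  Comparing the second moments of \<open>G(s + t) - G(s) G(t)\<close>, where \<open>G\<close> is the survival function of an interarrival
  time, shows that almost every kernel has a multiplicative, hence exponential, survival function.
  Measurability of \<open>y \<mapsto> Q y\<close> rests on the Lusin--Souslin theorem: injective Borel images of Borel sets
  are Borel.
\<close>

section \<open>Injective Borel images of Borel sets\<close>

text \<open>A disintegration must be Borel measurable in its parameter on the whole line, yet
  \<open>Q\<close> runs through the inverse of \<open>ph\<close>, and \<open>ph\<close> is known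
  only as an injective limit of measurable functions; so images under \<open>ph\<close>, not just
  preimages, have to be Borel. The rate is pinned down locally. A survival function that turns out
  to be exponential has some rate, and the limit of its density at 0, which is the parameter by the
  choice of \<open>ph\<close>, leaves only \<open>y\<close>. The mixing law says nothing about a
  single kernel, and its grid probabilities concern counts only. But the event that the arrival
  number \<open>b + 1\<close> comes after time \<open>u\<close> is a finite disjoint union over the
  exact counts at \<open>u\<close>, and in this way grids fix the joint law of interarrival times.
  Second moments then reach the kernels without inverting any transform: a nonnegative function with
  mean zero vanishes almost everywhere. Null sets depend on times and events. Claims are therefore
  made at rational times and for finite index sets first, and continuity or right continuity
  supplies the rest.\<close>

definition uniquely_coded :: "(nat \<Rightarrow> nat) set \<Rightarrow> bool" where
  "uniquely_coded B \<longleftrightarrow> (\<exists>C :: ((nat \<Rightarrow> nat) \<times> (nat \<Rightarrow> nat)) set.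
     closed C \<and> (\<forall>x\<in>B. \<exists>!w. (x, w) \<in> C) \<and> (\<forall>x w. (x, w) \<in> C \<longrightarrow> x \<in> B))"

lemma closed_vimage_coordinate: "closed {z::nat \<Rightarrow> nat. z i \<in> A}"
proof -
  have "closed ((\<lambda>z::nat \<Rightarrow> nat. z i) -` A)"
    by (intro closed_vimage) (simp_all add: closed_def Topological_Spaces.open_discrete)
  then show ?thesis by (simp add: vimage_def)
qed

lemma open_vimage_coordinate: "open {z::nat \<Rightarrow> nat. z i \<in> A}"
  using closed_vimage_coordinate[of i "- A"] by (simp add: closed_def Collect_neg_eq[symmetric])

text \<open>A set with unique codes is a bijective projection of a closed set of pairs, the form in
  which images of Borel sets are analysed below. For a closed set one constant code serves all
  points.\<close>

lemma uniquely_coded_closed: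
  assumes "closed B"
  shows "uniquely_coded B"
proof -
  have "{\<lambda>_::nat. 0::nat} = (\<Inter>i. {z. z i \<in> {0}})" by auto
  also have "closed \<dots>" by (intro closed_INT ballI closed_vimage_coordinate)
  finally have "closed {\<lambda>_::nat. 0::nat}" .
  then show ?thesis
    unfolding uniquely_coded_def
    by (intro exI[of _ "B \<times> {\<lambda>_::nat. 0::nat}"]) (auto intro!: closed_Times assms)
qed

lemma continuous_on_precomp:
  "continuous_on S (\<lambda>p. (fst p :: nat \<Rightarrow> nat, \<lambda>k. (snd p :: nat \<Rightarrow> nat) (f k)))"
  by (rule continuous_on_Pair[OF continuous_on_fst[OF continuous_on_id]
      continuous_on_coordinatewise_then_product[OF
        continuous_on_product_then_coordinatewise[OF continuous_on_snd[OF continuous_on_id]]]])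

text \<open>One sequence carries codes for all the sets at once, the \<open>n\<close>-th on the
  track of indices \<open>prod_encode (n, k)\<close>. Every index lies on exactly one track, so
  uniqueness on each track makes the whole code unique.\<close>

lemma uniquely_coded_INT:
  assumes "\<And>n::nat. uniquely_coded (B n)"
  shows "uniquely_coded (\<Inter>n. B n)"
proof -
  have "\<forall>n. \<exists>C :: ((nat \<Rightarrow> nat) \<times> (nat \<Rightarrow> nat)) set. closed C \<and> (\<forall>x\<in>B n. \<exists>!w. (x, w) \<in> C) \<and> (\<forall>x w. (x, w) \<in> C \<longrightarrow> x \<in> B n)"
    by (rule allI) (rule assms(1)[unfolded uniquely_coded_def])
  from choice[OF this] obtain C :: "nat \<Rightarrow> ((nat \<Rightarrow> nat) \<times> (nat \<Rightarrow> nat)) set" where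
    "\<forall>n. closed (C n) \<and> (\<forall>x\<in>B n. \<exists>!w. (x, w) \<in> C n) \<and>
      (\<forall>x w. (x, w) \<in> C n \<longrightarrow> x \<in> B n)" ..
  then have C: "\<And>n. closed (C n)" "\<And>n x. x \<in> B n \<Longrightarrow> \<exists>!w. (x, w) \<in> C n"
      "\<And>n x w. (x, w) \<in> C n \<Longrightarrow> x \<in> B n" by blast+
  define S where "S n w = (\<lambda>k. w (prod_encode (n, k)) :: nat)" for n and w :: "nat \<Rightarrow> nat"
  let ?C = "\<Inter>n. (\<lambda>p. (fst p, S n (snd p))) -` C n"
  have "closed ?C"
    unfolding S_def by (intro closed_INT ballI closed_vimage C continuous_on_precomp)
  moreover have "\<exists>!w. (x, w) \<in> ?C" if x: "x \<in> (\<Inter>n. B n)" for x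
  proof -
    have "\<forall>n. \<exists>w. (x, w) \<in> C n" using x C(2) by blast
    then obtain w where w: "\<And>n. (x, w n) \<in> C n" by metis
    have "S n (\<lambda>i. w (fst (prod_decode i)) (snd (prod_decode i))) = w n" for n
      by (simp add: S_def)
    then have "(x, \<lambda>i. w (fst (prod_decode i)) (snd (prod_decode i))) \<in> ?C" using w by simp
    moreover have "v = v'" if v: "(x, v) \<in> ?C" "(x, v') \<in> ?C" for v v'
    proof
      fix i
      obtain n k where i: "i = prod_encode (n, k)" by (metis prod_decode_inverse surj_pair)
      have "S n v = S n v'" using v C(2)[of x n] x by auto
      then show "v i = v' i" unfolding i S_def by metis
    qed
    ultimately show ?thesis by blast
  qed
  moreover have "x \<in> (\<Inter>n. B n)" if "(x, w) \<in> ?C" for x w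
    using that C(3) by auto
  ultimately show ?thesis
    unfolding uniquely_coded_def by (intro exI[of _ ?C] conjI ballI allI impI)
qed

lemma uniquely_coded_Int:
  assumes "uniquely_coded A" "uniquely_coded B"
  shows "uniquely_coded (A \<inter> B)"
proof -
  have "uniquely_coded (\<Inter>n::nat. if n = 0 then A else B)"
    by (rule uniquely_coded_INT) (simp add: assms)
  moreover have "(\<Inter>n::nat. if n = 0 then A else B) = A \<inter> B"
    by (auto split: if_splits)
  ultimately show ?thesis by simp
qed

text \<open>The first entry of a code names the member of the family and the tail is a code within
  that member. Disjointness makes the first entry unique.\<close>

lemma uniquely_coded_UN:
  assumes "\<And>n::nat. uniquely_coded (B n)" and disj: "disjoint_family B"
  shows "uniquely_coded (\<Union>n. B n)"
proof -
  have "\<forall>n. \<exists>C :: ((nat \<Rightarrow> nat) \<times> (nat \<Rightarrow> nat)) set. closed C \<and> (\<forall>x\<in>B n. \<exists>!w. (x, w) \<in> C) \<and> (\<forall>x w. (x, w) \<in> C \<longrightarrow> x \<in> B n)"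
    by (rule allI) (rule assms(1)[unfolded uniquely_coded_def])
  from choice[OF this] obtain C :: "nat \<Rightarrow> ((nat \<Rightarrow> nat) \<times> (nat \<Rightarrow> nat)) set" where
    "\<forall>n. closed (C n) \<and> (\<forall>x\<in>B n. \<exists>!w. (x, w) \<in> C n) \<and>
      (\<forall>x w. (x, w) \<in> C n \<longrightarrow> x \<in> B n)" ..
  then have C: "\<And>n. closed (C n)" "\<And>n x. x \<in> B n \<Longrightarrow> \<exists>!w. (x, w) \<in> C n"
      "\<And>n x w. (x, w) \<in> C n \<Longrightarrow> x \<in> B n" by blast+
  \<comment> \<open>This is the intersection of the conditions "if the first entry is
    \<open>n\<close>, then the tail is a code in \<open>C n\<close>". Each is closed because its
    premise is clopen.\<close>
  let ?C = "\<Inter>n. ((\<lambda>p. snd p 0) -` (- {n})) \<union> ((\<lambda>p. (fst p, \<lambda>k. snd p (Suc k))) -` C n)"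
  have mem: "(x, w) \<in> ?C \<longleftrightarrow> (x, \<lambda>k. w (Suc k)) \<in> C (w 0)" for x w by auto
  have "closed ?C"
  proof (intro closed_INT ballI closed_Un closed_vimage C continuous_on_precomp)
    show "continuous_on UNIV (\<lambda>p :: (nat \<Rightarrow> nat) \<times> (nat \<Rightarrow> nat). snd p 0)"
      by (rule continuous_on_product_then_coordinatewise[OF continuous_on_snd[OF continuous_on_id]])
  qed (simp add: closed_def Topological_Spaces.open_discrete)
  moreover have "\<exists>!w. (x, w) \<in> ?C" if x: "x \<in> (\<Union>n. B n)" for x
  proof -
    obtain n where n: "x \<in> B n" using x by auto
    obtain w where w: "(x, w) \<in> C n" using C(2) n by blast
    have "(x, case_nat n w) \<in> ?C" unfolding mem using w by simp
    moreover have "v = v'" if v: "(x, v) \<in> ?C" "(x, v') \<in> ?C" for v v'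
    proof
      fix i
      have "v 0 = n" "v' 0 = n"
        using v n C(3) disj unfolding mem disjoint_family_on_def by blast+
      then show "v i = v' i"
        using v C(2)[OF n] unfolding mem by (cases i) (auto dest: fun_cong)
    qed
    ultimately show ?thesis by blast
  qed
  moreover have "x \<in> (\<Union>n. B n)" if "(x, w) \<in> ?C" for x w
    using that C(3) unfolding mem by blast
  ultimately show ?thesis
    unfolding uniquely_coded_def by (intro exI[of _ ?C] conjI ballI allI impI)
qed

text \<open>These generators are clopen, so a generator and its complement are both closed at the
  start of the induction over Borel sets.\<close>

lemma borel_baire_generated:
  "sets (borel :: (nat \<Rightarrow> nat) measure) = sigma_sets UNIV (range (\<lambda>(i, j). {z. z i = j}))"
    (is "_ = ?S")
proof
  let ?M = "sigma UNIV (range (\<lambda>(i, j). {z :: nat \<Rightarrow> nat. z i = j}))"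
  have "(\<lambda>z. z) \<in> measurable ?M (PiM UNIV (\<lambda>_. borel))"
  proof (rule measurable_PiM_single')
    fix i :: nat
    show "(\<lambda>z. z i) \<in> borel_measurable ?M"
    proof (rule measurableI)
      fix A :: "nat set"
      have "(\<lambda>z. z i) -` A \<inter> space ?M = (\<Union>j\<in>A. {z. z i = j})" by auto
      also have "\<dots> \<in> sets ?M"
        by (intro sets.countable_UN'' countableI_type) auto
      finally show "(\<lambda>z. z i) -` A \<inter> space ?M \<in> sets ?M" .
    qed simp
  qed (simp add: space_PiM)
  then have "sets (PiM UNIV (\<lambda>_. borel :: nat measure)) \<subseteq> sets ?M"
    by (auto dest!: measurable_sets simp: space_PiM)
  then show "sets (borel :: (nat \<Rightarrow> nat) measure) \<subseteq> ?S"
    by (simp add: sets_PiM_equal_borel)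
next
  have "(\<lambda>z::nat \<Rightarrow> nat. z i) -` {j} \<inter> space borel \<in> sets borel" for i j
    by (rule measurable_sets[of _ _ borel])
       (auto intro!: borel_measurable_continuous_onI continuous_on_product_then_coordinatewise)
  moreover have "(\<lambda>z::nat \<Rightarrow> nat. z i) -` {j} \<inter> space borel = {z. z i = j}" for i j by auto
  ultimately show "?S \<subseteq> sets borel"
    by (intro sets.sigma_sets_subset') auto
qed

text \<open>The induction treats a set together with its complement: unique codes pass to disjoint
  unions only, and making a union disjoint intersects each member with the complements of the
  earlier ones.\<close>

lemma uniquely_coded_borel:
  assumes "B \<in> sets borel"
  shows "uniquely_coded B"
proof -
  have "B \<in> sigma_sets UNIV (range (\<lambda>(i, j). {z. z i = j}))"
    using assms borel_baire_generated by simp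
  then have "uniquely_coded B \<and> uniquely_coded (- B)"
  proof induction
    case (Basic a)
    then obtain i j where a: "a = {z. z i \<in> {j}}" by auto
    have "closed a" "closed (- a)"
      unfolding a using closed_vimage_coordinate[of i "{j}"] open_vimage_coordinate[of i "{j}"]
      by (simp_all add: closed_def)
    then show ?case using uniquely_coded_closed by blast
  next
    case Empty
    then show ?case by (simp add: uniquely_coded_closed)
  next
    case (Compl a)
    then show ?case by (simp add: Compl_eq_Diff_UNIV[symmetric])
  next
    case (Union a)
    define b where "b n = (\<Inter>i. if i < n then - a i else UNIV)" for n :: nat
    have "uniquely_coded (if i < n then - a i else UNIV)" for i n
      using Union uniquely_coded_closed[OF closed_UNIV] by simp
    then have "uniquely_coded (b n)" for n
      unfolding b_def by (rule uniquely_coded_INT)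
    then have "uniquely_coded (a n \<inter> b n)" for n
      using Union by (intro uniquely_coded_Int) auto
    moreover have "x \<in> b n \<longleftrightarrow> (\<forall>i<n. x \<notin> a i)" for x n
      unfolding b_def by (subst INT_iff) auto
    then have d: "a n \<inter> b n = disjointed a n" for n
      by (auto simp: disjointed_def)
    ultimately have "uniquely_coded (\<Union>n. disjointed a n)"
      by (intro uniquely_coded_UN disjoint_family_disjointed) auto
    moreover have "- (\<Union>n. a n) = (\<Inter>n. - a n)" by auto
    ultimately show ?case
      using Union by (auto simp: UN_disjointed_eq intro!: uniquely_coded_INT)
  qed
  then show ?thesis ..
qed

section \<open>Borel separation of disjoint continuous images\<close>

definition borel_separated :: "'a::topological_space set \<Rightarrow> 'a set \<Rightarrow> bool" where
  "borel_separated A B \<longleftrightarrow> (\<exists>E\<in>sets borel. A \<subseteq> E \<and> B \<inter> E = {})"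

text \<open>Needed in contrapositive form: inseparable unions contain an inseparable pair of
  members, which drives the branching in \<open>borel_separated_images\<close>.\<close>

lemma borel_separated_UN:
  assumes "\<And>(i::nat) (j::nat). borel_separated (A i) (B j)"
  shows "borel_separated (\<Union>i. A i) (\<Union>j. B j)"
proof -
  define E where "E i j = (SOME E. E \<in> sets borel \<and> A i \<subseteq> E \<and> B j \<inter> E = {})" for i j
  have E: "E i j \<in> sets borel" "A i \<subseteq> E i j" "B j \<inter> E i j = {}" for i j
    using someI_ex[OF assms[of i j, unfolded borel_separated_def Bex_def], folded E_def] by simp_all
  have "(\<Union>i. \<Inter>j. E i j) \<in> sets borel"
    by (intro sets.countable_UN'' sets.countable_INT'' countableI_type E(1)) simp_all
  moreover have "(\<Union>i. A i) \<subseteq> (\<Union>i. \<Inter>j. E i j)" using E(2) by blast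
  moreover have "(\<Union>j. B j) \<inter> (\<Union>i. \<Inter>j. E i j) = {}" using E(3) by blast
  ultimately show ?thesis
    unfolding borel_separated_def by (intro bexI[of _ "\<Union>i. \<Inter>j. E i j"] conjI)
qed

definition cylinder :: "nat list \<Rightarrow> (nat \<Rightarrow> nat) set" where
  "cylinder s = {z. \<forall>i<length s. z i = s ! i}"

lemma cylinder_snoc: "cylinder (s @ [k]) = {z \<in> cylinder s. z (length s) = k}"
  by (auto simp: cylinder_def nth_append less_Suc_eq)

lemma cylinderD: "z \<in> cylinder s \<Longrightarrow> s = map z [0..<length s]"
  by (rule nth_equalityI) (simp_all add: cylinder_def)

lemma in_cylinder_prefix: "x \<in> cylinder (map z [0..<n]) \<longleftrightarrow> (\<forall>i<n. x i = z i)"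
  by (auto simp: cylinder_def)

lemma open_contains_cylinder:
  assumes "open U" "z \<in> U"
  obtains n where "cylinder (map z [0..<n]) \<subseteq> U"
proof -
  have "openin (product_topology (\<lambda>_. euclidean) UNIV) U"
    using assms by (simp add: open_fun_def)
  then obtain X where X: "z \<in> Pi\<^sub>E UNIV X" "finite {i. X i \<noteq> UNIV}" "Pi\<^sub>E UNIV X \<subseteq> U"
    using product_topology_open_contains_basis[of "\<lambda>_. euclidean" UNIV U z] assms by auto
  obtain n where n: "\<And>i. X i \<noteq> UNIV \<Longrightarrow> i < n"
    using X(2) finite_nat_set_iff_bounded by auto
  have "cylinder (map z [0..<n]) \<subseteq> Pi\<^sub>E UNIV X"
  proof
    fix x assume "x \<in> cylinder (map z [0..<n])"
    then have x: "x i = z i" if "i < n" for i using that by (simp add: in_cylinder_prefix)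
    have "x i \<in> X i" for i
      using x[of i] n[of i] X(1) by (cases "i < n") (auto simp: PiE_def Pi_def)
    then show "x \<in> Pi\<^sub>E UNIV X" by auto
  qed
  then show ?thesis using that X(3) by blast
qed

lemma closed_meets_cylinders:
  assumes "closed C" "\<And>n. C \<inter> cylinder (map z [0..<n]) \<noteq> {}"
  shows "z \<in> C"
proof (rule ccontr)
  assume "z \<notin> C"
  then obtain n where "cylinder (map z [0..<n]) \<subseteq> - C"
    using open_contains_cylinder[of "- C" z] assms(1) by (auto simp: closed_def)
  then show False using assms(2)[of n] by auto
qed

text \<open>Lusin separation by contradiction. An inseparable pair of pieces has an inseparable pair
  of one-step extensions, so two infinite branches \<open>x\<close> and \<open>y\<close> arise.
  Closedness puts both into \<open>C\<close>, and disjointness gives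
  \<open>g x \<noteq> g y\<close>. By continuity the images of long enough initial segments are
  separated by the value of one coordinate, a contradiction. Equal lengths let both branches share
  one index.\<close>

lemma borel_separated_images:
  fixes g :: "(nat \<Rightarrow> nat) \<Rightarrow> nat \<Rightarrow> nat"
  assumes C: "closed C" and g: "continuous_on UNIV g" and disj: "g ` (C \<inter> cylinder s) \<inter> g ` (C \<inter> cylinder t) = {}"
    and len: "length s = length t"
  shows "borel_separated (g ` (C \<inter> cylinder s)) (g ` (C \<inter> cylinder t))"
proof (rule ccontr)
  assume neg: "\<not> ?thesis"
  define m where "m = length s"
  define sep where "sep u v \<longleftrightarrow> borel_separated (g ` (C \<inter> cylinder u)) (g ` (C \<inter> cylinder v))" for u v
  have step: "\<exists>i j. \<not> sep (u @ [i]) (v @ [j])" if "\<not> sep u v" for u v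
  proof (rule ccontr)
    assume "\<not> ?thesis"
    then have s: "borel_separated (\<Union>i. g ` (C \<inter> cylinder (u @ [i]))) (\<Union>j. g ` (C \<inter> cylinder (v @ [j])))"
      unfolding sep_def by (intro borel_separated_UN) blast
    have eq: "g ` (C \<inter> cylinder w) = (\<Union>i. g ` (C \<inter> cylinder (w @ [i])))" for w
    proof -
      have "C \<inter> cylinder w = (\<Union>i. C \<inter> cylinder (w @ [i]))" by (auto simp: cylinder_snoc)
      then show ?thesis by (simp only: image_UN)
    qed
    show False using that s unfolding sep_def eq[of u, symmetric] eq[of v, symmetric] by (rule notE)
  qed
  define F where "F = rec_nat (s, t) (\<lambda>_ (u, v). let (i, j) = SOME (i, j). \<not> sep (u @ [i]) (v @ [j])
      in (u @ [i], v @ [j]))"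
  have FS: "\<exists>i j. F (Suc n) = (fst (F n) @ [i], snd (F n) @ [j]) \<and> \<not> sep (fst (F n) @ [i]) (snd (F n) @ [j])"
    if "\<not> sep (fst (F n)) (snd (F n))" for n
  proof -
    obtain u v where uv: "F n = (u, v)" by (cases "F n")
    obtain i j where ij: "(SOME (i, j). \<not> sep (u @ [i]) (v @ [j])) = (i, j)"
      by (cases "SOME (i, j). \<not> sep (u @ [i]) (v @ [j])")
    have "\<exists>p. case p of (i, j) \<Rightarrow> \<not> sep (u @ [i]) (v @ [j])"
      using step[of u v] that uv by auto
    from someI_ex[OF this] have "\<not> sep (u @ [i]) (v @ [j])" unfolding ij by simp
    moreover have "F (Suc n) = (u @ [i], v @ [j])"
      using uv ij by (simp add: F_def)
    ultimately show ?thesis using uv by auto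
  qed
  have nsep: "\<not> sep (fst (F n)) (snd (F n))" for n
  proof (induction n)
    case 0
    then show ?case using neg by (simp add: F_def sep_def)
  next
    case (Suc n)
    then show ?case using FS[of n] by auto
  qed
  have ext: "\<exists>i j. F (Suc n) = (fst (F n) @ [i], snd (F n) @ [j])" for n
    using FS[OF nsep[of n]] by blast
  have len': "length (fst (F n)) = m + n" "length (snd (F n)) = m + n" for n
  proof (induction n)
    case (Suc n)
    { case 1 then show ?case using ext[of n] Suc by auto }
    { case 2 then show ?case using ext[of n] Suc by auto }
  qed (simp_all add: F_def m_def len)
  have pre: "i < m + n \<Longrightarrow> fst (F (n + k)) ! i = fst (F n) ! i \<and> snd (F (n + k)) ! i = snd (F n) ! i" for i n k
  proof (induction k)
    case (Suc k)
    then show ?case using ext[of "n + k"] len'[of "n + k"] by (auto simp: nth_append)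
  qed simp
  \<comment> \<open>The lists only grow at their ends, so every entry is final once it appears and
    the lists define infinite branches.\<close>
  define x where "x i = fst (F (Suc i)) ! i" for i
  define y where "y i = snd (F (Suc i)) ! i" for i
  have agree: "fst (F n) ! i = x i" "snd (F n) ! i = y i" if "i < n" for i n
    using pre[of i "Suc i" "n - Suc i"] that by (simp_all add: x_def y_def)
  have sub: "cylinder (fst (F n)) \<subseteq> cylinder (map x [0..<n])" "cylinder (snd (F n)) \<subseteq> cylinder (map y [0..<n])" for n
    using len' agree by (auto simp: in_cylinder_prefix cylinder_def)
  have mono: "cylinder (map z [0..<n + k]) \<subseteq> cylinder (map z [0..<n])" for z n k
    by (auto simp: in_cylinder_prefix)
  have ne: "C \<inter> cylinder (fst (F n)) \<noteq> {}" "C \<inter> cylinder (snd (F n)) \<noteq> {}" for n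
    using nsep[of n] by (auto simp: sep_def borel_separated_def)
  have xC: "x \<in> C" and yC: "y \<in> C"
    using ne sub by (auto intro!: closed_meets_cylinders[OF C]) blast+
  have "x \<in> cylinder s"
  proof -
    have "x i = s ! i" if "i < m" for i
      using pre[of i 0 "Suc i"] that by (simp add: x_def F_def)
    then show ?thesis by (auto simp: cylinder_def m_def)
  qed
  moreover have "y \<in> cylinder t"
  proof -
    have "y i = t ! i" if "i < m" for i
      using pre[of i 0 "Suc i"] that by (simp add: y_def F_def)
    then show ?thesis by (auto simp: cylinder_def m_def len)
  qed
  ultimately have "g x \<noteq> g y" using xC yC disj by auto
  then obtain i where i: "g x i \<noteq> g y i" by blast
  have op: "open (g -` {z. z i \<in> A})" for A
    by (intro open_vimage open_vimage_coordinate g)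
  obtain n1 where n1: "cylinder (map x [0..<n1]) \<subseteq> g -` {z. z i \<in> {g x i}}"
    using open_contains_cylinder[OF op, of x "{g x i}"] by auto
  obtain n2 where n2: "cylinder (map y [0..<n2]) \<subseteq> g -` {z. z i \<in> - {g x i}}"
    using open_contains_cylinder[OF op, of y "- {g x i}"] i by auto
  have "cylinder (fst (F (n1 + n2))) \<subseteq> g -` {z. z i \<in> {g x i}}"
    using sub(1)[of "n1 + n2"] mono[of x n1 n2] n1 by blast
  moreover have "cylinder (snd (F (n1 + n2))) \<subseteq> g -` {z. z i \<in> - {g x i}}"
    using sub(2)[of "n1 + n2"] mono[of y n2 n1] n2 by (auto simp: add.commute)
  ultimately have "sep (fst (F (n1 + n2))) (snd (F (n1 + n2)))"
    unfolding sep_def borel_separated_def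
    by (intro bexI[of _ "{z. z i \<in> {g x i}}"] borel_open open_vimage_coordinate) auto
  then show False using nsep by blast
qed

text \<open>By injectivity, images of pieces with different prefixes of equal length are disjoint,
  hence separable, and they can be enlarged to Borel sets \<open>B s\<close> that are disjoint on
  each level. A point lying in some \<open>B s\<close> on every level selects one infinite branch
  \<open>z\<close>, and the closures inside the sets \<open>B s\<close> force the point to be
  \<open>g z\<close>.\<close>

lemma continuous_injective_image_borel:
  fixes g :: "(nat \<Rightarrow> nat) \<Rightarrow> nat \<Rightarrow> nat"
  assumes C: "closed C" and g: "continuous_on UNIV g" and inj: "inj_on g C"
  shows "g ` C \<in> sets borel"
proof -
  have "borel_separated (g ` (C \<inter> cylinder s)) (g ` (C \<inter> cylinder t))"
    if "s \<noteq> t" "length s = length t" for s t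
  proof (rule borel_separated_images[OF C g _ that(2)])
    have "z \<notin> cylinder t" if "z \<in> cylinder s" for z
      using cylinderD[of z s] cylinderD[of z t] that \<open>s \<noteq> t\<close> \<open>length s = length t\<close> by metis
    then show "g ` (C \<inter> cylinder s) \<inter> g ` (C \<inter> cylinder t) = {}"
      using inj by (auto dest!: inj_onD)
  qed
  note separated = this
  define E where "E s t = (SOME E. E \<in> sets borel \<and> g ` (C \<inter> cylinder s) \<subseteq> E \<and> g ` (C \<inter> cylinder t) \<inter> E = {})" for s t
  have E: "E s t \<in> sets borel" "g ` (C \<inter> cylinder s) \<subseteq> E s t" "g ` (C \<inter> cylinder t) \<inter> E s t = {}"
    if "s \<noteq> t" "length s = length t" for s t
    using someI_ex[OF separated[OF that, unfolded borel_separated_def Bex_def], folded E_def] by simp_all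
  \<comment> \<open>Removing \<open>E t s\<close> makes \<open>sep s t\<close> and
    \<open>sep t s\<close> disjoint, while \<open>sep s t\<close> still contains the image of the
    piece of \<open>s\<close>. Lists of another length impose no condition.\<close>
  define sep where "sep s t = (if length t = length s \<and> t \<noteq> s then E s t \<inter> - E t s else UNIV)" for s t
  define B where "B s = closure (g ` (C \<inter> cylinder s)) \<inter> (\<Inter>t. sep s t)" for s
  have "sep s t \<in> sets borel" for s t
    using E(1)[of s t] E(1)[of t s] by (auto simp: sep_def)
  then have B_borel: "B s \<in> sets borel" for s
    unfolding B_def
    by (intro sets.Int[OF borel_closed[OF closed_closure]] sets.countable_INT'' countableI_type) simp_all
  have sub: "g ` (C \<inter> cylinder s) \<subseteq> B s" for s
  proof -
    have "g ` (C \<inter> cylinder s) \<subseteq> sep s t" for t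
    proof (cases "length t = length s \<and> t \<noteq> s")
      case True
      then have st: "s \<noteq> t" "t \<noteq> s" "length s = length t" "length t = length s" by auto
      have "g ` (C \<inter> cylinder s) \<subseteq> E s t \<inter> - E t s"
        using E(2)[OF st(1,3)] E(3)[OF st(2,4)] by (simp add: disjoint_eq_subset_Compl)
      then show ?thesis using True by (simp add: sep_def)
    next
      case False
      then show ?thesis unfolding sep_def by (simp only: if_False subset_UNIV)
    qed
    then show ?thesis
      unfolding B_def by (intro Int_greatest closure_subset INT_greatest)
  qed
  have B_disj: "s = t" if "y \<in> B s" "y \<in> B t" "length s = length t" for s t y
  proof (rule ccontr)
    assume "s \<noteq> t"
    have "y \<in> sep s t" "y \<in> sep t s"
      using that(1,2) unfolding B_def by (simp_all only: Int_iff INT_iff UNIV_I simp_thms ball_simps)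
    then show False using \<open>s \<noteq> t\<close> that(3) by (simp add: sep_def)
  qed
  \<comment> \<open>Membership is required for all prefixes \<open>take k s\<close>: lists chosen on
    different levels then cohere, since prefixes of equal length whose sets share a point coincide
    by \<open>B_disj\<close>.\<close>
  have "g ` C = (\<Inter>n. \<Union>s\<in>{s. length s = n}. \<Inter>k. B (take k s))"
  proof (intro set_eqI iffI)
    fix y assume "y \<in> g ` C"
    then obtain z where z: "z \<in> C" "y = g z" by blast
    have "y \<in> B (take k (map z [0..<n]))" for k n
    proof -
      have "z \<in> cylinder (take k (map z [0..<n]))" by (simp add: cylinder_def)
      then show ?thesis using z sub by blast
    qed
    then show "y \<in> (\<Inter>n. \<Union>s\<in>{s. length s = n}. \<Inter>k. B (take k s))"
      by (intro INT_I UN_I[of "map z [0..<_]"]) simp_all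
  next
    fix y assume "y \<in> (\<Inter>n. \<Union>s\<in>{s. length s = n}. \<Inter>k. B (take k s))"
    then have "\<forall>n. \<exists>s. length s = n \<and> (\<forall>k. y \<in> B (take k s))" by simp
    from choice[OF this] obtain S where "\<forall>n. length (S n) = n \<and> (\<forall>k. y \<in> B (take k (S n)))" ..
    then have S: "\<And>n. length (S n) = n" "\<And>n k. y \<in> B (take k (S n))" by simp_all
    have S_take: "take n (S (Suc n)) = S n" for n
    proof (rule B_disj[of y])
      show "y \<in> B (take n (S (Suc n)))" by (rule S(2))
      show "y \<in> B (S n)" using S(2)[of n n] by (simp add: S(1))
    qed (simp add: S(1))
    have coh: "take n (S (n + k)) = S n" for n k
    proof (induction k)
      case (Suc k)
      have "take n (S (n + k)) = take n (take (n + k) (S (Suc (n + k))))" by (simp only: S_take)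
      then show ?case using Suc by (simp add: min_def)
    qed (simp add: S(1))
    define z where "z i = S (Suc i) ! i" for i
    have Sz: "S n = map z [0..<n]" for n
    proof (rule nth_equalityI)
      fix i assume "i < length (S n)"
      then have "i < n" by (simp add: S)
      then show "S n ! i = map z [0..<n] ! i"
        using coh[of "Suc i" "n - Suc i", symmetric] by (simp add: z_def)
    qed (simp add: S)
    have yB: "y \<in> B (map z [0..<n])" for n
      using S(2)[of n n] by (simp add: S(1) Sz[symmetric])
    then have cl: "y \<in> closure (g ` (C \<inter> cylinder (map z [0..<n])))" for n
      unfolding B_def by blast
    have "C \<inter> cylinder (map z [0..<n]) \<noteq> {}" for n using cl[of n] by auto
    then have "z \<in> C" by (rule closed_meets_cylinders[OF C])
    moreover have "y = g z"
    proof
      fix i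
      have "open (g -` {u. u i \<in> {g z i}})" by (intro open_vimage open_vimage_coordinate g)
      then obtain n where n: "cylinder (map z [0..<n]) \<subseteq> g -` {u. u i \<in> {g z i}}"
        using open_contains_cylinder[of "g -` {u. u i \<in> {g z i}}" z] by auto
      have "closure (g ` (C \<inter> cylinder (map z [0..<n]))) \<subseteq> {u. u i \<in> {g z i}}"
        using n by (intro closure_minimal closed_vimage_coordinate) auto
      then show "y i = g z i" using cl[of n] by auto
    qed
    ultimately show "y \<in> g ` C" by blast
  qed
  also have "\<dots> \<in> sets borel"
    by (intro sets.countable_INT'' sets.countable_UN'' countableI_type B_borel) simp_all
  finally show ?thesis .
qed

section \<open>Coding real numbers in Baire space\<close>

definition cut_code :: "real \<Rightarrow> nat \<Rightarrow> nat" where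
  "cut_code x i = (if x < of_rat (from_nat i) then 1 else 0)"

definition cut_decode :: "(nat \<Rightarrow> nat) \<Rightarrow> real" where
  "cut_decode z = real_of_ereal (INF i. if z i = 1 then ereal (of_rat (from_nat i)) else \<infinity>)"

text \<open>The code of \<open>x\<close> marks the rationals above \<open>x\<close>, and their
  infimum is \<open>x\<close> by density. The code is not continuous; what counts is that coding and
  decoding are measurable.\<close>

lemma cut_decode_code: "cut_decode (cut_code x) = x"
proof -
  have "(INF i. if cut_code x i = 1 then ereal (of_rat (from_nat i)) else \<infinity>) = ereal x"
  proof (rule antisym)
    show "ereal x \<le> (INF i. if cut_code x i = 1 then ereal (of_rat (from_nat i)) else \<infinity>)"
      by (rule INF_greatest) (simp add: cut_code_def)
    show "(INF i. if cut_code x i = 1 then ereal (of_rat (from_nat i)) else \<infinity>) \<le> ereal x"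
    proof (rule ereal_le_epsilon2)
      fix e :: real assume "0 < e"
      then obtain r where r: "x < of_rat r" "of_rat r < x + e"
        using of_rat_dense[of x "x + e"] by auto
      obtain i where i: "r = from_nat i" by (metis from_nat_to_nat)
      have "(INF i. if cut_code x i = 1 then ereal (of_rat (from_nat i)) else \<infinity>) \<le> ereal (of_rat r)"
        using r i by (intro INF_lower2[of i]) (auto simp: cut_code_def)
      also have "\<dots> \<le> ereal x + ereal e" using r by simp
      finally show "(INF i. if cut_code x i = 1 then ereal (of_rat (from_nat i)) else \<infinity>) \<le> ereal x + ereal e" .
    qed
  qed
  then show ?thesis by (simp add: cut_decode_def)
qed

lemma inj_cut_code: "inj cut_code"
  by (metis cut_decode_code injI)

lemma coordinate_measurable_baire: "(\<lambda>z::nat \<Rightarrow> nat. z i) \<in> measurable borel borel"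
  by (intro borel_measurable_continuous_onI) simp

lemma measurable_into_baire:
  fixes f :: "'a \<Rightarrow> nat \<Rightarrow> nat"
  assumes "\<And>i. (\<lambda>x. f x i) \<in> measurable M borel"
  shows "f \<in> measurable M borel"
proof -
  have "f \<in> measurable M (PiM UNIV (\<lambda>_. borel))"
    by (rule measurable_PiM_single') (simp_all add: assms)
  then show ?thesis
    by (simp add: measurable_cong_sets[OF refl sets_PiM_equal_borel])
qed

lemma cut_code_measurable: "cut_code \<in> measurable borel borel"
  unfolding cut_code_def[abs_def] by (intro measurable_into_baire) measurable

lemma cut_decode_measurable: "cut_decode \<in> borel_measurable borel"
proof -
  note [measurable] = coordinate_measurable_baire
  show ?thesis unfolding cut_decode_def[abs_def] by measurable
qed

text \<open>The graph of \<open>f\<close>, coded in Baire space, is Borel, and its projection to the second coordinate is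
  injective on it.\<close>

theorem injective_borel_image:
  fixes f :: "real \<Rightarrow> real"
  assumes A: "A \<in> sets borel" and f: "f \<in> borel_measurable (restrict_space borel A)" and inj: "inj_on f A"
  shows "f ` A \<in> sets borel"
proof -
  define f' where "f' x = (if x \<in> A then f x else 0)" for x
  have f' [measurable]: "f' \<in> borel_measurable borel"
    unfolding f'_def using f A by (subst measurable_If_restrict_space_iff) auto
  define ev where "ev z = (\<lambda>i. z (2 * i))" for z :: "nat \<Rightarrow> nat"
  define od where "od z = (\<lambda>i. z (2 * i + 1))" for z :: "nat \<Rightarrow> nat"
  define join where "join x y = (\<lambda>i. if even i then x (i div 2) else y (i div 2))" for x y :: "nat \<Rightarrow> nat"
  have ev_join [simp]: "ev (join x y) = x" and od_join [simp]: "od (join x y) = y" for x y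
    by (simp_all add: ev_def od_def join_def)
  have join_ev_od: "join (ev z) (od z) = z" for z
    by (rule ext) (auto simp: join_def ev_def od_def elim: oddE)
  note [measurable] = coordinate_measurable_baire cut_decode_measurable cut_code_measurable
  have comp_meas [measurable]: "(\<lambda>x. cut_code x i) \<in> measurable borel borel" for i
    using measurable_compose[OF cut_code_measurable coordinate_measurable_baire] .
  define G where "G x = join (cut_code x) (cut_code (f' x))" for x
  have G [measurable]: "G \<in> measurable borel borel"
    unfolding G_def join_def by (intro measurable_into_baire) measurable
  define dec where "dec z = cut_decode (ev z)" for z
  have [measurable]: "ev \<in> measurable borel borel"
    unfolding ev_def by (intro measurable_into_baire) measurable
  have dec [measurable]: "dec \<in> borel_measurable borel"
    unfolding dec_def by measurable
  have dec_G: "dec (G x) = x" for x by (simp add: dec_def G_def cut_decode_code)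
  \<comment> \<open>Membership is tested by decoding and encoding again. The coded graph is thus an
    equality set of measurable maps, and no image has to be formed at this point.\<close>
  have GA: "G ` A = dec -` A \<inter> (\<Inter>i. {z. z i = G (dec z) i})"
  proof (intro set_eqI iffI)
    fix z assume "z \<in> dec -` A \<inter> (\<Inter>i. {z. z i = G (dec z) i})"
    then have "dec z \<in> A" "z = G (dec z)" by auto
    then show "z \<in> G ` A" by blast
  qed (auto simp: dec_G)
  have Gd: "(\<lambda>z. G (dec z) i) \<in> measurable borel borel" for i
    using measurable_compose[OF measurable_compose[OF dec G] coordinate_measurable_baire] .
  have "{z. z i = G (dec z) i} \<in> sets borel" for i
    using borel_measurable_eq[OF coordinate_measurable_baire Gd, of i i] by simp
  moreover have "dec -` A \<in> sets borel" using measurable_sets[OF dec A] by simp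
  ultimately have "G ` A \<in> sets borel"
    unfolding GA by (intro sets.Int sets.countable_INT'' countableI_type) simp_all
  from uniquely_coded_borel[OF this] obtain C :: "((nat \<Rightarrow> nat) \<times> (nat \<Rightarrow> nat)) set"
    where C: "closed C" "\<forall>x\<in>G ` A. \<exists>!w. (x, w) \<in> C" "\<forall>x w. (x, w) \<in> C \<longrightarrow> x \<in> G ` A"
    unfolding uniquely_coded_def by (elim exE conjE)
  \<comment> \<open>A point of \<open>C'\<close> interleaves a coded graph point with its unique
    code, and \<open>g\<close> keeps the coded value of \<open>f\<close>. Injectivity of
    \<open>f\<close> recovers the graph point, and uniqueness of codes recovers the rest.\<close>
  define C' where "C' = (\<lambda>z. (ev z, od z)) -` C"
  define g where "g z = od (ev z)" for z
  have coord: "continuous_on UNIV (\<lambda>z::nat \<Rightarrow> nat. z i)" for i by simp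
  have "continuous_on UNIV (\<lambda>z. (ev z, od z))"
    unfolding ev_def od_def
    by (intro continuous_on_Pair continuous_on_coordinatewise_then_product coord)
  then have closed: "closed C'"
    unfolding C'_def by (intro closed_vimage C)
  have g: "continuous_on UNIV g"
    unfolding g_def ev_def od_def by (intro continuous_on_coordinatewise_then_product coord)
  have C'_D: "\<exists>x\<in>A. ev z = G x \<and> g z = cut_code (f x)" if "z \<in> C'" for z
  proof -
    have "(ev z, od z) \<in> C" using that by (simp add: C'_def)
    then have "ev z \<in> G ` A" using C(3) by blast
    then obtain x where "x \<in> A" "ev z = G x" by blast
    then show ?thesis by (intro bexI[of _ x]) (auto simp: g_def G_def f'_def)
  qed
  have "inj_on g C'"
  proof (rule inj_onI)
    fix z z' assume z: "z \<in> C'" "z' \<in> C'" and eq: "g z = g z'"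
    obtain x where x: "x \<in> A" "ev z = G x" "g z = cut_code (f x)" using C'_D[OF z(1)] by blast
    obtain x' where x': "x' \<in> A" "ev z' = G x'" "g z' = cut_code (f x')" using C'_D[OF z(2)] by blast
    have "f x = f x'" using eq x x' inj_cut_code by (simp add: inj_eq)
    then have "x = x'" using inj x x' by (simp add: inj_on_eq_iff)
    then have ev: "ev z = ev z'" using x x' by simp
    moreover have "od z = od z'"
    proof -
      have "\<exists>!w. (ev z, w) \<in> C" using C(2) x by simp
      moreover have "(ev z, od z) \<in> C" "(ev z, od z') \<in> C" using z ev by (simp_all add: C'_def)
      ultimately show ?thesis by blast
    qed
    ultimately show "z = z'" using join_ev_od by metis
  qed
  from continuous_injective_image_borel[OF closed g this] have "g ` C' \<in> sets borel" .
  moreover have "g ` C' = cut_code ` f ` A"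
  proof (intro set_eqI iffI)
    fix y assume "y \<in> g ` C'"
    then show "y \<in> cut_code ` f ` A" using C'_D by blast
  next
    fix y assume "y \<in> cut_code ` f ` A"
    then obtain x where x: "x \<in> A" "y = cut_code (f x)" by blast
    then obtain w where "(G x, w) \<in> C" using C(2) by blast
    then have "join (G x) w \<in> C'" by (simp add: C'_def)
    moreover have "g (join (G x) w) = y" using x by (simp add: g_def G_def f'_def)
    ultimately show "y \<in> g ` C'" by blast
  qed
  ultimately have "cut_code -` (cut_code ` f ` A) \<inter> space borel \<in> sets borel"
    by (intro measurable_sets[OF cut_code_measurable]) simp
  then show ?thesis by (simp add: inj_vimage_image_eq inj_cut_code)
qed

section \<open>Counting processes and their interarrival times\<close>

context
  fixes M :: "'a measure" and N :: "real \<Rightarrow> 'a \<Rightarrow> ereal"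
  assumes cp: "counting_process M N"
begin

lemma count_range:
  assumes "\<omega> \<in> space M" "0 \<le> t"
  obtains n :: nat where "N t \<omega> = ereal (real n)" | "N t \<omega> = \<infinity>"
  using cp assms unfolding counting_process_def by blast

lemma count_mono:
  assumes "\<omega> \<in> space M" "0 \<le> s" "s \<le> t"
  shows "N s \<omega> \<le> N t \<omega>"
  using cp assms unfolding counting_process_def by (auto dest!: bspec mono_onD[where r = s and s = t])

lemma arrival_set_ne:
  assumes \<omega>: "\<omega> \<in> space M"
  shows "{t. 0 \<le> t \<and> ereal (real n) \<le> N t \<omega>} \<noteq> {}"
proof -
  have "((\<lambda>t. N t \<omega>) \<longlongrightarrow> \<infinity>) at_top"
    using cp \<omega> unfolding counting_process_def by blast
  then have "eventually (\<lambda>t. ereal (real n) < N t \<omega>) at_top"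
    by (rule order_tendstoD) simp
  then have "eventually (\<lambda>t. ereal (real n) < N t \<omega> \<and> 0 \<le> t) at_top"
    using eventually_ge_at_top[of "0::real"] by eventually_elim simp
  then show ?thesis
    by (auto simp: eventually_at_top_linorder intro: less_imp_le)
qed

lemma arrival_nonneg:
  assumes \<omega>: "\<omega> \<in> space M"
  shows "0 \<le> arrival N n \<omega>"
  unfolding arrival_def by (rule cInf_greatest[OF arrival_set_ne[OF \<omega>]]) auto

text \<open>Right continuity turns the infimum into a minimum: the level \<open>n\<close> is reached
  at all later times, and the bound passes to the right limit.\<close>

lemma arrival_attained:
  assumes \<omega>: "\<omega> \<in> space M"
  shows "ereal (real n) \<le> N (arrival N n \<omega>) \<omega>"
proof -
  let ?S = "{t. 0 \<le> t \<and> ereal (real n) \<le> N t \<omega>}" and ?T = "arrival N n \<omega>"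
  have T: "?T = Inf ?S" by (simp add: arrival_def)
  have bdd: "bdd_below ?S" by (rule bdd_belowI[of _ 0]) simp
  have above: "ereal (real n) \<le> N s \<omega>" if "?T < s" for s
  proof -
    have "\<exists>u\<in>?S. u < s"
      using that unfolding T by (simp only: cInf_less_iff[OF arrival_set_ne[OF \<omega>] bdd])
    then obtain u where u: "0 \<le> u" "ereal (real n) \<le> N u \<omega>" "u < s" by auto
    have "N u \<omega> \<le> N s \<omega>" using u by (intro count_mono[OF \<omega>]) simp_all
    with u(2) show ?thesis by (rule order_trans)
  qed
  have "((\<lambda>s. N s \<omega>) \<longlongrightarrow> N ?T \<omega>) (at_right ?T)"
    using cp \<omega> arrival_nonneg[OF \<omega>] unfolding counting_process_def by blast
  moreover have "eventually (\<lambda>s. ereal (real n) \<le> N s \<omega>) (at_right ?T)"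
    using above by (auto simp: eventually_at_right_field intro!: exI[of _ "?T + 1"])
  ultimately show ?thesis
    by (rule tendsto_lowerbound) simp
qed

text \<open>The duality between counts and arrival times, through which measurability of arrivals
  and the description of count events are obtained.\<close>

lemma arrival_le_iff:
  assumes \<omega>: "\<omega> \<in> space M" and "0 \<le> t"
  shows "arrival N n \<omega> \<le> t \<longleftrightarrow> ereal (real n) \<le> N t \<omega>"
proof
  assume "arrival N n \<omega> \<le> t"
  then show "ereal (real n) \<le> N t \<omega>"
    using arrival_attained[OF \<omega>, of n] count_mono[OF \<omega> arrival_nonneg[OF \<omega>]] order_trans by blast
next
  assume "ereal (real n) \<le> N t \<omega>"
  then show "arrival N n \<omega> \<le> t"
    unfolding arrival_def using assms by (intro cInf_lower bdd_belowI[of _ 0]) auto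
qed

lemma arrival_0:
  assumes \<omega>: "\<omega> \<in> space M"
  shows "arrival N 0 \<omega> = 0"
proof -
  have "N 0 \<omega> = 0" using cp \<omega> unfolding counting_process_def by blast
  then have "arrival N 0 \<omega> \<le> 0" using arrival_le_iff[OF \<omega>, of 0 0] by (simp add: zero_ereal_def)
  then show ?thesis using arrival_nonneg[OF \<omega>, of 0] by simp
qed

text \<open>If two consecutive arrivals coincided, the count would be at least \<open>n + 1\<close>
  at that time and at most \<open>n - 1\<close> before it, a jump of two.\<close>

lemma arrival_strict_mono:
  assumes \<omega>: "\<omega> \<in> space M"
  shows "arrival N n \<omega> < arrival N (Suc n) \<omega>"
proof (rule ccontr)
  let ?T = "arrival N n \<omega>"
  assume "\<not> ?thesis"
  then have at: "ereal (real (Suc n)) \<le> N ?T \<omega>"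
    using arrival_le_iff[OF \<omega> arrival_nonneg[OF \<omega>], of "Suc n" n] by simp
  have N0: "N 0 \<omega> = 0" using cp \<omega> unfolding counting_process_def by blast
  have "?T \<noteq> 0" using at N0 by (auto simp: zero_ereal_def)
  then have Tpos: "0 < ?T" using arrival_nonneg[OF \<omega>, of n] by simp
  then have npos: "0 < n" using arrival_0[OF \<omega>] by (cases n) auto
  have "N s \<omega> \<le> ereal (real (n - 1))" if s: "s \<in> {0..<?T}" for s
  proof -
    have "\<not> ereal (real n) \<le> N s \<omega>" using arrival_le_iff[OF \<omega>, of s n] s by simp
    then show ?thesis
      using s npos by (cases rule: count_range[OF \<omega>, of s]) auto
  qed
  then have "(SUP s\<in>{0..<?T}. N s \<omega>) \<le> ereal (real (n - 1))"
    by (rule SUP_least)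
  then have "(SUP s\<in>{0..<?T}. N s \<omega>) + 1 \<le> ereal (real (n - 1)) + 1"
    by (rule add_right_mono)
  moreover have "N ?T \<omega> \<le> (SUP s\<in>{0..<?T}. N s \<omega>) + 1"
    using cp \<omega> Tpos unfolding counting_process_def by blast
  ultimately have "ereal (real (Suc n)) \<le> ereal (real (n - 1)) + 1"
    using at order_trans by blast
  then show False using npos by (simp add: one_ereal_def)
qed

lemma interarrival_pos:
  assumes "\<omega> \<in> space M" "1 \<le> n"
  shows "0 < interarrival N n \<omega>"
  using arrival_strict_mono[OF assms(1), of "n - 1"] assms(2) by (simp add: interarrival_def)

lemma sum_interarrival:
  assumes "\<omega> \<in> space M"
  shows "(\<Sum>i<n. interarrival N (Suc i) \<omega>) = arrival N n \<omega>"
  by (induction n) (simp_all add: interarrival_def arrival_0[OF assms])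

lemma count_eq_iff:
  assumes \<omega>: "\<omega> \<in> space M" and t: "0 \<le> t"
  shows "N t \<omega> = ereal (real k) \<longleftrightarrow> arrival N k \<omega> \<le> t \<and> t < arrival N (Suc k) \<omega>"
proof -
  have "arrival N k \<omega> \<le> t \<and> \<not> arrival N (Suc k) \<omega> \<le> t \<longleftrightarrow>
      ereal (real k) \<le> N t \<omega> \<and> \<not> ereal (real (Suc k)) \<le> N t \<omega>"
    using arrival_le_iff[OF \<omega> t] by simp
  also have "\<dots> \<longleftrightarrow> N t \<omega> = ereal (real k)"
    by (rule count_range[OF \<omega> t]) auto
  finally show ?thesis by auto
qed

lemma count_measurable: "0 \<le> t \<Longrightarrow> N t \<in> borel_measurable M"
  using cp unfolding counting_process_def by blast

lemma arrival_measurable: "arrival N n \<in> borel_measurable M"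
proof (rule borel_measurableI_le)
  fix a
  show "{\<omega> \<in> space M. arrival N n \<omega> \<le> a} \<in> sets M"
  proof (cases "0 \<le> a")
    case True
    then have "{\<omega> \<in> space M. arrival N n \<omega> \<le> a} = {\<omega> \<in> space M. ereal (real n) \<le> N a \<omega>}"
      using arrival_le_iff by blast
    also have "\<dots> \<in> sets M" using count_measurable[OF True] by measurable
    finally show ?thesis .
  next
    case False
    then have E: "{\<omega> \<in> space M. arrival N n \<omega> \<le> a} = {}"
      using arrival_nonneg[of _ n] by (auto dest: order_trans)
    show ?thesis unfolding E by (rule sets.empty_sets)
  qed
qed

lemma interarrival_measurable: "interarrival N n \<in> borel_measurable M"
  unfolding interarrival_def[abs_def]
  by (intro borel_measurable_diff arrival_measurable)

end

section \<open>Jump patterns of a renewal sequence\<close>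

definition partial_sum :: "(nat \<Rightarrow> real) \<Rightarrow> nat \<Rightarrow> real" where
  "partial_sum w n = (\<Sum>i<n. w i)"

text \<open>The renewal sequence with interarrival times \<open>w\<close>, which stands at \<open>n\<close> at time \<open>t\<close>, makes \<open>k\<close> jumps
  during the next \<open>d\<close> time units, for each \<open>(d, k)\<close> in the list in turn.\<close>

fun jumps :: "real \<Rightarrow> nat \<Rightarrow> (real \<times> nat) list \<Rightarrow> (nat \<Rightarrow> real) \<Rightarrow> bool" where
  "jumps t n [] w = True"
| "jumps t n ((d, k) # ps) w \<longleftrightarrow>
     partial_sum w (n + k) \<le> t + d \<and> t + d < partial_sum w (Suc (n + k)) \<and> jumps (t + d) (n + k) ps w"

text \<open>\<open>jumps\<close> recurses from the front, as conditioning on the first arrival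
  requires, whereas a time grid grows at its end.\<close>

lemma jumps_snoc:
  "jumps t n (ps @ [(d, k)]) w \<longleftrightarrow> jumps t n ps w \<and>
     partial_sum w (n + sum_list (map snd ps) + k) \<le> t + sum_list (map fst ps) + d \<and>
     t + sum_list (map fst ps) + d < partial_sum w (Suc (n + sum_list (map snd ps) + k))"
  by (induction ps arbitrary: t n) (auto simp: add.assoc)

lemma jumps_last:
  assumes "jumps t n ps w" "partial_sum w n \<le> t" "t < partial_sum w (Suc n)"
  shows "partial_sum w (n + sum_list (map snd ps)) \<le> t + sum_list (map fst ps) \<and>
     t + sum_list (map fst ps) < partial_sum w (Suc (n + sum_list (map snd ps)))"
  using assms
proof (induction ps arbitrary: t n)
  case (Cons p ps)
  obtain d k where p: "p = (d, k)" by (cases p)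
  show ?case using Cons.IH[of "t + d" "n + k"] Cons.prems by (simp add: p add.assoc)
qed simp

definition grid_jumps :: "(nat \<Rightarrow> real) \<Rightarrow> (nat \<Rightarrow> nat) \<Rightarrow> nat \<Rightarrow> (real \<times> nat) list" where
  "grid_jumps t \<kappa> m = map (\<lambda>j. (t j - t (j - 1), \<kappa> j)) [1..<Suc m]"

lemma grid_jumps_Suc:
  "grid_jumps t \<kappa> (Suc m) = grid_jumps t \<kappa> m @ [(t (Suc m) - t m, \<kappa> (Suc m))]"
  by (simp add: grid_jumps_def)

lemma grid_jumps_0: "grid_jumps t \<kappa> 0 = []"
  by (simp add: grid_jumps_def)

lemma sum_grid_jumps:
  "sum_list (map fst (grid_jumps t \<kappa> m)) = t m - t 0"
  "sum_list (map snd (grid_jumps t \<kappa> m)) = (\<Sum>i\<in>{1..m}. \<kappa> i)"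
  by (induction m) (simp_all add: grid_jumps_0 grid_jumps_Suc)

lemma prod_grid_jumps:
  fixes f :: "real \<Rightarrow> nat \<Rightarrow> 'b::comm_monoid_mult"
  shows "(\<Prod>(d, k)\<leftarrow>grid_jumps t \<kappa> m. f d k) = (\<Prod>j\<in>{1..m}. f (t j - t (j - 1)) (\<kappa> j))"
  by (induction m) (simp_all add: grid_jumps_0 grid_jumps_Suc)

lemma grid_mono:
  assumes "time_grid m t" "i \<le> j" "j \<le> m"
  shows "t i \<le> t j"
  using assms(2,3)
proof (induction j rule: dec_induct)
  case (step k)
  then show ?case using assms(1) unfolding time_grid_def by (meson Suc_le_lessD less_imp_le order_trans)
qed simp

text \<open>Prescribed increments amount to prescribed counts at the grid points, and an exact count
  says that the time lies between two consecutive partial sums. Sequences are indexed from 0 and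
  interarrival times from 1, hence the \<open>Suc i\<close>.\<close>

lemma incr_eq_iff_jumps:
  assumes cp: "counting_process M N" and \<omega>: "\<omega> \<in> space M" and grid: "time_grid m t"
  shows "(\<forall>j\<in>{1..m}. incr N t j \<omega> = ereal (real (\<kappa> j))) \<longleftrightarrow>
     jumps 0 0 (grid_jumps t \<kappa> m) (\<lambda>i. interarrival N (Suc i) \<omega>)"
proof -
  let ?W = "\<lambda>i. interarrival N (Suc i) \<omega>"
  have ps: "partial_sum ?W n = arrival N n \<omega>" for n
    using sum_interarrival[OF cp \<omega>] by (simp add: partial_sum_def)
  have t0: "t 0 = 0" using grid by (simp add: time_grid_def)
  have t_nonneg: "0 \<le> t j" if "j \<le> m" for j using grid_mono[OF grid _ that, of 0] t0 by simp
  \<comment> \<open>The induction also carries the value of the count at the last grid point: an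
    increment determines the next count only when the previous one is finite.\<close>
  have "((\<forall>j\<in>{1..l}. incr N t j \<omega> = ereal (real (\<kappa> j))) \<longleftrightarrow> jumps 0 0 (grid_jumps t \<kappa> l) ?W) \<and>
      ((\<forall>j\<in>{1..l}. incr N t j \<omega> = ereal (real (\<kappa> j))) \<longrightarrow> N (t l) \<omega> = ereal (real (\<Sum>i\<in>{1..l}. \<kappa> i)))"
    if "l \<le> m" for l
    using that
  proof (induction l)
    case 0
    have "N 0 \<omega> = 0" using cp \<omega> unfolding counting_process_def by blast
    then show ?case by (simp add: grid_jumps_0 t0 zero_ereal_def)
  next
    case (Suc l)
    let ?I = "\<lambda>l. \<forall>j\<in>{1..l}. incr N t j \<omega> = ereal (real (\<kappa> j))"
    have split: "?I (Suc l) \<longleftrightarrow> ?I l \<and> incr N t (Suc l) \<omega> = ereal (real (\<kappa> (Suc l)))"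
      by (simp add: atLeastAtMostSuc_conv conj_commute)
    have step: "incr N t (Suc l) \<omega> = ereal (real (\<kappa> (Suc l))) \<longleftrightarrow>
        N (t (Suc l)) \<omega> = ereal (real (\<Sum>i\<in>{1..Suc l}. \<kappa> i))" if "?I l"
    proof -
      have "N (t l) \<omega> = ereal (real (\<Sum>i\<in>{1..l}. \<kappa> i))" using Suc that by simp
      then show ?thesis by (cases "N (t (Suc l)) \<omega>") (auto simp: incr_def)
    qed
    have "N (t (Suc l)) \<omega> = ereal (real (\<Sum>i\<in>{1..Suc l}. \<kappa> i)) \<longleftrightarrow>
        partial_sum ?W (\<Sum>i\<in>{1..Suc l}. \<kappa> i) \<le> t (Suc l) \<and> t (Suc l) < partial_sum ?W (Suc (\<Sum>i\<in>{1..Suc l}. \<kappa> i))"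
      unfolding ps by (rule count_eq_iff[OF cp \<omega>]) (use t_nonneg Suc in simp)
    then show ?case
      using split step Suc by (auto simp: grid_jumps_Suc jumps_snoc sum_grid_jumps t0)
  qed
  then show ?thesis by blast
qed

section \<open>Exponential interarrival times and Poisson increments\<close>

definition poisson_weight :: "real \<Rightarrow> real \<Rightarrow> nat \<Rightarrow> real" where
  "poisson_weight y d k = exp (- y * d) * (y * d) ^ k / fact k"

lemma partial_sum_measurable [measurable]:
  "(\<lambda>w. partial_sum w n) \<in> borel_measurable (PiM UNIV (\<lambda>_::nat. borel))"
  unfolding partial_sum_def by measurable

lemma jumps_measurable [measurable]:
  "Measurable.pred (PiM UNIV (\<lambda>_::nat. borel)) (jumps t n ps)"
proof (induction ps arbitrary: t n)
  case (Cons p ps)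
  obtain d k where p: "p = (d, k)" by (cases p)
  note [measurable] = Cons
  have "jumps t n (p # ps) = (\<lambda>w. partial_sum w (n + k) \<le> t + d \<and> t + d < partial_sum w (Suc (n + k)) \<and>
      jumps (t + d) (n + k) ps w)" by (simp add: p fun_eq_iff)
  then show ?case by simp
next
  case Nil
  have "jumps t n [] = (\<lambda>w. True)" by (simp add: fun_eq_iff)
  then show ?case by simp
qed

lemma partial_sum_case_nat: "partial_sum (case_nat x w) (Suc n) = x + partial_sum w n"
  unfolding partial_sum_def by (subst sum.lessThan_Suc_shift) simp

text \<open>Once an arrival has been counted, every partial sum compared contains the first time
  \<open>x\<close>. Subtracting it restarts the pattern for the remaining sequence.\<close>

lemma jumps_case_nat: "jumps t (Suc n) ps (case_nat x w) \<longleftrightarrow> jumps (t - x) n ps w"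
proof (induction ps arbitrary: t n)
  case (Cons p ps)
  obtain d k where p: "p = (d, k)" by (cases p)
  have "jumps (t + d) (Suc (n + k)) ps (case_nat x w) \<longleftrightarrow> jumps (t + d - x) (n + k) ps w"
    by (rule Cons)
  moreover have "t + d - x = t - x + d" by simp
  ultimately show ?case by (auto simp: p partial_sum_case_nat)
qed simp

text \<open>Delaying both the clock and the first arrival by \<open>s\<close> changes no comparison
  with a sum that contains the first time. The empty sum stays below the clock because all times are
  nonnegative.\<close>

lemma jumps_shift_first:
  assumes "\<forall>(d, k)\<in>set ps. 0 \<le> d" "0 \<le> t" "0 \<le> s"
  shows "jumps (t + s) n ps (case_nat (x + s) w) \<longleftrightarrow> jumps t n ps (case_nat x w)"
  using assms(1,2)
proof (induction ps arbitrary: t n)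
  case (Cons p ps)
  obtain d k where p: "p = (d, k)" by (cases p)
  have d: "0 \<le> d" using Cons p by auto
  have IH: "jumps (t + s + d) (n + k) ps (case_nat (x + s) w) \<longleftrightarrow> jumps (t + d) (n + k) ps (case_nat x w)"
    using Cons.IH[of "t + d" "n + k"] Cons.prems d by (simp add: algebra_simps)
  show ?case
  proof (cases "n + k")
    case 0
    then show ?thesis using IH d Cons.prems assms(3)
      by (auto simp: p partial_sum_case_nat) (auto simp: partial_sum_def)
  next
    case (Suc m)
    then show ?thesis using IH unfolding p jumps.simps Suc partial_sum_case_nat by auto
  qed
qed simp

text \<open>Conditioning on the first coordinate: an i.i.d. sequence is a first value followed by an
  independent copy of the sequence.\<close>

lemma emeasure_sequence_unroll:
  assumes "prob_space \<mu>" and A: "A \<in> sets (PiM UNIV (\<lambda>_::nat. \<mu>))"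
  shows "emeasure (PiM UNIV (\<lambda>_::nat. \<mu>)) A =
     (\<integral>\<^sup>+x. emeasure (PiM UNIV (\<lambda>_::nat. \<mu>)) {w \<in> space (PiM UNIV (\<lambda>_::nat. \<mu>)). case_nat x w \<in> A} \<partial>\<mu>)"
proof -
  interpret \<mu>: prob_space \<mu> by fact
  interpret sequence_space \<mu> by standard
  let ?P = "\<mu> \<Otimes>\<^sub>M S"
  have [measurable]: "(\<lambda>(s, \<omega>). case_nat s \<omega>) \<in> measurable ?P S" by measurable
  have "emeasure S A = emeasure (distr ?P S (\<lambda>(s, \<omega>). case_nat s \<omega>)) A"
    by (simp add: PiM_iter)
  also have "\<dots> = emeasure ?P ((\<lambda>(s, \<omega>). case_nat s \<omega>) -` A \<inter> space ?P)"
    using A by (intro emeasure_distr) measurable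
  also have "\<dots> = (\<integral>\<^sup>+x. emeasure S (Pair x -` ((\<lambda>(s, \<omega>). case_nat s \<omega>) -` A \<inter> space ?P)) \<partial>\<mu>)"
    using A by (intro emeasure_pair_measure_alt measurable_sets[of _ ?P S]) measurable
  also have "\<dots> = (\<integral>\<^sup>+x. emeasure S {w \<in> space S. case_nat x w \<in> A} \<partial>\<mu>)"
    by (intro nn_integral_cong arg_cong[where f = "emeasure S"]) (auto simp: space_pair_measure)
  finally show ?thesis .
qed

section \<open>Sequences of independent exponential times\<close>

lemma prob_space_exp_law: "0 < y \<Longrightarrow> prob_space (exp_law y)"
  unfolding exp_law_def by (rule prob_space_exponential_density)

lemma sets_exp_law [simp, measurable_cong]: "sets (exp_law y) = sets borel"
  by (simp add: exp_law_def)

lemma space_exp_law [simp]: "space (exp_law y) = UNIV"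
  by (simp add: exp_law_def)

abbreviation exp_seq :: "real \<Rightarrow> (nat \<Rightarrow> real) measure" where
  "exp_seq y \<equiv> PiM UNIV (\<lambda>_::nat. exp_law y)"

lemma sets_exp_seq [measurable_cong]: "sets (exp_seq y) = sets (PiM UNIV (\<lambda>_::nat. borel))"
  by (intro sets_PiM_cong) simp_all

lemma space_exp_seq [simp]: "space (exp_seq y) = UNIV"
  by (simp add: space_PiM PiE_UNIV_domain)

lemma AE_exp_law_pos:
  assumes "0 < y"
  shows "AE x in exp_law y. 0 < x"
proof -
  have "AE x in lborel. 0 < exponential_density y x \<longrightarrow> 0 < x"
    using AE_lborel_singleton[of 0]
    by eventually_elim (auto simp: exponential_density_def split: if_splits)
  then show ?thesis unfolding exp_law_def by (subst AE_density) simp_all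
qed

lemma AE_exp_seq_pos:
  assumes "0 < y"
  shows "AE w in exp_seq y. \<forall>i. 0 < w i"
  unfolding AE_all_countable
  by (intro allI AE_PiM_component prob_space_exp_law assms AE_exp_law_pos) simp

lemma partial_sum_nonneg: "(\<And>i. 0 < w i) \<Longrightarrow> 0 \<le> partial_sum w n"
  unfolding partial_sum_def by (intro sum_nonneg) (simp add: less_imp_le)

lemma poisson_weight_nonneg: "0 \<le> y \<Longrightarrow> 0 \<le> d \<Longrightarrow> 0 \<le> poisson_weight y d k"
  by (simp add: poisson_weight_def)

text \<open>The two exponential factors multiply to the constant \<open>exp (- y * d)\<close>, which
  leaves a power of \<open>d - x\<close> with the explicit antiderivative \<open>?F\<close>. The
  indicator removes arrivals after \<open>d\<close>, where the remaining duration would be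
  negative.\<close>

lemma nn_integral_poisson_weight:
  assumes y: "0 < y" and d: "0 \<le> d"
  shows "(\<integral>\<^sup>+x. indicator {..d} x * ennreal (poisson_weight y (d - x) k) \<partial>exp_law y)
     = ennreal (poisson_weight y d (Suc k))"
proof -
  let ?f = "\<lambda>x. y * exp (- y * d) * (y * (d - x)) ^ k / fact k"
  let ?F = "\<lambda>x. - (exp (- y * d) / fact (Suc k)) * (y * (d - x)) ^ Suc k"
  have "(\<integral>\<^sup>+x. indicator {..d} x * ennreal (poisson_weight y (d - x) k) \<partial>exp_law y)
      = (\<integral>\<^sup>+x. ennreal (exponential_density y x) * (indicator {..d} x * ennreal (poisson_weight y (d - x) k)) \<partial>lborel)"
    unfolding exp_law_def poisson_weight_def by (subst nn_integral_density) simp_all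
  also have "\<dots> = (\<integral>\<^sup>+x. ennreal (?f x) * indicator {0..d} x \<partial>lborel)"
  proof (intro nn_integral_cong)
    fix x
    show "ennreal (exponential_density y x) * (indicator {..d} x * ennreal (poisson_weight y (d - x) k))
        = ennreal (?f x) * indicator {0..d} x"
    proof (cases "0 \<le> x \<and> x \<le> d")
      case True
      have e: "exp (- x * y) * exp (- y * (d - x)) = exp (- y * d)"
        by (simp add: exp_add[symmetric] algebra_simps)
      have "exponential_density y x * poisson_weight y (d - x) k = ?f x"
        using True e by (simp add: exponential_density_def poisson_weight_def)
      then show ?thesis
        using True y by (simp add: ennreal_mult'[symmetric] exponential_density_nonneg)
    qed (auto simp: exponential_density_def)
  qed
  also have "\<dots> = ennreal (?F d - ?F 0)"
  proof (rule nn_integral_FTC_Icc)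
    fix x assume x: "x \<in> {0..d}"
    have "DERIV (\<lambda>x. y * (d - x)) x :> - y" by (auto intro!: derivative_eq_intros)
    from DERIV_cmult[OF DERIV_power_Suc[OF this, of k], of "- (exp (- y * d) / fact (Suc k))"]
    show "DERIV ?F x :> ?f x"
      by (rule DERIV_cong) (simp add: divide_simps)
    show "0 \<le> ?f x" using x y by simp
  qed (use d in simp_all)
  also have "?F d - ?F 0 = poisson_weight y d (Suc k)"
    by (simp add: poisson_weight_def)
  finally show ?thesis .
qed

text \<open>Condition on the first time \<open>x\<close>, by induction on the list and, inside, on
  the number of jumps in the first period. Without a jump in that period \<open>x > d\<close>, and
  lack of memory passes to the remaining periods. Otherwise the period shrinks to
  \<open>d - x\<close> with one jump fewer, so the inner hypothesis has to range over all
  durations.\<close>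

theorem emeasure_exp_seq_jumps:
  assumes y: "0 < y" and "\<forall>(d, k)\<in>set ps. 0 \<le> d"
  shows "emeasure (exp_seq y) {w. jumps 0 0 ps w} = ennreal (\<Prod>(d, k)\<leftarrow>ps. poisson_weight y d k)"
  using assms(2)
proof (induction ps)
  case Nil
  interpret prob_space "exp_seq y" by (intro prob_space_PiM prob_space_exp_law y)
  show ?case using emeasure_space_1 by simp
next
  case (Cons p ps)
  interpret E: prob_space "exp_law y" by (rule prob_space_exp_law[OF y])
  interpret S: prob_space "exp_seq y" by (intro prob_space_PiM prob_space_exp_law y)
  let ?c = "\<Prod>(d, k)\<leftarrow>ps. poisson_weight y d k"
  have nonneg: "\<forall>(d, k)\<in>set ps. 0 \<le> d" using Cons by simp
  have c: "emeasure (exp_seq y) {w. jumps 0 0 ps w} = ennreal ?c" using Cons by simp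
  have c_nonneg: "0 \<le> ?c"
    using nonneg y by (induction ps) (auto intro!: mult_nonneg_nonneg poisson_weight_nonneg)
  have meas: "{w. jumps t n qs w} \<in> sets (exp_seq y)" for t n qs
    using jumps_measurable[of t n qs] by (simp add: pred_def space_PiM sets_exp_seq)
  have unroll: "emeasure (exp_seq y) {w. jumps 0 0 qs w} =
      (\<integral>\<^sup>+x. emeasure (exp_seq y) {w. jumps 0 0 qs (case_nat x w)} \<partial>exp_law y)" for qs
    using emeasure_sequence_unroll[OF prob_space_exp_law[OF y] meas, of 0 0 qs] by simp
  have "\<forall>d\<ge>0. emeasure (exp_seq y) {w. jumps 0 0 ((d, k) # ps) w} = ennreal (poisson_weight y d k * ?c)" for k
  proof (induction k)
    case 0
    show ?case
    proof (intro allI impI)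
      fix d :: real assume d: "0 \<le> d"
      define \<phi> where "\<phi> x = emeasure (exp_seq y) {w. jumps 0 0 ps (case_nat x w)}" for x
      have [measurable]: "\<phi> \<in> borel_measurable borel"
      proof -
        have "Measurable.pred (borel \<Otimes>\<^sub>M exp_seq y) (\<lambda>p. jumps 0 0 ps (case_nat (fst p) (snd p)))"
          by (rule measurable_compose[OF _ jumps_measurable]) measurable
        then have "{p. jumps 0 0 ps (case_nat (fst p) (snd p))} \<in> sets (borel \<Otimes>\<^sub>M exp_seq y)"
          by (simp add: pred_def space_pair_measure)
        from S.measurable_emeasure_Pair[OF this] show ?thesis
          by (simp add: \<phi>_def[abs_def] vimage_def)
      qed
      have "emeasure (exp_seq y) {w. jumps 0 0 ((d, 0) # ps) w} =
          (\<integral>\<^sup>+x. indicator {d<..} x * \<phi> (x - d) \<partial>exp_law y)"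
        unfolding unroll
      proof (intro nn_integral_cong)
        fix x
        \<comment> \<open>After an idle period of length \<open>d\<close> the first time has the
          residual value \<open>x - d\<close>. The substitution below turns it back into
          \<open>x\<close> at the cost of the factor \<open>exp (- y * d)\<close>.\<close>
        have "jumps 0 0 ((d, 0) # ps) (case_nat x w) \<longleftrightarrow> d < x \<and> jumps 0 0 ps (case_nat (x - d) w)" for w
          using jumps_shift_first[OF nonneg, of 0 d 0 "x - d" w] d
          by (simp add: partial_sum_case_nat) (simp add: partial_sum_def)
        then show "emeasure (exp_seq y) {w. jumps 0 0 ((d, 0) # ps) (case_nat x w)} = indicator {d<..} x * \<phi> (x - d)"
          by (simp add: \<phi>_def indicator_def)
      qed
      also have "\<dots> = (\<integral>\<^sup>+x. ennreal (exponential_density y x) * (indicator {d<..} x * \<phi> (x - d)) \<partial>lborel)"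
        unfolding exp_law_def by (subst nn_integral_density) simp_all
      also have "\<dots> = (\<integral>\<^sup>+x. ennreal (exponential_density y (d + x)) * (indicator {d<..} (d + x) * \<phi> x) \<partial>lborel)"
        by (subst nn_integral_real_affine[where t = d and c = 1]) simp_all
      also have "\<dots> = (\<integral>\<^sup>+x. ennreal (exp (- y * d)) * (ennreal (exponential_density y x) * \<phi> x) \<partial>lborel)"
      proof (intro nn_integral_cong_AE)
        show "AE x in lborel. ennreal (exponential_density y (d + x)) * (indicator {d<..} (d + x) * \<phi> x) =
            ennreal (exp (- y * d)) * (ennreal (exponential_density y x) * \<phi> x)"
          using AE_lborel_singleton[of 0]
        proof eventually_elim
          case (elim x)
          show ?case
          proof (cases "0 < x")
            case True
            then have "exponential_density y (d + x) = exp (- y * d) * exponential_density y x"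
              using d by (simp add: exponential_density_def exp_add[symmetric] algebra_simps)
            then show ?thesis using True y
              by (simp add: ennreal_mult' exponential_density_nonneg mult.assoc)
          next
            case False
            then show ?thesis using elim by (simp add: exponential_density_def)
          qed
        qed
      qed
      also have "\<dots> = ennreal (exp (- y * d)) * (\<integral>\<^sup>+x. ennreal (exponential_density y x) * \<phi> x \<partial>lborel)"
        by (rule nn_integral_cmult) simp
      also have "(\<integral>\<^sup>+x. ennreal (exponential_density y x) * \<phi> x \<partial>lborel) = (\<integral>\<^sup>+x. \<phi> x \<partial>exp_law y)"
        unfolding exp_law_def by (subst nn_integral_density) simp_all
      also have "\<dots> = ennreal ?c" unfolding \<phi>_def unroll[symmetric] by (rule c)
      also have "ennreal (exp (- y * d)) * ennreal ?c = ennreal (poisson_weight y d 0 * ?c)"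
        by (simp add: poisson_weight_def ennreal_mult' c_nonneg)
      finally show "emeasure (exp_seq y) {w. jumps 0 0 ((d, 0) # ps) w} = ennreal (poisson_weight y d 0 * ?c)" .
    qed
  next
    case (Suc k)
    show ?case
    proof (intro allI impI)
      fix d :: real assume d: "0 \<le> d"
      have "emeasure (exp_seq y) {w. jumps 0 0 ((d, Suc k) # ps) w} =
          (\<integral>\<^sup>+x. indicator {..d} x * ennreal (poisson_weight y (d - x) k) * ennreal ?c \<partial>exp_law y)"
        unfolding unroll
      proof (intro nn_integral_cong)
        fix x
        have eq: "jumps 0 0 ((d, Suc k) # ps) (case_nat x w) \<longleftrightarrow> jumps 0 0 ((d - x, k) # ps) w" for w
          by (auto simp: partial_sum_case_nat jumps_case_nat)
        show "emeasure (exp_seq y) {w. jumps 0 0 ((d, Suc k) # ps) (case_nat x w)} =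
            indicator {..d} x * ennreal (poisson_weight y (d - x) k) * ennreal ?c"
        proof (cases "x \<le> d")
          case True
          then show ?thesis
            using Suc y c_nonneg by (simp add: eq ennreal_mult poisson_weight_nonneg del: jumps.simps)
        next
          case False
          \<comment> \<open>For \<open>x > d\<close> the clock \<open>d - x\<close> is negative,
            whereas partial sums are almost surely nonnegative.\<close>
          have "AE w in exp_seq y. \<not> jumps 0 0 ((d - x, k) # ps) w"
            using AE_exp_seq_pos[OF y]
          proof eventually_elim
            case (elim w)
            then show ?case using partial_sum_nonneg[of w k] False by simp
          qed
          then have "emeasure (exp_seq y) {w. jumps 0 0 ((d - x, k) # ps) w} = 0"
            using AE_iff_null[of "exp_seq y" "\<lambda>w. \<not> jumps 0 0 ((d - x, k) # ps) w"] meas[of 0 0 "(d - x, k) # ps"]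
            by (simp add: null_sets_def del: jumps.simps)
          then show ?thesis using False by (simp add: eq del: jumps.simps)
        qed
      qed
      also have "\<dots> = (\<integral>\<^sup>+x. indicator {..d} x * ennreal (poisson_weight y (d - x) k) \<partial>exp_law y) * ennreal ?c"
        unfolding poisson_weight_def by (rule nn_integral_multc) simp
      also have "\<dots> = ennreal (poisson_weight y d (Suc k) * ?c)"
        using y d c_nonneg by (simp add: nn_integral_poisson_weight ennreal_mult poisson_weight_nonneg)
      finally show "emeasure (exp_seq y) {w. jumps 0 0 ((d, Suc k) # ps) w} = ennreal (poisson_weight y d (Suc k) * ?c)" .
    qed
  qed
  moreover obtain d k where "p = (d, k)" by (cases p)
  ultimately show ?case using Cons by simp
qed

section \<open>Independence of integer-valued variables\<close>

lemma (in prob_space) indep_vars_reindex: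
  assumes ind: "indep_vars (\<lambda>_. B) X (f ` I)" and inj: "inj_on f I"
  shows "indep_vars (\<lambda>_. B) (\<lambda>i. X (f i)) I"
proof -
  let ?F = "\<lambda>i. {X i -` A \<inter> space M |A. A \<in> sets B}"
  have rv: "\<And>i. i \<in> I \<Longrightarrow> random_variable B (X (f i))" and F: "indep_sets ?F (f ` I)"
    using ind by (auto simp: indep_vars_def2)
  have "indep_sets (\<lambda>i. ?F (f i)) I"
  proof (rule indep_setsI)
    show "\<And>i. i \<in> I \<Longrightarrow> ?F (f i) \<subseteq> events" using rv by auto
    fix A J assume J: "J \<noteq> {}" "J \<subseteq> I" "finite J" and A: "\<forall>j\<in>J. A j \<in> ?F (f j)"
    have injJ: "inj_on f J" using inj J(2) by (rule inj_on_subset)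
    define A' where "A' j = A (the_inv_into J f j)" for j
    have A': "A' (f j) = A j" if "j \<in> J" for j
      using that injJ by (simp add: A'_def the_inv_into_f_f)
    have "prob (\<Inter>j\<in>f ` J. A' j) = (\<Prod>j\<in>f ` J. prob (A' j))"
    proof (rule indep_setsD[OF F])
      show "\<forall>j\<in>f ` J. A' j \<in> {X j -` A \<inter> space M |A. A \<in> sets B}"
      proof
        fix i assume "i \<in> f ` J"
        then obtain j where "j \<in> J" "i = f j" by blast
        then show "A' i \<in> {X i -` A \<inter> space M |A. A \<in> sets B}" using A A' by simp
      qed
    qed (use J in auto)
    then show "prob (\<Inter>j\<in>J. A j) = (\<Prod>j\<in>J. prob (A j))"
      using A' by (simp add: prod.reindex[OF injJ])
  qed
  then show ?thesis using rv by (simp add: indep_vars_def2)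
qed

lemma countable_finite_support_nat:
  assumes "finite I"
  shows "countable {f :: 'i \<Rightarrow> nat. \<forall>i. i \<notin> I \<longrightarrow> f i = 0}"
proof -
  have "{f :: 'i \<Rightarrow> nat. \<forall>i. i \<notin> I \<longrightarrow> f i = 0} \<subseteq> (\<lambda>g i. if i \<in> I then g i else 0) ` (PiE I (\<lambda>_. UNIV))"
  proof
    fix f :: "'i \<Rightarrow> nat" assume "f \<in> {f. \<forall>i. i \<notin> I \<longrightarrow> f i = 0}"
    then have "f = (\<lambda>i. if i \<in> I then restrict f I i else 0)" by auto
    then show "f \<in> (\<lambda>g i. if i \<in> I then g i else 0) ` (PiE I (\<lambda>_. UNIV))"
      by (intro image_eqI[where x = "restrict f I"]) auto
  qed
  moreover have "countable (PiE I (\<lambda>_. UNIV :: nat set))"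
    by (rule countable_PiE[OF assms]) simp
  ultimately show ?thesis by (rule countable_subset[OF _ countable_image])
qed

context prob_space
begin

text \<open>The variables are extended real, so values outside the natural numbers have to be
  excluded. This comes for free: the given point probabilities already sum to one.\<close>

lemma prob_discrete_product:
  fixes X :: "'i \<Rightarrow> 'a \<Rightarrow> ereal" and p :: "'i \<Rightarrow> nat pmf"
  assumes I: "finite I" and X: "\<And>i. i \<in> I \<Longrightarrow> X i \<in> borel_measurable M"
    and atoms: "\<And>\<kappa>. prob {\<omega> \<in> space M. \<forall>i\<in>I. X i \<omega> = ereal (real (\<kappa> i))} = (\<Prod>i\<in>I. pmf (p i) (\<kappa> i))"
    and B: "\<And>i. i \<in> I \<Longrightarrow> B i \<in> sets borel"
  shows "prob {\<omega> \<in> space M. \<forall>i\<in>I. X i \<omega> \<in> B i} = (\<Prod>i\<in>I. measure (p i) {k. ereal (real k) \<in> B i})"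
proof -
  define E where "E \<kappa> = {\<omega> \<in> space M. \<forall>i\<in>I. X i \<omega> = ereal (real (\<kappa> i))}" for \<kappa>
  have meas_C: "{\<omega> \<in> space M. \<forall>i\<in>I. X i \<omega> \<in> C i} \<in> events" if "\<And>i. i \<in> I \<Longrightarrow> C i \<in> sets borel" for C
  proof -
    have "{\<omega> \<in> space M. X i \<omega> \<in> C i} \<in> events" if "i \<in> I" for i
      using measurable_sets[OF X[OF that], of "C i"] \<open>\<And>i. i \<in> I \<Longrightarrow> C i \<in> sets borel\<close>[OF that]
      by (simp add: vimage_def Int_def conj_commute)
    then show ?thesis by (rule sets.sets_Collect_finite_All[OF _ I])
  qed
  have meas_E: "E \<kappa> \<in> events" for \<kappa>
    using meas_C[of "\<lambda>i. {ereal (real (\<kappa> i))}"] by (simp add: E_def)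
  have key: "prob {\<omega> \<in> space M. \<forall>i\<in>I. X i \<omega> \<in> C i \<and> X i \<omega> \<in> range (\<lambda>k::nat. ereal (real k))}
      = (\<Prod>i\<in>I. measure (p i) {k. ereal (real k) \<in> C i})" for C
  proof -
    \<comment> \<open>Functions with the fixed value 0 outside \<open>I\<close> form a countable
      set, and different ones differ on \<open>I\<close>, so the events \<open>E \<kappa>\<close>
      are disjoint.\<close>
    let ?S = "PiE_dflt I 0 (\<lambda>i. {k. ereal (real k) \<in> C i})"
    have "{\<omega> \<in> space M. \<forall>i\<in>I. X i \<omega> \<in> C i \<and> X i \<omega> \<in> range (\<lambda>k::nat. ereal (real k))} = (\<Union>\<kappa>\<in>?S. E \<kappa>)"
    proof (intro set_eqI iffI)
      fix \<omega> assume \<omega>: "\<omega> \<in> {\<omega> \<in> space M. \<forall>i\<in>I. X i \<omega> \<in> C i \<and> X i \<omega> \<in> range (\<lambda>k::nat. ereal (real k))}"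
      then have "\<forall>i\<in>I. \<exists>k::nat. X i \<omega> = ereal (real k)" by auto
      then obtain \<kappa> :: "'i \<Rightarrow> nat" where \<kappa>: "\<And>i. i \<in> I \<Longrightarrow> X i \<omega> = ereal (real (\<kappa> i))"
        using bchoice[of I "\<lambda>i k. X i \<omega> = ereal (real k)"] by blast
      show "\<omega> \<in> (\<Union>\<kappa>\<in>?S. E \<kappa>)"
        using \<omega> \<kappa> by (intro UN_I[of "\<lambda>i. if i \<in> I then \<kappa> i else 0"]) (auto simp: PiE_dflt_def E_def)
    qed (auto simp: PiE_dflt_def E_def)
    also have "emeasure M \<dots> = (\<integral>\<^sup>+\<kappa>. emeasure M (E \<kappa>) \<partial>count_space ?S)"
    proof (rule emeasure_UN_countable)
      show "countable ?S"
        by (rule countable_subset[OF _ countable_finite_support_nat[OF I]]) (auto simp: PiE_dflt_def)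
      show "disjoint_family_on E ?S"
      proof (unfold disjoint_family_on_def, intro ballI impI)
        fix \<kappa> \<kappa>' assume S: "\<kappa> \<in> ?S" "\<kappa>' \<in> ?S" and ne: "\<kappa> \<noteq> \<kappa>'"
        then obtain i where "\<kappa> i \<noteq> \<kappa>' i" by blast
        moreover from this S have "i \<in> I" by (cases "i \<in> I") (auto simp: PiE_dflt_def)
        ultimately show "E \<kappa> \<inter> E \<kappa>' = {}" by (auto simp: E_def)
      qed
    qed (rule meas_E)
    also have "\<dots> = (\<integral>\<^sup>+\<kappa>. pmf (Pi_pmf I 0 p) \<kappa> \<partial>count_space ?S)"
    proof (intro nn_integral_cong)
      fix \<kappa> assume "\<kappa> \<in> space (count_space ?S)"
      then have "pmf (Pi_pmf I 0 p) \<kappa> = (\<Prod>i\<in>I. pmf (p i) (\<kappa> i))"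
        by (intro pmf_Pi'[OF I]) (auto simp: PiE_dflt_def)
      then show "emeasure M (E \<kappa>) = pmf (Pi_pmf I 0 p) \<kappa>"
        using atoms[of \<kappa>] by (simp add: E_def emeasure_eq_measure)
    qed
    also have "\<dots> = emeasure (Pi_pmf I 0 p) ?S" by (rule nn_integral_pmf)
    also have "\<dots> = ennreal (\<Prod>i\<in>I. measure (p i) {k. ereal (real k) \<in> C i})"
      by (simp add: measure_pmf.emeasure_eq_measure measure_Pi_pmf_PiE_dflt[OF I])
    finally show ?thesis by (simp add: emeasure_eq_measure prod_nonneg)
  qed
  have R: "range (\<lambda>k::nat. ereal (real k)) \<in> sets borel"
  proof -
    have "(\<Union>k::nat. {ereal (real k)}) \<in> sets borel" by (intro sets.countable_UN'') auto
    moreover have "(\<Union>k::nat. {ereal (real k)}) = range (\<lambda>k::nat. ereal (real k))" by auto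
    ultimately show ?thesis by simp
  qed
  let ?R = "{\<omega> \<in> space M. \<forall>i\<in>I. X i \<omega> \<in> range (\<lambda>k::nat. ereal (real k))}"
  have R_ev: "?R \<in> events" using R by (intro meas_C)
  \<comment> \<open>Summing all point probabilities gives mass one to natural-number values.\<close>
  have "prob ?R = 1" using key[of "\<lambda>_. UNIV"] by simp
  then have "AE \<omega> in M. \<omega> \<in> ?R" using prob_Collect_eq_1 R_ev AE_prob_1 by blast
  then have AE: "AE \<omega> in M. \<forall>i\<in>I. X i \<omega> \<in> range (\<lambda>k::nat. ereal (real k))" by eventually_elim simp
  have "prob {\<omega> \<in> space M. \<forall>i\<in>I. X i \<omega> \<in> B i} =
      prob {\<omega> \<in> space M. \<forall>i\<in>I. X i \<omega> \<in> B i \<inter> range (\<lambda>k::nat. ereal (real k))}"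
  proof (rule measure_eq_AE)
    show "AE \<omega> in M. \<omega> \<in> {\<omega> \<in> space M. \<forall>i\<in>I. X i \<omega> \<in> B i} \<longleftrightarrow>
        \<omega> \<in> {\<omega> \<in> space M. \<forall>i\<in>I. X i \<omega> \<in> B i \<inter> range (\<lambda>k::nat. ereal (real k))}"
      using AE by eventually_elim auto
  qed (rule meas_C, simp add: B R sets.Int)+
  also have "\<dots> = (\<Prod>i\<in>I. measure (p i) {k. ereal (real k) \<in> B i})"
    using key[of B] by simp
  finally show ?thesis .
qed

lemma indep_vars_discrete:
  fixes X :: "'i \<Rightarrow> 'a \<Rightarrow> ereal" and p :: "'i \<Rightarrow> nat pmf"
  assumes I: "finite I" "I \<noteq> {}" and X: "\<And>i. i \<in> I \<Longrightarrow> X i \<in> borel_measurable M"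
    and atoms: "\<And>\<kappa>. prob {\<omega> \<in> space M. \<forall>i\<in>I. X i \<omega> = ereal (real (\<kappa> i))} = (\<Prod>i\<in>I. pmf (p i) (\<kappa> i))"
  shows "indep_vars (\<lambda>_. borel) X I"
    and "\<And>i. i \<in> I \<Longrightarrow> distr M borel (X i) = distr (measure_pmf (p i)) borel (\<lambda>k. ereal (real k))"
proof -
  note joint = prob_discrete_product[OF I(1) X atoms]
  have marg: "prob (X i -` A \<inter> space M) = measure (p i) {k. ereal (real k) \<in> A}"
    if i: "i \<in> I" and A: "A \<in> sets borel" for i A
  proof -
    have "X i -` A \<inter> space M = {\<omega> \<in> space M. \<forall>j\<in>I. X j \<omega> \<in> (if j = i then A else UNIV)}"
      using i by auto
    also have "prob \<dots> = (\<Prod>j\<in>I. measure (p j) {k. ereal (real k) \<in> (if j = i then A else UNIV)})"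
      using A by (intro joint) auto
    also have "\<dots> = (\<Prod>j\<in>I. if j = i then measure (p i) {k. ereal (real k) \<in> A} else 1)"
      by (intro prod.cong) auto
    also have "\<dots> = measure (p i) {k. ereal (real k) \<in> A}" using I i by simp
    finally show ?thesis .
  qed
  show "distr M borel (X i) = distr (measure_pmf (p i)) borel (\<lambda>k. ereal (real k))" if i: "i \<in> I" for i
  proof (rule measure_eqI)
    fix A assume "A \<in> sets (distr M borel (X i))"
    then have A: "A \<in> sets borel" by simp
    show "emeasure (distr M borel (X i)) A = emeasure (distr (measure_pmf (p i)) borel (\<lambda>k. ereal (real k))) A"
      using marg[OF i A] A X[OF i]
      by (simp add: emeasure_distr emeasure_eq_measure measure_pmf.emeasure_eq_measure vimage_def)
  qed simp
  show "indep_vars (\<lambda>_. borel) X I"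
  proof (subst indep_vars_finite[OF I(2,1), where E = "\<lambda>_. sets borel"])
    show "\<forall>A\<in>I \<rightarrow> sets borel. prob (\<Inter>j\<in>I. X j -` A j \<inter> space M) = (\<Prod>j\<in>I. prob (X j -` A j \<inter> space M))"
    proof
      fix A :: "'i \<Rightarrow> ereal set" assume A: "A \<in> I \<rightarrow> sets borel"
      have "(\<Inter>j\<in>I. X j -` A j \<inter> space M) = {\<omega> \<in> space M. \<forall>i\<in>I. X i \<omega> \<in> A i}" using I by auto
      also have "prob \<dots> = (\<Prod>i\<in>I. measure (p i) {k. ereal (real k) \<in> A i})"
        using A by (intro joint) auto
      also have "\<dots> = (\<Prod>j\<in>I. prob (X j -` A j \<inter> space M))"
        using A by (intro prod.cong marg[symmetric]) auto
      finally show "prob (\<Inter>j\<in>I. X j -` A j \<inter> space M) = (\<Prod>j\<in>I. prob (X j -` A j \<inter> space M))" .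
    qed
  qed (use X in \<open>auto simp: Int_stable_def sets.sigma_sets_eq[of borel, simplified]\<close>)
qed

end

lemma poisson_law_eq_pmf:
  assumes "0 < l"
  shows "poisson_law l = distr (measure_pmf (poisson_pmf l)) borel (\<lambda>k. ereal (real k))"
proof -
  have "(\<lambda>k. ennreal (exp (- l) * l ^ k / fact k)) = (\<lambda>k. ennreal (pmf (poisson_pmf l) k))"
    using assms by (simp add: fun_eq_iff mult.commute)
  then show ?thesis unfolding poisson_law_def measure_pmf_eq_density by simp
qed

lemma pmf_poisson_weight:
  assumes "0 < y * d"
  shows "pmf (poisson_pmf (y * d)) k = poisson_weight y d k"
  using assms by (simp add: poisson_weight_def mult.commute)

section \<open>Poisson processes from exponential interarrival times\<close>

lemma counting_process_cong:
  assumes "sets Q = sets M"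
  shows "counting_process Q N \<longleftrightarrow> counting_process M N"
  unfolding counting_process_def
  by (simp add: sets_eq_imp_space_eq[OF assms] measurable_cong_sets[OF assms refl])

text \<open>A shifted grid no longer starts at 0. With 0 put in front it does, and the shifted
  increments are those of the new grid from index 2 on, so facts on increments over grids yield
  stationarity.\<close>

lemma time_grid_shift:
  assumes "time_grid m t" "0 < h"
  shows "time_grid (Suc m) (case_nat 0 (\<lambda>j. t j + h))"
  using assms unfolding time_grid_def by (auto split: nat.split)

lemma grid_nonneg:
  assumes "time_grid m t" "j \<le> m"
  shows "0 \<le> t j"
  using grid_mono[OF assms(1) _ assms(2), of 0] assms(1) by (simp add: time_grid_def)

lemma incr_measurable:
  assumes "counting_process M N" "0 \<le> t j" "0 \<le> t (j - 1)"
  shows "incr N t j \<in> borel_measurable M"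
  unfolding incr_def[abs_def] using count_measurable[OF assms(1)] assms(2,3)
  by (intro borel_measurable_ereal_diff) auto

lemma interarrival_seq_measurable:
  assumes "counting_process M N"
  shows "(\<lambda>\<omega> i. interarrival N (Suc i) \<omega>) \<in> measurable M (PiM UNIV (\<lambda>_. borel))"
  by (rule measurable_PiM_single') (simp_all add: interarrival_measurable[OF assms])

lemma exponential_renewal_fdd:
  assumes cp: "counting_process M N" and y: "0 < y" and "prob_space M"
    and ind: "prob_space.indep_vars M (\<lambda>_. borel) (interarrival N) {1..}"
    and law: "\<And>n. 1 \<le> n \<Longrightarrow> distr M borel (interarrival N n) = exp_law y"
    and grid: "time_grid m t"
  shows "measure M {\<omega> \<in> space M. \<forall>j\<in>{1..m}. incr N t j \<omega> = ereal (real (\<kappa> j))} =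
      (\<Prod>j\<in>{1..m}. poisson_weight y (t j - t (j - 1)) (\<kappa> j))"
proof -
  let ?E = "{\<omega> \<in> space M. \<forall>j\<in>{1..m}. incr N t j \<omega> = ereal (real (\<kappa> j))}"
  let ?c = "\<Prod>j\<in>{1..m}. poisson_weight y (t j - t (j - 1)) (\<kappa> j)"
  interpret prob_space M by fact
  let ?W = "\<lambda>\<omega> i. interarrival N (Suc i) \<omega>"
  have "indep_vars (\<lambda>_. borel) (\<lambda>i. interarrival N (Suc i)) (UNIV :: nat set)"
  proof (rule indep_vars_reindex)
    show "indep_vars (\<lambda>_. borel) (interarrival N) (range Suc)"
      by (rule indep_vars_subset[OF ind]) auto
  qed simp
  then have "distr M (PiM UNIV (\<lambda>_. borel)) (\<lambda>\<omega>. \<lambda>i\<in>UNIV. interarrival N (Suc i) \<omega>) =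
      PiM UNIV (\<lambda>i. distr M borel (interarrival N (Suc i)))"
    by (subst (asm) indep_vars_iff_distr_eq_PiM) (auto intro: interarrival_measurable[OF cp])
  then have W: "distr M (PiM UNIV (\<lambda>_. borel)) ?W = exp_seq y"
    by (simp add: law restrict_def)
  note W_meas = interarrival_seq_measurable[OF cp]
  let ?ps = "grid_jumps t \<kappa> m"
  have d: "0 \<le> t j - t (j - 1)" if "j \<in> {1..m}" for j
    using grid_mono[OF grid, of "j - 1" j] that by simp
  have "?E = ?W -` {w. jumps 0 0 ?ps w} \<inter> space M"
    using incr_eq_iff_jumps[OF cp _ grid] by auto
  also have "emeasure M \<dots> = emeasure (distr M (PiM UNIV (\<lambda>_. borel)) ?W) {w. jumps 0 0 ?ps w}"
    using jumps_measurable[of 0 0 ?ps]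
    by (intro emeasure_distr[symmetric] W_meas) (simp add: pred_def space_PiM)
  also have "\<dots> = ennreal (\<Prod>(d, k)\<leftarrow>?ps. poisson_weight y d k)"
    unfolding W by (rule emeasure_exp_seq_jumps[OF y]) (use d in \<open>auto simp: grid_jumps_def\<close>)
  also have "(\<Prod>(d, k)\<leftarrow>?ps. poisson_weight y d k) = ?c"
    by (rule prod_grid_jumps)
  finally have "ennreal (prob ?E) =
      ennreal ?c"
    by (simp only: emeasure_eq_measure)
  moreover have "0 \<le> ?c"
    using y by (intro prod_nonneg poisson_weight_nonneg d) simp_all
  ultimately show ?thesis
    by (simp only: ennreal_inj[OF measure_nonneg])
qed

theorem exponential_renewal_imp_PP:
  assumes cp: "counting_process M N" and y: "0 < y" and "prob_space M"
    and ind: "prob_space.indep_vars M (\<lambda>_. borel) (interarrival N) {1..}"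
    and law: "\<And>n. 1 \<le> n \<Longrightarrow> distr M borel (interarrival N n) = exp_law y"
  shows "PP M N y"
proof -
  interpret prob_space M by fact
  have fdd: "prob {\<omega> \<in> space M. \<forall>j\<in>{1..m}. incr N t j \<omega> = ereal (real (\<kappa> j))} =
      (\<Prod>j\<in>{1..m}. poisson_weight y (t j - t (j - 1)) (\<kappa> j))" if "time_grid m t" for m t \<kappa>
    using cp y \<open>prob_space M\<close> ind law that by (rule exponential_renewal_fdd)
  have incrs: "indep_vars (\<lambda>_. borel) (incr N t) {1..m} \<and>
      (\<forall>j\<in>{1..m}. distr M borel (incr N t j) = poisson_law (y * (t j - t (j - 1))))"
    if grid: "time_grid m t" for m t
  proof -
    have pos: "0 < y * (t j - t (j - 1))" if "j \<in> {1..m}" for j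
      using grid that y unfolding time_grid_def by (cases j) auto
    have ne: "{1..m} \<noteq> {}" using grid by (simp add: time_grid_def)
    have meas: "incr N t j \<in> borel_measurable M" if "j \<in> {1..m}" for j
      using that grid_nonneg[OF grid] by (intro incr_measurable cp) auto
    have atoms: "prob {\<omega> \<in> space M. \<forall>j\<in>{1..m}. incr N t j \<omega> = ereal (real (\<kappa> j))} =
        (\<Prod>j\<in>{1..m}. pmf (poisson_pmf (y * (t j - t (j - 1)))) (\<kappa> j))" for \<kappa>
      unfolding fdd[OF grid] by (intro prod.cong refl pmf_poisson_weight[symmetric] pos)
    show ?thesis
      using indep_vars_discrete[OF finite_atLeastAtMost ne meas atoms] pos
      by (simp add: poisson_law_eq_pmf)
  qed
  have vec: "distr M (PiM {1..m} (\<lambda>_. borel)) (incr_vec N t m) = PiM {1..m} (\<lambda>j. distr M borel (incr N t j))"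
    if "indep_vars (\<lambda>_. borel) (incr N t) {1..m}" "1 \<le> m" for m t
  proof -
    have "\<And>i. i \<in> {1..m} \<Longrightarrow> random_variable borel (incr N t i)"
      using that(1) by (simp add: indep_vars_def2)
    from indep_vars_iff_distr_eq_PiM'[where I = "{1..m}" and M' = "\<lambda>_. borel" and X = "incr N t", OF _ this] show ?thesis
      unfolding incr_vec_def[abs_def] using that by simp
  qed
  show ?thesis
    unfolding PP_def
  proof (intro conjI allI impI)
    fix m t assume "time_grid m t"
    then show "indep_vars (\<lambda>_. borel) (incr N t) {1..m}" using incrs by blast
  next
    fix m t and h :: real assume grid: "time_grid m t" and h: "0 < h"
    let ?s = "case_nat 0 (\<lambda>j. t j + h)" and ?t = "\<lambda>j. t j + h"
    have m: "1 \<le> m" using grid by (simp add: time_grid_def)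
    have s: "incr N ?t j = incr N ?s (Suc j)" if "1 \<le> j" for j
      using that by (cases j) (simp_all add: incr_def fun_eq_iff)
    note S = incrs[OF time_grid_shift[OF grid h]]
    have "indep_vars (\<lambda>_. borel) (\<lambda>j. incr N ?s (Suc j)) {1..m}"
      by (rule indep_vars_reindex[OF indep_vars_subset[OF conjunct1[OF S]]]) auto
    then have ind': "indep_vars (\<lambda>_. borel) (incr N ?t) {1..m}"
      using s by (subst indep_vars_cong[OF refl _ refl, where Y = "\<lambda>j. incr N ?s (Suc j)"]) auto
    have "distr M borel (incr N ?t j) = distr M borel (incr N t j)" if j: "j \<in> {1..m}" for j
    proof -
      have "distr M borel (incr N ?t j) = distr M borel (incr N ?s (Suc j))" using j s by simp
      also have "\<dots> = poisson_law (y * (?s (Suc j) - ?s j))" using S j by simp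
      also have "?s (Suc j) - ?s j = t j - t (j - 1)" using j by (cases j) auto
      also have "poisson_law (y * (t j - t (j - 1))) = distr M borel (incr N t j)" using incrs[OF grid] j by simp
      finally show ?thesis .
    qed
    then have "PiM {1..m} (\<lambda>j. distr M borel (incr N t j)) = PiM {1..m} (\<lambda>j. distr M borel (incr N ?t j))"
      by (intro PiM_cong) simp_all
    then show "distr M (PiM {1..m} (\<lambda>_. borel)) (incr_vec N t m) =
        distr M (PiM {1..m} (\<lambda>_. borel)) (incr_vec N ?t m)"
      by (simp only: vec[OF conjunct1[OF incrs[OF grid]] m] vec[OF ind' m])
  next
    fix t :: real assume t: "0 < t"
    have grid: "time_grid 1 (\<lambda>j. if j = 0 then 0 else t)" using t by (simp add: time_grid_def)
    have "distr M borel (incr N (\<lambda>j. if j = 0 then 0 else t) 1) = poisson_law (y * t)"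
      using incrs[OF grid] by simp
    also have "distr M borel (incr N (\<lambda>j. if j = 0 then 0 else t) 1) = distr M borel (N t)"
    proof (rule distr_cong[OF refl refl])
      fix \<omega> assume "\<omega> \<in> space M"
      then have "N 0 \<omega> = 0" using cp unfolding counting_process_def by blast
      then show "incr N (\<lambda>j. if j = 0 then 0 else t) 1 \<omega> = N t \<omega>" by (simp add: incr_def)
    qed
    finally show "distr M borel (N t) = poisson_law (y * t)" .
  qed
qed

section \<open>Consistent disintegrations as regular conditional probabilities\<close>

lemma disintegration_prob_space:
  assumes "disintegration M U D P" "y \<in> D"
  shows "prob_space (P y)" "sets (P y) = sets M" "space (P y) = space M"
  using assms sets_eq_imp_space_eq[of "P y" M] by (auto simp: disintegration_def)

text \<open>A kernel is prescribed on \<open>D\<close> only; the indicator extends its values to a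
  Borel function on the line.\<close>

lemma disintegration_measurable:
  assumes "disintegration M U D P" "D \<in> sets borel" "E \<in> sets M"
  shows "(\<lambda>y. indicator D y * measure (P y) E) \<in> borel_measurable borel"
  using assms borel_measurable_restrict_space_iff[of D borel "\<lambda>y. measure (P y) E"]
  by (simp add: disintegration_def)

text \<open>Used for the given kernels on \<open>D\<close> and, through
  \<open>regular_mixture\<close>, for the reparametrized kernels on the whole line.\<close>

locale consistent_disintegration = prob_space M
  for M :: "'a measure" and \<Theta> :: "'a \<Rightarrow> real" and D :: "real set" and P :: "real \<Rightarrow> 'a measure" +
  assumes \<Theta> [measurable]: "\<Theta> \<in> borel_measurable M"
    and D [measurable]: "D \<in> sets borel" and \<Theta>_D: "\<Theta> ` space M \<subseteq> D"
    and dis: "disintegration M (distr M borel \<Theta>) D P"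
    and cons: "consistent M (distr M borel \<Theta>) D P \<Theta>"
begin

lemma measurable_kernel:
  assumes "E \<in> sets M"
  shows "(\<lambda>\<omega>. measure (P (\<Theta> \<omega>)) E) \<in> borel_measurable M"
proof -
  note [measurable] = disintegration_measurable[OF dis D assms]
  have "(\<lambda>\<omega>. indicator D (\<Theta> \<omega>) * measure (P (\<Theta> \<omega>)) E) \<in> borel_measurable M" by measurable
  moreover have "indicator D (\<Theta> \<omega>) * measure (P (\<Theta> \<omega>)) E = measure (P (\<Theta> \<omega>)) E" if "\<omega> \<in> space M" for \<omega>
    using \<Theta>_D that by auto
  ultimately show ?thesis by (simp cong: measurable_cong)
qed

lemma measurable_kernel_vimage:
  assumes "E \<in> sets M"
  shows "(\<lambda>\<omega>. measure (P (\<Theta> \<omega>)) E) \<in> borel_measurable (vimage_algebra (space M) \<Theta> borel)"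
proof -
  have "\<Theta> \<in> borel_measurable (vimage_algebra (space M) \<Theta> borel)"
    by (rule measurable_vimage_algebra1) simp
  from measurable_compose[OF this disintegration_measurable[OF dis D assms]]
  have *: "(\<lambda>\<omega>. indicator D (\<Theta> \<omega>) * measure (P (\<Theta> \<omega>)) E) \<in> borel_measurable (vimage_algebra (space M) \<Theta> borel)" .
  have "measure (P (\<Theta> \<omega>)) E = indicator D (\<Theta> \<omega>) * measure (P (\<Theta> \<omega>)) E"
    if "\<omega> \<in> space (vimage_algebra (space M) \<Theta> borel)" for \<omega>
    using \<Theta>_D that by auto
  from measurable_cong[where f = "\<lambda>\<omega>. measure (P (\<Theta> \<omega>)) E", OF this] show ?thesis
    using * by blast
qed

lemma integral_kernel:
  assumes E: "E \<in> sets M"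
  shows "(\<integral>\<omega>. measure (P (\<Theta> \<omega>)) E \<partial>M) = prob E"
proof -
  have "prob E = (LINT y:D|distr M borel \<Theta>. measure (P y) E)"
    using dis E by (simp add: disintegration_def)
  also have "\<dots> = (\<integral>y. indicator D y * measure (P y) E \<partial>distr M borel \<Theta>)"
    by (simp add: set_lebesgue_integral_def)
  also have "\<dots> = (\<integral>\<omega>. indicator D (\<Theta> \<omega>) * measure (P (\<Theta> \<omega>)) E \<partial>M)"
    by (intro integral_distr \<Theta> disintegration_measurable[OF dis D E])
  also have "\<dots> = (\<integral>\<omega>. measure (P (\<Theta> \<omega>)) E \<partial>M)"
    using \<Theta>_D by (intro Bochner_Integration.integral_cong) auto
  finally show ?thesis by simp
qed

lemma kernel_prob_space:
  assumes "\<omega> \<in> space M"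
  shows "prob_space (P (\<Theta> \<omega>))" "sets (P (\<Theta> \<omega>)) = sets M" "space (P (\<Theta> \<omega>)) = space M"
  using assms \<Theta>_D disintegration_prob_space[OF dis] by blast+

lemma AE_kernel_consistent:
  assumes B: "B \<in> sets borel"
  shows "AE \<omega> in M. \<Theta> \<omega> \<in> B \<longrightarrow> measure (P (\<Theta> \<omega>)) (\<Theta> -` B \<inter> space M) = 1"
proof -
  have "D \<inter> B \<in> sets borel" using B D by simp
  then have "AE y in distr M borel \<Theta>. y \<in> D \<inter> B \<longrightarrow> measure (P y) (\<Theta> -` (D \<inter> B) \<inter> space M) = 1"
    using cons[unfolded consistent_def, THEN bspec, THEN mp] by blast
  from AE_distrD[OF \<Theta> this]
  have AE: "AE \<omega> in M. \<Theta> \<omega> \<in> D \<inter> B \<longrightarrow> measure (P (\<Theta> \<omega>)) (\<Theta> -` (D \<inter> B) \<inter> space M) = 1" .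
  have eq: "\<Theta> -` (D \<inter> B) \<inter> space M = \<Theta> -` B \<inter> space M" using \<Theta>_D by auto
  show ?thesis
    using AE AE_space
  proof eventually_elim
    case (elim \<omega>)
    then show ?case using \<Theta>_D unfolding eq by blast
  qed
qed

text \<open>Consistency for \<open>B\<close> and for its complement: the kernel gives the event that
  \<open>\<Theta>\<close> lies in \<open>B\<close> mass one or mass zero, according to whether its
  own parameter lies in \<open>B\<close>.\<close>

lemma AE_kernel_restrict:
  assumes B: "B \<in> sets borel" and E: "E \<in> sets M"
  shows "AE \<omega> in M. measure (P (\<Theta> \<omega>)) (E \<inter> (\<Theta> -` B \<inter> space M)) = indicator B (\<Theta> \<omega>) * measure (P (\<Theta> \<omega>)) E"
  using AE_kernel_consistent[OF B] AE_kernel_consistent[OF borel_comp[OF B]] AE_space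
proof eventually_elim
  case (elim \<omega>)
  interpret K: prob_space "P (\<Theta> \<omega>)" using kernel_prob_space elim(3) by blast
  note sets_K = kernel_prob_space(2)[OF elim(3)]
  have meas: "\<Theta> -` B \<inter> space M \<in> sets M" "\<Theta> -` (- B) \<inter> space M \<in> sets M"
    using measurable_sets[OF \<Theta> B] measurable_sets[OF \<Theta> borel_comp[OF B]] by simp_all
  show ?case
  proof (cases "\<Theta> \<omega> \<in> B")
    case True
    then have "K.prob (\<Theta> -` B \<inter> space M) = 1" using elim(1) by simp
    then have "K.prob (E \<inter> (\<Theta> -` B \<inter> space M)) = K.prob E"
      using meas E sets_K B by (intro measure_eq_AE) (auto simp: K.prob_eq_1)
    then show ?thesis using True by simp
  next
    case False
    then have "K.prob (\<Theta> -` (- B) \<inter> space M) = 1" using elim(2) by simp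
    then have "AE x in P (\<Theta> \<omega>). x \<in> \<Theta> -` (- B) \<inter> space M"
      using sets_K B by (subst (asm) K.prob_eq_1) auto
    then have "AE x in P (\<Theta> \<omega>). x \<notin> E \<inter> (\<Theta> -` B \<inter> space M)" by eventually_elim auto
    then have "K.prob (E \<inter> (\<Theta> -` B \<inter> space M)) = 0"
      using E sets_K B by (subst K.prob_eq_0) auto
    then show ?thesis using False by simp
  qed
qed

lemma integral_kernel_restrict:
  assumes B: "B \<in> sets borel" and E: "E \<in> sets M"
  shows "(\<integral>\<omega>. indicator B (\<Theta> \<omega>) * measure (P (\<Theta> \<omega>)) E \<partial>M) = prob (E \<inter> (\<Theta> -` B \<inter> space M))"
proof -
  have "\<Theta> -` B \<inter> space M \<in> sets M" using B by measurable
  then have meas: "E \<inter> (\<Theta> -` B \<inter> space M) \<in> sets M" using E by simp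
  have "prob (E \<inter> (\<Theta> -` B \<inter> space M)) = (\<integral>\<omega>. measure (P (\<Theta> \<omega>)) (E \<inter> (\<Theta> -` B \<inter> space M)) \<partial>M)"
    by (rule integral_kernel[OF meas, symmetric])
  also have "\<dots> = (\<integral>\<omega>. indicator B (\<Theta> \<omega>) * measure (P (\<Theta> \<omega>)) E \<partial>M)"
    by (intro integral_cong_AE AE_kernel_restrict B E measurable_kernel meas borel_measurable_times
        measurable_kernel[OF E] measurable_compose[OF \<Theta> borel_measurable_indicator[OF B]])
  finally show ?thesis by simp
qed

text \<open>Integrating the kernel over a set generated by \<open>\<Theta>\<close> gives the
  probability of the intersection, which characterizes the conditional probability. Conditional
  independence and conditional laws thereby become statements about kernels.\<close>

theorem AE_cprob_eq_kernel:
  assumes E: "E \<in> sets M"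
  shows "AE \<omega> in M. cprob M \<Theta> E \<omega> = measure (P (\<Theta> \<omega>)) E"
proof -
  let ?F = "vimage_algebra (space M) \<Theta> borel"
  have sets_F: "sets ?F = {\<Theta> -` A \<inter> space M |A. A \<in> sets borel}"
    by (rule sets_vimage_algebra2) simp
  interpret finite_measure_subalgebra M ?F
  proof
    show "subalgebra M ?F"
      unfolding subalgebra_def sets_F by (auto intro: measurable_sets[OF \<Theta>])
  qed
  show ?thesis
    unfolding cprob_def
  proof (rule real_cond_exp_charact)
    fix A assume "A \<in> sets ?F"
    then obtain B where B: "B \<in> sets borel" "A = \<Theta> -` B \<inter> space M" unfolding sets_F by auto
    have A: "A \<in> sets M" unfolding B(2) using B(1) by measurable
    have "(LINT x:A|M. indicator E x) = (\<integral>x. indicator (E \<inter> A) x \<partial>M)"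
      unfolding set_lebesgue_integral_def by (intro Bochner_Integration.integral_cong) (auto split: split_indicator)
    also have "\<dots> = prob (E \<inter> A)"
      using E A by (simp add: sets.Int_space_eq2)
    also have "\<dots> = (\<integral>\<omega>. indicator B (\<Theta> \<omega>) * measure (P (\<Theta> \<omega>)) E \<partial>M)"
      unfolding B(2) by (rule integral_kernel_restrict[OF B(1) E, symmetric])
    also have "\<dots> = (LINT x:A|M. measure (P (\<Theta> x)) E)"
      unfolding set_lebesgue_integral_def B(2)
      by (intro Bochner_Integration.integral_cong) (auto split: split_indicator)
    finally show "(LINT x:A|M. indicator E x) = (LINT x:A|M. measure (P (\<Theta> x)) E)" .
  next
    show "integrable M (indicator E :: 'a \<Rightarrow> real)" using E by (simp add: integrable_indicator_iff emeasure_eq_measure)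
    show "integrable M (\<lambda>x. measure (P (\<Theta> x)) E)"
      by (rule integrable_const_bound[of _ 1])
         (auto intro!: AE_I2 measurable_kernel E simp: prob_space.prob_le_1[OF kernel_prob_space(1)])
    show "(\<lambda>x. measure (P (\<Theta> x)) E) \<in> borel_measurable ?F" by (rule measurable_kernel_vimage[OF E])
  qed
qed

end

section \<open>Independence tested at rational bounds\<close>

lemma sigma_sets_atMost_rat: "sigma_sets UNIV (range (\<lambda>q::rat. {..real_of_rat q})) = sets borel"
proof (rule antisym)
  show "sigma_sets UNIV (range (\<lambda>q::rat. {..real_of_rat q})) \<subseteq> sets borel"
    by (intro sets.sigma_sets_subset') auto
  let ?M = "sigma UNIV (range (\<lambda>q::rat. {..real_of_rat q}))"
  have "(\<lambda>x::real. x) \<in> borel_measurable ?M"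
  proof (rule borel_measurableI_le)
    fix a :: real
    have "{x. x \<le> a} = (\<Inter>q\<in>{q. a < real_of_rat q}. {..real_of_rat q})"
    proof (intro set_eqI iffI)
      fix x assume x: "x \<in> (\<Inter>q\<in>{q. a < real_of_rat q}. {..real_of_rat q})"
      show "x \<in> {x. x \<le> a}"
      proof (rule ccontr)
        assume "x \<notin> {x. x \<le> a}"
        then obtain q where "a < real_of_rat q" "real_of_rat q < x" using of_rat_dense[of a x] by auto
        then show False using x by auto
      qed
    qed auto
    also have "\<dots> \<in> sets ?M"
    proof (rule sets.countable_INT'')
      show "UNIV \<in> sets ?M" using sets.top[of ?M] by simp
    qed auto
    finally show "{x \<in> space ?M. x \<le> a} \<in> sets ?M" by simp
  qed
  then have "sets (borel :: real measure) \<subseteq> sets ?M"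
    by (auto dest: measurable_sets)
  then show "sets borel \<subseteq> sigma_sets UNIV (range (\<lambda>q::rat. {..real_of_rat q}))" by simp
qed

text \<open>Rational half-lines form an intersection-stable generator. The bounds are extensional
  functions on a finite \<open>J\<close>, so there are countably many tests for each
  \<open>J\<close> and null sets can be collected.\<close>

lemma (in prob_space) indep_vars_rat_cdf:
  fixes X :: "'i \<Rightarrow> 'a \<Rightarrow> real"
  assumes X: "\<And>i. i \<in> I \<Longrightarrow> random_variable borel (X i)"
    and prod: "\<And>J q. J \<subseteq> I \<Longrightarrow> finite J \<Longrightarrow> J \<noteq> {} \<Longrightarrow> q \<in> PiE J (\<lambda>_. UNIV :: rat set) \<Longrightarrow>
      prob (\<Inter>j\<in>J. {\<omega>\<in>space M. X j \<omega> \<le> of_rat (q j)}) = (\<Prod>j\<in>J. prob {\<omega>\<in>space M. X j \<omega> \<le> of_rat (q j)})"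
  shows "indep_vars (\<lambda>_. borel) X I"
proof -
  let ?G = "\<lambda>i. (\<lambda>q::rat. {\<omega>\<in>space M. X i \<omega> \<le> of_rat q}) ` UNIV"
  have G: "?G i = {X i -` A \<inter> space M |A. A \<in> range (\<lambda>q::rat. {..real_of_rat q})}" for i
    by (auto simp: vimage_def Int_def conj_commute)
  have "sigma_sets (space M) (?G i) = {X i -` A \<inter> space M |A. A \<in> sets borel}" for i
    unfolding G using sigma_sets_vimage_commute[of "X i" "space M" UNIV "range (\<lambda>q::rat. {..real_of_rat q})"]
    by (simp add: sigma_sets_atMost_rat)
  moreover have "indep_sets (\<lambda>i. sigma_sets (space M) (?G i)) I"
  proof (rule indep_sets_sigma)
    show "indep_sets ?G I"
    proof (rule indep_setsI)
      show "?G i \<subseteq> events" if "i \<in> I" for i using X[OF that] by auto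
      fix A J assume J: "J \<noteq> {}" "J \<subseteq> I" "finite J" and A: "\<forall>j\<in>J. A j \<in> ?G j"
      then have "\<forall>j\<in>J. \<exists>q::rat. A j = {\<omega>\<in>space M. X j \<omega> \<le> of_rat q}" by auto
      from bchoice[OF this] obtain q :: "'i \<Rightarrow> rat"
        where q: "\<And>j. j \<in> J \<Longrightarrow> A j = {\<omega>\<in>space M. X j \<omega> \<le> of_rat (q j)}" by blast
      show "prob (\<Inter>j\<in>J. A j) = (\<Prod>j\<in>J. prob (A j))"
        using prod[OF J(2,3,1), of "restrict q J"] q by simp
    qed
    show "Int_stable (?G i)" for i
    proof (rule Int_stableI)
      fix a b assume "a \<in> ?G i" "b \<in> ?G i"
      then obtain q r :: rat where "a = {\<omega>\<in>space M. X i \<omega> \<le> of_rat q}" "b = {\<omega>\<in>space M. X i \<omega> \<le> of_rat r}" by auto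
      then have "a \<inter> b = {\<omega>\<in>space M. X i \<omega> \<le> of_rat (min q r)}" by (auto simp: min_def of_rat_less_eq intro: order_trans)
      then show "a \<inter> b \<in> ?G i" by blast
    qed
  qed
  ultimately show ?thesis using X by (simp add: indep_vars_def2)
qed

section \<open>Interarrival times of a mixed Poisson process\<close>

lemma emeasure_exp_law_greater:
  assumes l: "0 < l" and s: "0 \<le> s"
  shows "emeasure (exp_law l) {s<..} = ennreal (exp (- l * s))"
proof -
  interpret E: prob_space "exp_law l" by (rule prob_space_exp_law[OF l])
  have "distr (exp_law l) lborel (\<lambda>x. x) = density lborel (exponential_density l)"
    by (subst distr_id2) (simp_all add: exp_law_def)
  then have "distributed (exp_law l) lborel (\<lambda>x. x) (exponential_density l)"
    by (simp add: distributed_def)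
  from E.exponential_distributedD_gt[OF this s l] show ?thesis
    by (simp add: E.emeasure_eq_measure greaterThan_def mult.commute)
qed

lemma emeasure_exp_seq_box:
  assumes l: "0 < l" and s: "\<And>i. i < n \<Longrightarrow> 0 \<le> s i"
  shows "emeasure (exp_seq l) {w. \<forall>i<n. s i < w i} = ennreal (\<Prod>i<n. exp (- l * s i))"
proof -
  interpret product_prob_space "\<lambda>_. exp_law l" "UNIV :: nat set"
    by (intro product_prob_spaceI prob_space_exp_law l)
  have "{w. \<forall>i<n. s i < w i} = {w \<in> space (exp_seq l). \<forall>i\<in>{..<n}. w i \<in> {s i<..}}" by auto
  also have "emeasure (exp_seq l) \<dots> = (\<Prod>i\<in>{..<n}. emeasure (exp_law l) {s i<..})"
    by (rule emeasure_PiM_Collect) simp_all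
  also have "\<dots> = (\<Prod>i<n. ennreal (exp (- l * s i)))"
    using s by (intro prod.cong refl emeasure_exp_law_greater l) simp
  finally show ?thesis by (simp add: prod_ennreal)
qed

lemma partial_sum_strict_mono:
  assumes "\<And>i. 0 < w i" "m < n"
  shows "partial_sum w m < partial_sum w n"
  using assms(2)
proof (induction n)
  case (Suc n)
  then show ?case using assms(1)[of n] by (cases "m = n") (simp_all add: partial_sum_def)
qed simp

lemma partial_sum_less_cancel:
  assumes "\<And>i. 0 < w i" "partial_sum w m < partial_sum w n"
  shows "m < n"
  using partial_sum_strict_mono[of w n m, OF assms(1)] assms(2) by (cases m n rule: linorder_cases) auto

lemma poisson_weight_prod_measurable [measurable]:
  "(\<lambda>l. \<Prod>(d, k)\<leftarrow>ps. poisson_weight l d k) \<in> borel_measurable borel"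
proof (induction ps)
  case (Cons p ps)
  obtain d k where "p = (d, k)" by (cases p)
  then show ?case using Cons by (simp add: poisson_weight_def) 
qed simp

text \<open>\<open>A\<close> stands for the unconditional law of the interarrival times and
  \<open>U\<close> for the mixing law. Only probabilities of jump patterns over positive durations
  are given, as time grids supply them. The indicator keeps to rates at which \<open>exp_law\<close>
  is a probability.\<close>

locale mixed_poisson_sequence = A: prob_space A + U: prob_space U
  for A :: "(nat \<Rightarrow> real) measure" and U :: "real measure" +
  assumes sets_A [measurable_cong]: "sets A = sets (PiM UNIV (\<lambda>_::nat. borel))"
    and sets_U [measurable_cong]: "sets U = sets borel"
    and A_pos: "AE w in A. \<forall>i. 0 < w i" and U_pos: "AE l in U. 0 < l"
    and jumps_A: "\<And>ps. ps \<noteq> [] \<Longrightarrow> \<forall>(d, k)\<in>set ps. 0 < d \<Longrightarrow> emeasure A {w. jumps 0 0 ps w} =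
      (\<integral>\<^sup>+l. indicator {0<..} l * ennreal (\<Prod>(d, k)\<leftarrow>ps. poisson_weight l d k) \<partial>U)"
begin

definition \<Omega> :: "(nat \<Rightarrow> real) set" where
  "\<Omega> = {w. \<forall>i. 0 < w i}"

text \<open>The identity to be spread by a Dynkin argument inside \<open>\<Omega>\<close>.
  Measurability in the rate belongs to it, so that both are carried through the set operations
  together.\<close>

definition agree :: "(nat \<Rightarrow> real) set \<Rightarrow> bool" where
  "agree E \<longleftrightarrow> E \<in> sets A \<and> E \<subseteq> \<Omega> \<and>
     (\<lambda>l. indicator {0<..} l * emeasure (exp_seq l) E) \<in> borel_measurable borel \<and>
     emeasure A E = (\<integral>\<^sup>+l. indicator {0<..} l * emeasure (exp_seq l) E \<partial>U)"

lemma space_A [simp]: "space A = UNIV"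
  using sets_eq_imp_space_eq[OF sets_A] by (simp add: space_PiM)

lemma sets_exp_seq_A: "sets (exp_seq l) = sets A"
  by (simp add: sets_A sets_exp_seq)

lemma \<Omega>_sets [measurable]: "\<Omega> \<in> sets A"
proof -
  have "{w \<in> space (PiM UNIV (\<lambda>_::nat. borel)). \<forall>i. (0::real) < w i} \<in> sets (PiM UNIV (\<lambda>_::nat. borel))"
    by measurable
  then show ?thesis by (simp add: \<Omega>_def sets_A space_PiM)
qed

lemma AE_\<Omega>: "AE w in A. w \<in> \<Omega>" "0 < l \<Longrightarrow> AE w in exp_seq l. w \<in> \<Omega>"
  using A_pos AE_exp_seq_pos[of l] by (simp_all add: \<Omega>_def)

lemma emeasure_\<Omega>:
  assumes "E \<in> sets A"
  shows "emeasure A (\<Omega> \<inter> E) = emeasure A E" "0 < l \<Longrightarrow> emeasure (exp_seq l) (\<Omega> \<inter> E) = emeasure (exp_seq l) E"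
proof -
  show "emeasure A (\<Omega> \<inter> E) = emeasure A E"
  proof (rule emeasure_eq_AE)
    show "AE w in A. w \<in> \<Omega> \<inter> E \<longleftrightarrow> w \<in> E" using AE_\<Omega>(1) by eventually_elim simp
  qed (use assms in simp_all)
  show "emeasure (exp_seq l) (\<Omega> \<inter> E) = emeasure (exp_seq l) E" if "0 < l"
  proof (rule emeasure_eq_AE)
    show "AE w in exp_seq l. w \<in> \<Omega> \<inter> E \<longleftrightarrow> w \<in> E" using AE_\<Omega>(2)[OF that] by eventually_elim simp
  qed (use assms in \<open>simp_all add: sets_exp_seq_A\<close>)
qed

lemma agree_UN:
  fixes F :: "nat \<Rightarrow> (nat \<Rightarrow> real) set"
  assumes F: "\<And>i. agree (F i)" and disj: "disjoint_family F"
  shows "agree (\<Union>i. F i)"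
proof -
  have FA: "F i \<in> sets A" for i using F by (simp add: agree_def)
  have meas [measurable]: "(\<lambda>l. indicator {0<..} l * emeasure (exp_seq l) (F i)) \<in> borel_measurable borel" for i
    using F by (simp add: agree_def)
  have sum: "indicator {0<..} l * emeasure (exp_seq l) (\<Union>i. F i) =
      (\<Sum>i. indicator {0<..} l * emeasure (exp_seq l) (F i))" for l
    using suminf_emeasure[of F "exp_seq l"] FA disj
    by (simp add: sets_exp_seq_A ennreal_suminf_cmult image_subset_iff)
  have "emeasure A (\<Union>i. F i) = (\<Sum>i. emeasure A (F i))"
    using suminf_emeasure[of F A] FA disj by (simp add: image_subset_iff)
  also have "\<dots> = (\<Sum>i. \<integral>\<^sup>+l. indicator {0<..} l * emeasure (exp_seq l) (F i) \<partial>U)"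
    using F by (simp add: agree_def)
  also have "\<dots> = (\<integral>\<^sup>+l. (\<Sum>i. indicator {0<..} l * emeasure (exp_seq l) (F i)) \<partial>U)"
    using meas by (intro nn_integral_suminf[symmetric]) (simp add: measurable_cong_sets[OF sets_U refl])
  finally have "emeasure A (\<Union>i. F i) = (\<integral>\<^sup>+l. indicator {0<..} l * emeasure (exp_seq l) (\<Union>i. F i) \<partial>U)"
    by (simp only: sum)
  moreover have "(\<lambda>l. indicator {0<..} l * emeasure (exp_seq l) (\<Union>i. F i)) \<in> borel_measurable borel"
    unfolding sum by measurable
  moreover have "(\<Union>i. F i) \<subseteq> \<Omega>" using F by (auto simp: agree_def)
  ultimately show ?thesis using FA by (simp add: agree_def sets.countable_UN)
qed

lemma agree_empty: "agree {}"
  by (simp add: agree_def)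

lemma agree_finite_UN:
  fixes F :: "nat \<Rightarrow> (nat \<Rightarrow> real) set"
  assumes "\<And>i. i \<in> K \<Longrightarrow> agree (F i)" and "disjoint_family_on F K"
  shows "agree (\<Union>i\<in>K. F i)"
proof -
  have "agree (\<Union>i. if i \<in> K then F i else {})"
    using assms agree_empty by (intro agree_UN) (auto simp: disjoint_family_on_def)
  moreover have "(\<Union>i. if i \<in> K then F i else {}) = (\<Union>i\<in>K. F i)" by (auto split: if_splits)
  ultimately show ?thesis by simp
qed

lemma integral_pos_indicator: "(\<integral>\<^sup>+l. indicator {0<..} l \<partial>U) = 1"
proof -
  have "AE l in U. indicator {0<..} l = (1 :: ennreal)"
    using U_pos by eventually_elim simp
  then have "(\<integral>\<^sup>+l. indicator {0<..} l \<partial>U) = (\<integral>\<^sup>+l. 1 \<partial>U)"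
    by (rule nn_integral_cong_AE)
  then show ?thesis using U.emeasure_space_1 by simp
qed

lemma agree_jumps:
  assumes "\<forall>(d, k)\<in>set ps. 0 < d"
  shows "agree (\<Omega> \<inter> {w. jumps 0 0 ps w})"
proof -
  let ?E = "{w. jumps 0 0 ps w}"
  have E: "?E \<in> sets A"
    using jumps_measurable[of 0 0 ps] by (simp add: pred_def space_PiM sets_A)
  have "indicator {0<..} l * emeasure (exp_seq l) (\<Omega> \<inter> ?E) =
      indicator {0<..} l * ennreal (\<Prod>(d, k)\<leftarrow>ps. poisson_weight l d k)" for l
  proof (cases "0 < l")
    case True
    have "\<forall>(d, k)\<in>set ps. 0 \<le> d" using assms by (auto intro: less_imp_le)
    then show ?thesis using True by (simp add: emeasure_\<Omega>[OF E] emeasure_exp_seq_jumps)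
  qed simp
  note eq = this
  have "emeasure A (\<Omega> \<inter> ?E) = (\<integral>\<^sup>+l. indicator {0<..} l * ennreal (\<Prod>(d, k)\<leftarrow>ps. poisson_weight l d k) \<partial>U)"
  proof (cases "ps = []")
    case True
    show ?thesis
      using integral_pos_indicator True emeasure_\<Omega>(1)[OF E] A.emeasure_space_1 by simp
  next
    case False
    then show ?thesis using jumps_A[OF False assms] emeasure_\<Omega>(1)[OF E] by simp
  qed
  then show ?thesis
    unfolding agree_def eq using E by (auto intro!: borel_measurable_times_ennreal)
qed

text \<open>That fewer than \<open>b + 1\<close> arrivals have occurred by time \<open>u\<close> is
  split according to the exact count at \<open>u\<close>; an exact count extends the pattern by one
  period ending at \<open>u\<close>.\<close>

lemma jumps_partition:
  assumes pos: "\<And>i. 0 < w i" and u: "sum_list (map fst ps) < u" and nonneg: "\<forall>(d, k)\<in>set ps. 0 < d"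
  defines "n \<equiv> sum_list (map snd ps)"
  shows "jumps 0 0 ps w \<and> u < partial_sum w (Suc b) \<longleftrightarrow>
    (\<exists>k. n + k \<le> b \<and> jumps 0 0 (ps @ [(u - sum_list (map fst ps), k)]) w)"
proof
  assume asm: "jumps 0 0 ps w \<and> u < partial_sum w (Suc b)"
  \<comment> \<open>\<open>m\<close> is the count at time \<open>u\<close>; minimality gives
    \<open>partial_sum w m \<le> u\<close>.\<close>
  define m where "m = (LEAST j. u < partial_sum w (Suc j))"
  have m: "u < partial_sum w (Suc m)" "m \<le> b"
    unfolding m_def using asm by (auto intro: LeastI Least_le)
  have "0 \<le> sum_list (map fst ps)"
    using nonneg by (intro sum_list_nonneg) (auto intro: less_imp_le)
  then have "partial_sum w m \<le> u"
    using u not_less_Least[of "m - 1" "\<lambda>j. u < partial_sum w (Suc j)"]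
    by (cases m) (auto simp: m_def[symmetric] partial_sum_def[of w 0])
  moreover have "partial_sum w n \<le> sum_list (map fst ps)"
    using jumps_last[of 0 0 ps w] asm pos[of 0] by (simp add: n_def partial_sum_def[of w 0] partial_sum_def[of w "Suc 0"])
  then have "n < Suc m"
    using m(1) u by (intro partial_sum_less_cancel[of w, OF pos]) simp
  ultimately show "\<exists>k. n + k \<le> b \<and> jumps 0 0 (ps @ [(u - sum_list (map fst ps), k)]) w"
    using m asm by (intro exI[of _ "m - n"]) (simp add: jumps_snoc n_def)
next
  assume "\<exists>k. n + k \<le> b \<and> jumps 0 0 (ps @ [(u - sum_list (map fst ps), k)]) w"
  then obtain k where k: "n + k \<le> b" "jumps 0 0 ps w" "u < partial_sum w (Suc (n + k))"
    by (auto simp: jumps_snoc n_def)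
  have "partial_sum w (Suc (n + k)) \<le> partial_sum w (Suc b)"
    using k(1) partial_sum_strict_mono[of w "Suc (n + k)" "Suc b", OF pos] by (cases "n + k = b") auto
  then show "jumps 0 0 ps w \<and> u < partial_sum w (Suc b)" using k by simp
qed

text \<open>Each bound in turn is resolved into finitely many disjoint exact counts, which lengthens
  \<open>ps\<close>. Sorting the times gives every new period a positive duration.\<close>

lemma agree_jumps_bounds:
  assumes "\<forall>(d, k)\<in>set ps. 0 < d" "sorted_wrt (<) (sum_list (map fst ps) # us)"
  shows "agree (\<Omega> \<inter> {w. jumps 0 0 ps w \<and> (\<forall>u\<in>set us. u < partial_sum w (Suc (b u)))})"
  using assms
proof (induction us arbitrary: ps)
  case Nil
  then show ?case using agree_jumps[of ps] by simp
next
  case (Cons u us)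
  let ?n = "sum_list (map snd ps)"
  let ?ps = "\<lambda>k. ps @ [(u - sum_list (map fst ps), k)]"
  let ?F = "\<lambda>k. \<Omega> \<inter> {w. jumps 0 0 (?ps k) w \<and> (\<forall>u\<in>set us. u < partial_sum w (Suc (b u)))}"
  have u: "sum_list (map fst ps) < u" using Cons.prems by simp
  have "agree (\<Union>k\<in>{k. ?n + k \<le> b u}. ?F k)"
  proof (rule agree_finite_UN)
    show "agree (?F k)" for k
      using Cons.prems u by (intro Cons.IH) auto
    show "disjoint_family_on ?F {k. ?n + k \<le> b u}"
    proof (unfold disjoint_family_on_def, intro ballI impI equals0I)
      fix k k' w assume ne: "k \<noteq> k'" and w: "w \<in> ?F k \<inter> ?F k'"
      then have pos: "\<And>i. 0 < w i" by (simp add: \<Omega>_def)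
      have "partial_sum w (?n + k) < partial_sum w (Suc (?n + k'))" "partial_sum w (?n + k') < partial_sum w (Suc (?n + k))"
        using w by (auto simp: jumps_snoc)
      then have "?n + k < Suc (?n + k')" "?n + k' < Suc (?n + k)"
        using partial_sum_less_cancel[of w, OF pos] by blast+
      then show False using ne by simp
    qed
  qed
  also have "(\<Union>k\<in>{k. ?n + k \<le> b u}. ?F k) =
      \<Omega> \<inter> {w. jumps 0 0 ps w \<and> (\<forall>u\<in>set (u # us). u < partial_sum w (Suc (b u)))}"
  proof (intro set_eqI)
    fix w
    show "w \<in> (\<Union>k\<in>{k. ?n + k \<le> b u}. ?F k) \<longleftrightarrow>
        w \<in> \<Omega> \<inter> {w. jumps 0 0 ps w \<and> (\<forall>u\<in>set (u # us). u < partial_sum w (Suc (b u)))}"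
    proof (cases "w \<in> \<Omega>")
      case True
      then have "\<And>i. 0 < w i" by (simp add: \<Omega>_def)
      from jumps_partition[of w, OF this u Cons.prems(1), of "b u"] show ?thesis
        using True by auto
    qed simp
  qed
  finally show ?case .
qed

text \<open>Finitely many events that an arrival comes after a given positive time. Each time
  carries one bound; where two such events share a time, the smaller bound is the stronger, which
  makes the system closed under intersection.\<close>

definition generator :: "(nat \<Rightarrow> real) set set" where
  "generator = {\<Omega> \<inter> {w. \<forall>u\<in>T. u < partial_sum w (Suc (b u))} |T b. finite T \<and> T \<subseteq> {0<..}}"

lemma agree_generator:
  assumes "E \<in> generator"
  shows "agree E"
proof -
  obtain T b where T: "finite T" "T \<subseteq> {0<..}" and E: "E = \<Omega> \<inter> {w. \<forall>u\<in>T. u < partial_sum w (Suc (b u))}"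
    using assms by (auto simp: generator_def)
  have "agree (\<Omega> \<inter> {w. jumps 0 0 [] w \<and> (\<forall>u\<in>set (sorted_list_of_set T). u < partial_sum w (Suc (b u)))})"
    using T by (intro agree_jumps_bounds) auto
  then show ?thesis using T by (simp add: E)
qed

lemma Int_stable_generator: "Int_stable generator"
proof (rule Int_stableI)
  fix E E' assume "E \<in> generator" "E' \<in> generator"
  then obtain T b T' b' where T: "finite T" "T \<subseteq> {0<..}" "finite T'" "T' \<subseteq> {0<..}"
    and E: "E = \<Omega> \<inter> {w. \<forall>u\<in>T. u < partial_sum w (Suc (b u))}"
      "E' = \<Omega> \<inter> {w. \<forall>u\<in>T'. u < partial_sum w (Suc (b' u))}"
    by (auto simp: generator_def)
  define c where "c u = (if u \<in> T \<and> u \<in> T' then min (b u) (b' u) else if u \<in> T then b u else b' u)" for u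
  have "(\<forall>u\<in>T \<union> T'. u < partial_sum w (Suc (c u))) \<longleftrightarrow>
      (\<forall>u\<in>T. u < partial_sum w (Suc (b u))) \<and> (\<forall>u\<in>T'. u < partial_sum w (Suc (b' u)))"
    if "w \<in> \<Omega>" for w
  proof -
    have pos: "\<And>i. 0 < w i" using that by (simp add: \<Omega>_def)
    have mono: "partial_sum w (Suc i) \<le> partial_sum w (Suc j)" if "i \<le> j" for i j
      using that partial_sum_strict_mono[of w "Suc i" "Suc j", OF pos] by (cases "i = j") auto
    have "u < partial_sum w (Suc (min i j)) \<longleftrightarrow> u < partial_sum w (Suc i) \<and> u < partial_sum w (Suc j)" for u i j
      using mono[of i j] mono[of j i] by (cases "i \<le> j") (auto simp: min_def)
    then show ?thesis by (auto simp: c_def split: if_splits)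
  qed
  then have "E \<inter> E' = \<Omega> \<inter> {w. \<forall>u\<in>T \<union> T'. u < partial_sum w (Suc (c u))}"
    unfolding E by blast
  then show "E \<inter> E' \<in> generator"
    unfolding generator_def using T by (intro CollectI exI[of _ "T \<union> T'"] exI[of _ c]) auto
qed

lemma agree_sigma_generator:
  assumes "E \<in> sigma_sets \<Omega> generator"
  shows "agree E"
proof (rule sigma_sets_induct_disjoint[OF Int_stable_generator _ assms])
  show "generator \<subseteq> Pow \<Omega>" by (auto simp: generator_def)
  show "agree E" if "E \<in> generator" for E using that by (rule agree_generator)
  show "agree {}" by (rule agree_empty)
  fix E assume "agree E"
  then have E: "E \<in> sets A" "E \<subseteq> \<Omega>"
    and meas: "(\<lambda>l. indicator {0<..} l * emeasure (exp_seq l) E) \<in> borel_measurable borel"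
    and eq: "emeasure A E = (\<integral>\<^sup>+l. indicator {0<..} l * emeasure (exp_seq l) E \<partial>U)"
    by (simp_all add: agree_def)
  \<comment> \<open>Complements are taken in \<open>\<Omega>\<close>, which has mass one under
    \<open>A\<close> and under \<open>exp_seq l\<close> for every positive \<open>l\<close>.\<close>
  have compl: "indicator {0<..} l * emeasure (exp_seq l) (\<Omega> - E) =
      indicator {0<..} l - indicator {0<..} l * emeasure (exp_seq l) E" for l
  proof (cases "0 < l")
    case True
    interpret L: prob_space "exp_seq l" by (intro prob_space_PiM prob_space_exp_law True)
    have "emeasure (exp_seq l) \<Omega> = 1"
      using emeasure_\<Omega>(2)[of UNIV l] True L.emeasure_space_1 sets.top[of A] by simp
    then show ?thesis using True E by (simp add: emeasure_Diff sets_exp_seq_A)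
  qed simp
  have "emeasure A \<Omega> = 1"
    using emeasure_\<Omega>(1)[of UNIV] A.emeasure_space_1 sets.top[of A] by simp
  then have "emeasure A (\<Omega> - E) = 1 - emeasure A E"
    using E by (simp add: emeasure_Diff)
  also have "1 = (\<integral>\<^sup>+l. indicator {0<..} l \<partial>U)" by (rule integral_pos_indicator[symmetric])
  also have "(\<integral>\<^sup>+l. indicator {0<..} l \<partial>U) - emeasure A E =
      (\<integral>\<^sup>+l. indicator {0<..} l - indicator {0<..} l * emeasure (exp_seq l) E \<partial>U)"
    unfolding eq
  proof (rule nn_integral_diff[symmetric])
    show "(\<lambda>l. indicator {0<..} l * emeasure (exp_seq l) E) \<in> borel_measurable U"
      using meas by (simp add: measurable_cong_sets[OF sets_U refl])
    show "(\<integral>\<^sup>+l. indicator {0<..} l * emeasure (exp_seq l) E \<partial>U) \<noteq> \<infinity>"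
      unfolding eq[symmetric] by simp
    show "AE l in U. indicator {0<..} l * emeasure (exp_seq l) E \<le> indicator {0<..} l"
    proof (rule AE_I2)
      fix l
      show "indicator {0<..} l * emeasure (exp_seq l) E \<le> indicator {0<..} l"
      proof (cases "0 < l")
        case True
        interpret L: prob_space "exp_seq l" by (intro prob_space_PiM prob_space_exp_law True)
        show ?thesis using True L.emeasure_le_1[of E] by simp
      qed simp
    qed
  qed simp
  finally have "emeasure A (\<Omega> - E) = (\<integral>\<^sup>+l. indicator {0<..} l * emeasure (exp_seq l) (\<Omega> - E) \<partial>U)"
    by (simp only: compl)
  moreover have "(\<lambda>l. indicator {0<..} l * emeasure (exp_seq l) (\<Omega> - E)) \<in> borel_measurable borel"
    unfolding compl using meas by (intro borel_measurable_minus_ennreal) simp_all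
  ultimately show "agree (\<Omega> - E)" using E by (simp add: agree_def)
next
  fix F :: "nat \<Rightarrow> _" assume "disjoint_family F" "\<And>i. agree (F i)"
  then show "agree (\<Union>i. F i)" by (intro agree_UN)
qed

text \<open>The generated sigma-algebra makes all partial sums measurable on
  \<open>\<Omega>\<close>, hence also their differences, the single coordinates. So it contains
  every box.\<close>

theorem emeasure_box:
  assumes s: "\<And>i. i < n \<Longrightarrow> 0 \<le> s i"
  shows "emeasure A {w. \<forall>i<n. s i < w i} =
    (\<integral>\<^sup>+l. indicator {0<..} l * ennreal (\<Prod>i<n. exp (- l * s i)) \<partial>U)"
proof -
  let ?B = "{w. \<forall>i<n. s i < w i}"
  let ?G = "sigma \<Omega> generator"
  have space_G: "space ?G = \<Omega>" and sets_G: "sets ?G = sigma_sets \<Omega> generator"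
    by (auto simp: generator_def intro!: space_measure_of sets_measure_of)
  have "(\<lambda>w. partial_sum w (Suc k)) \<in> borel_measurable ?G" for k
  proof (rule borel_measurableI_greater)
    fix a :: real
    show "{w \<in> space ?G. a < partial_sum w (Suc k)} \<in> sets ?G"
    proof (cases "0 < a")
      case True
      then have "\<Omega> \<inter> {w. \<forall>u\<in>{a}. u < partial_sum w (Suc k)} \<in> generator"
        unfolding generator_def by (intro CollectI exI[of _ "{a}"] exI[of _ "\<lambda>_. k"]) simp
      then have "\<Omega> \<inter> {w. \<forall>u\<in>{a}. u < partial_sum w (Suc k)} \<in> sets ?G" by (simp add: sets_G)
      also have "\<Omega> \<inter> {w. \<forall>u\<in>{a}. u < partial_sum w (Suc k)} = {w \<in> space ?G. a < partial_sum w (Suc k)}"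
        by (auto simp: space_G)
      finally show ?thesis .
    next
      \<comment> \<open>All positive-index sums exceed a bound \<open>a \<le> 0\<close> on
        \<open>\<Omega>\<close>, so positive times in the generator suffice.\<close>
      case False
      have "a < partial_sum w (Suc k)" if "w \<in> \<Omega>" for w
        using partial_sum_strict_mono[of w 0 "Suc k"] that False by (simp add: \<Omega>_def partial_sum_def[of w 0])
      then have "{w \<in> space ?G. a < partial_sum w (Suc k)} = space ?G" by (auto simp: space_G)
      then show ?thesis by simp
    qed
  qed
  then have S: "(\<lambda>w. partial_sum w k) \<in> borel_measurable ?G" for k
    by (cases k) (simp_all add: partial_sum_def[of _ 0])
  have "(\<lambda>w. w i) \<in> borel_measurable ?G" for i
  proof -
    have "(\<lambda>w. partial_sum w (Suc i) - partial_sum w i) \<in> borel_measurable ?G"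
      using S by (intro borel_measurable_diff)
    then show ?thesis by (simp add: partial_sum_def)
  qed
  then have [measurable]: "(\<lambda>w. w i) \<in> borel_measurable ?G" for i .
  have "{w \<in> space ?G. \<forall>i\<in>{..<n}. s i < w i} \<in> sets ?G" by measurable
  also have "{w \<in> space ?G. \<forall>i\<in>{..<n}. s i < w i} = \<Omega> \<inter> ?B"
    by (auto simp: space_G)
  finally have box_G: "\<Omega> \<inter> ?B \<in> sigma_sets \<Omega> generator"
    by (simp only: sets_G)
  have "{w \<in> space (PiM UNIV (\<lambda>_::nat. borel)). \<forall>i\<in>{..<n}. s i < w i} \<in> sets (PiM UNIV (\<lambda>_::nat. borel))"
    by measurable
  also have "{w \<in> space (PiM UNIV (\<lambda>_::nat. borel)). \<forall>i\<in>{..<n}. s i < w i} = ?B"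
    by (auto simp: space_PiM)
  finally have box: "?B \<in> sets A" by (simp only: sets_A)
  have "emeasure A ?B = emeasure A (\<Omega> \<inter> ?B)"
    by (rule emeasure_\<Omega>(1)[OF box, symmetric])
  also have "\<dots> = (\<integral>\<^sup>+l. indicator {0<..} l * emeasure (exp_seq l) (\<Omega> \<inter> ?B) \<partial>U)"
    using agree_sigma_generator[OF box_G] unfolding agree_def by (elim conjE)
  also have "\<dots> = (\<integral>\<^sup>+l. indicator {0<..} l * ennreal (\<Prod>i<n. exp (- l * s i)) \<partial>U)"
    using s by (intro nn_integral_cong) (simp add: indicator_def emeasure_\<Omega>(2)[OF box] emeasure_exp_seq_box)
  finally show ?thesis .
qed

end

section \<open>Mixtures of renewal processes with regular interarrival law\<close>

lemma continuous_zero_on_rationals: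
  fixes f :: "real \<Rightarrow> real"
  assumes cont: "continuous_on {0<..} f" and zero: "\<And>q::rat. 0 < q \<Longrightarrow> f (of_rat q) = 0" and x: "0 < x"
  shows "f x = 0"
proof (rule ccontr)
  assume "f x \<noteq> 0"
  have "open ({0<..} \<inter> f -` (- {0}))"
    by (rule continuous_open_preimage[OF cont]) auto
  moreover have "x \<in> {0<..} \<inter> f -` (- {0})" using x \<open>f x \<noteq> 0\<close> by simp
  ultimately obtain e where e: "0 < e" "ball x e \<subseteq> {0<..} \<inter> f -` (- {0})"
    unfolding open_contains_ball by blast
  obtain q :: rat where q: "x < of_rat q" "of_rat q < x + e" using of_rat_dense[of x "x + e"] e by auto
  then have "of_rat q \<in> ball x e" by (simp add: dist_real_def)
  then have "f (of_rat q) \<noteq> 0" using e by auto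
  moreover have "0 < (of_rat q :: real)" using q x by linarith
  then have "0 < q" by (simp only: zero_less_of_rat_iff)
  ultimately show False using zero by simp
qed

text \<open>Continuity extends the equation to real arguments, one at a time. Differentiating in
  \<open>s\<close> and letting \<open>s\<close> tend to 0 gives \<open>deriv F u = p * G u\<close>,
  so \<open>G u * exp (p * u)\<close> is a constant.\<close>

lemma exponential_functional_equation:
  fixes F :: "real \<Rightarrow> real"
  assumes diff: "\<And>t. 0 < t \<Longrightarrow> F differentiable at t" and cont: "continuous_on {0<..} (deriv F)"
    and pos: "\<And>t. 0 < t \<Longrightarrow> 0 < deriv F t" and lim: "(deriv F \<longlongrightarrow> p) (at_right 0)"
    and eq: "\<And>s t :: rat. 0 < s \<Longrightarrow> 0 < t \<Longrightarrow>
      1 - F (of_rat s + of_rat t) = (1 - F (of_rat s)) * (1 - F (of_rat t))"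
    and t: "0 < t"
  shows "1 - F t = exp (- p * t)"
proof -
  define G where "G t = 1 - F t" for t
  have dF: "(F has_real_derivative deriv F t) (at t)" if "0 < t" for t
    using diff[OF that] DERIV_deriv_iff_real_differentiable by blast
  have dG: "(G has_real_derivative - deriv F t) (at t)" if "0 < t" for t
    unfolding G_def by (auto intro!: derivative_eq_intros dF that)
  have contG: "continuous_on {0<..} G"
    by (intro continuous_at_imp_continuous_on ballI DERIV_isCont[OF dG]) simp
  have cont_comp: "continuous_on {0<..} (\<lambda>s. G (s + u))" if "0 < u" for u
    by (rule continuous_on_compose2[OF contG]) (use that in \<open>auto intro!: continuous_intros\<close>)
  have "G (s + of_rat q) - G s * G (of_rat q) = 0" if s: "0 < s" and q: "0 < q" for s and q :: rat
  proof (rule continuous_zero_on_rationals[OF _ _ s])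
    show "continuous_on {0<..} (\<lambda>s. G (s + of_rat q) - G s * G (of_rat q))"
      using q by (intro continuous_intros contG cont_comp) simp
  qed (use eq q in \<open>simp add: G_def\<close>)
  then have Gq: "G (of_rat q + s) - G (of_rat q) * G s = 0" if "0 < s" "0 < q" for s and q :: rat
    using that by (simp add: add.commute mult.commute)
  have Geq: "G (s + u) = G s * G u" if s: "0 < s" and u: "0 < u" for s u
  proof -
    have "G (s + u) - G s * G u = 0"
    proof (rule continuous_zero_on_rationals[OF _ _ s])
      show "continuous_on {0<..} (\<lambda>s. G (s + u) - G s * G u)"
        using u by (intro continuous_intros contG cont_comp) simp
    qed (use Gq u in simp)
    then show ?thesis by simp
  qed
  have dF_eq: "deriv F (s + u) = deriv F s * G u" if s: "0 < s" and u: "0 < u" for s u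
  proof -
    have "((\<lambda>s. G (s + u)) has_real_derivative - deriv F (s + u)) (at s)"
      using DERIV_shift[of G "- deriv F (s + u)" s u] dG[of "s + u"] s u by simp
    moreover have "((\<lambda>s. G s * G u) has_real_derivative - deriv F s * G u) (at s)"
      by (rule DERIV_cmult_right[OF dG[OF s]])
    then have "((\<lambda>s. G (s + u)) has_real_derivative - deriv F s * G u) (at s)"
    proof (rule has_field_derivative_transform_within_open)
      show "open {0::real<..}" by simp
    qed (use s u Geq in auto)
    ultimately show ?thesis using DERIV_unique by fastforce
  qed
  have dF_t: "deriv F u = p * G u" if u: "0 < u" for u
  proof -
    have "isCont (deriv F) u" using cont u by (simp add: continuous_on_eq_continuous_at)
    then have lim1: "((\<lambda>s. deriv F (s + u)) \<longlongrightarrow> deriv F u) (at_right 0)"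
      by (rule isCont_tendsto_compose) (auto intro!: tendsto_eq_intros)
    have lim2: "((\<lambda>s. deriv F s * G u) \<longlongrightarrow> p * G u) (at_right 0)"
      by (intro tendsto_intros lim)
    have "eventually (\<lambda>s. deriv F (s + u) = deriv F s * G u) (at_right 0)"
      using dF_eq u by (auto simp: eventually_at_right_field intro!: exI[of _ 1])
    then have "((\<lambda>s. deriv F s * G u) \<longlongrightarrow> deriv F u) (at_right 0)"
      by (rule Lim_transform_eventually[OF lim1])
    then show ?thesis
      by (rule tendsto_unique[OF trivial_limit_at_right_real _ lim2])
  qed
  have "\<exists>c. \<forall>u\<in>{0<..}. G u * exp (p * u) = c"
  proof (rule has_field_derivative_zero_constant)
    fix u :: real assume "u \<in> {0<..}"
    then have u: "0 < u" by simp
    have "((\<lambda>u. G u * exp (p * u)) has_real_derivative - deriv F u * exp (p * u) + p * exp (p * u) * G u) (at u)"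
      by (auto intro!: derivative_eq_intros dG u)
    then have "((\<lambda>u. G u * exp (p * u)) has_real_derivative 0) (at u)"
      using dF_t[OF u] by simp
    then show "((\<lambda>u. G u * exp (p * u)) has_real_derivative 0) (at u within {0<..})"
      by (rule has_field_derivative_at_within)
  qed simp
  then obtain c where c: "\<And>u. 0 < u \<Longrightarrow> G u * exp (p * u) = c" by auto
  have Gc: "G u = c * exp (- p * u)" if "0 < u" for u
    using c[OF that] by (auto simp: exp_minus field_simps)
  \<comment> \<open>No value of \<open>G\<close> at 0 is assumed, so the constant is found from the
    equation itself: \<open>G 2 = G 1 * G 1\<close> says \<open>c = c * c\<close>, and positivity of
    the derivative excludes 0.\<close>
  have "G 1 \<noteq> 0" using dF_t[of 1] pos[of 1] by auto
  then have "c \<noteq> 0" using Gc[of 1] by auto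
  moreover have "c * exp (- p * 2) = c * exp (- p) * (c * exp (- p))"
    using Geq[of 1 1] Gc[of 1] Gc[of 2] by simp
  then have "c * exp (- p * 2) = c * c * exp (- p * 2)"
    by (simp add: exp_double[symmetric] power2_eq_square mult.commute mult.left_commute exp_add[symmetric])
  ultimately have "c = 1" by simp
  then show ?thesis using Gc[OF t] by (simp add: G_def)
qed

text \<open>Distribution functions are right continuous, so equality at positive rationals reaches
  every \<open>a \<ge> 0\<close>, including 0, from the right.\<close>

lemma (in prob_space) exponential_law_from_rationals:
  assumes X: "random_variable borel X" and y: "0 < y"
    and cdf_q: "\<And>q::rat. 0 < q \<Longrightarrow> prob {\<omega> \<in> space M. X \<omega> \<le> of_rat q} = 1 - exp (- y * of_rat q)"
  shows "distr M borel X = exp_law y"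
proof -
  interpret R: real_distribution "distr M borel X"
    by (rule real_distribution_distr[OF X])
  have cdf_eq: "cdf (distr M borel X) a = prob {\<omega> \<in> space M. X \<omega> \<le> a}" for a
    using X unfolding cdf_def by (subst measure_distr) (auto simp: vimage_def Int_def conj_commute)
  define f where "f a = cdf (distr M borel X) a - (1 - exp (- a * y))" for a
  have f0: "f a = 0" if a: "0 \<le> a" for a
  proof (rule ccontr)
    assume "f a \<noteq> 0"
    have "(f \<longlongrightarrow> f a) (at_right a)"
      unfolding f_def using R.cdf_is_right_cont[of a]
      by (intro tendsto_intros) (simp add: continuous_within)
    then have "eventually (\<lambda>x. f x \<noteq> 0) (at_right a)"
      using \<open>f a \<noteq> 0\<close> by (rule tendsto_imp_eventually_ne)
    then obtain b where b: "a < b" "\<And>x. a < x \<Longrightarrow> x < b \<Longrightarrow> f x \<noteq> 0"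
      by (auto simp: eventually_at_right_field)
    obtain q :: rat where q: "a < of_rat q" "of_rat q < b" using of_rat_dense[OF b(1)] by blast
    have "0 < (of_rat q :: real)" using q a by linarith
    then have "0 < q" by (simp only: zero_less_of_rat_iff)
    then have "f (of_rat q) = 0" using cdf_q[of q] by (simp add: f_def cdf_eq mult.commute)
    then show False using b(2)[OF q] by simp
  qed
  have "distributed M lborel X (exponential_density y)"
    unfolding exponential_distributed_iff[OF y]
    using X f0 by (auto simp: f_def cdf_eq)
  then have "distr M lborel X = density lborel (exponential_density y)"
    by (simp add: distributed_def)
  moreover have "distr M borel X = distr M lborel X" by (rule distr_cong) simp_all
  ultimately show ?thesis by (simp add: exp_law_def)
qed

section \<open>Renewal kernels with a density limit at 0\<close>

definition regular_renewal :: "'a measure \<Rightarrow> (real \<Rightarrow> 'a \<Rightarrow> ereal) \<Rightarrow> real \<Rightarrow> bool" where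
  "regular_renewal Q N p \<longleftrightarrow>
     prob_space.indep_vars Q (\<lambda>_. borel) (interarrival N) {1..} \<and>
     (\<forall>n\<ge>1. distr Q borel (interarrival N n) = distr Q borel (interarrival N 1)) \<and>
     (\<forall>t>0. (\<lambda>t. measure Q {\<omega>\<in>space Q. interarrival N 1 \<omega> \<le> t}) differentiable at t) \<and>
     continuous_on {0<..} (deriv (\<lambda>t. measure Q {\<omega>\<in>space Q. interarrival N 1 \<omega> \<le> t})) \<and>
     (\<forall>t>0. 0 < deriv (\<lambda>t. measure Q {\<omega>\<in>space Q. interarrival N 1 \<omega> \<le> t}) t) \<and>
     (deriv (\<lambda>t. measure Q {\<omega>\<in>space Q. interarrival N 1 \<omega> \<le> t}) \<longlongrightarrow> p) (at_right 0)"

text \<open>Independence is left to \<open>regular_renewal\<close>, which holds under almost every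
  kernel in any case.\<close>

definition exponential_renewal :: "'a measure \<Rightarrow> (real \<Rightarrow> 'a \<Rightarrow> ereal) \<Rightarrow> real \<Rightarrow> bool" where
  "exponential_renewal Q N y \<longleftrightarrow> (\<forall>n\<ge>1. distr Q borel (interarrival N n) = exp_law y)"

lemma regular_renewal_exponentialI:
  assumes cp: "counting_process Q N" and "prob_space Q" and reg: "regular_renewal Q N p" and y: "0 < y"
    and cdf: "\<And>q::rat. 0 < q \<Longrightarrow> measure Q {\<omega>\<in>space Q. interarrival N 1 \<omega> \<le> of_rat q} = 1 - exp (- y * of_rat q)"
  shows "exponential_renewal Q N y"
proof -
  interpret prob_space Q by fact
  have "distr Q borel (interarrival N 1) = exp_law y"
    by (rule exponential_law_from_rationals[OF interarrival_measurable[OF cp] y cdf])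
  then show ?thesis using reg by (auto simp: regular_renewal_def exponential_renewal_def)
qed

lemma exponential_renewal_cdf:
  assumes cp: "counting_process Q N" and "prob_space Q" and ex: "exponential_renewal Q N y" and y: "0 < y" and t: "0 \<le> t"
  shows "measure Q {\<omega>\<in>space Q. interarrival N 1 \<omega> \<le> t} = 1 - exp (- y * t)"
proof -
  interpret prob_space Q by fact
  have "distr Q lborel (interarrival N 1) = distr Q borel (interarrival N 1)" by (rule distr_cong) simp_all
  also have "\<dots> = density lborel (exponential_density y)"
    using ex by (simp add: exponential_renewal_def exp_law_def)
  finally have "distributed Q lborel (interarrival N 1) (exponential_density y)"
    using interarrival_measurable[OF cp] by (simp add: distributed_def)
  from exponential_distributedD_le[OF this t y] show ?thesis by (simp add: mult.commute)
qed

lemma count_zero_iff: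
  assumes cp: "counting_process M N" and "\<omega> \<in> space M" "0 \<le> t"
  shows "N t \<omega> = 0 \<longleftrightarrow> \<not> interarrival N 1 \<omega> \<le> t"
proof -
  have "N t \<omega> = 0 \<longleftrightarrow> N t \<omega> = ereal (real 0)" by (simp add: zero_ereal_def)
  also have "\<dots> \<longleftrightarrow> arrival N 0 \<omega> \<le> t \<and> t < arrival N (Suc 0) \<omega>"
    by (rule count_eq_iff[OF assms])
  finally show ?thesis using assms(3) by (simp add: arrival_0[OF cp assms(2)] interarrival_def not_le)
qed

lemma measure_poisson_law_zero:
  assumes "0 < l"
  shows "measure (poisson_law l) {0} = exp (- l)"
proof -
  have "(\<lambda>k::nat. ereal (real k)) -` {0} = {0}" by (auto simp: zero_ereal_def)
  then have "measure (poisson_law l) {0} = measure (measure_pmf (poisson_pmf l)) {0}"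
    unfolding poisson_law_eq_pmf[OF assms] by (subst measure_distr) simp_all
  also have "\<dots> = exp (- l)" using assms by (simp add: measure_pmf_single)
  finally show ?thesis .
qed

text \<open>The situation after reparametrization: the parameter of almost every kernel is the limit
  of its interarrival density at 0. Each condition is compared with \<open>exponential\<close>
  here.\<close>

locale regular_mixture = consistent_disintegration M \<Theta> UNIV Q
  for M :: "'a measure" and \<Theta> :: "'a \<Rightarrow> real" and Q :: "real \<Rightarrow> 'a measure" +
  fixes N :: "real \<Rightarrow> 'a \<Rightarrow> ereal"
  assumes cp: "counting_process M N"
    and pos: "AE y in distr M borel \<Theta>. 0 < y"
    and regular: "AE y in distr M borel \<Theta>. regular_renewal (Q y) N y"
begin

abbreviation "\<nu> \<equiv> distr M borel \<Theta>"

lemma Q: "prob_space (Q y)" "sets (Q y) = sets M" "space (Q y) = space M"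
  using disintegration_prob_space[OF dis] by simp_all

lemma cp_Q: "counting_process (Q y) N"
  using cp counting_process_cong[OF Q(2)] by simp

lemma measurable_Q: "E \<in> sets M \<Longrightarrow> (\<lambda>y. measure (Q y) E) \<in> borel_measurable borel"
  using disintegration_measurable[OF dis D] by simp

lemma integral_Q: "E \<in> sets M \<Longrightarrow> (\<integral>y. measure (Q y) E \<partial>\<nu>) = prob E"
  using integral_kernel integral_distr[OF \<Theta> measurable_Q] by simp

lemma AE_\<nu>_iff:
  "{y. R y} \<in> sets borel \<Longrightarrow> (AE y in \<nu>. R y) \<longleftrightarrow> (AE \<omega> in M. R (\<Theta> \<omega>))"
  using AE_distr_iff[OF \<Theta>, of R] by simp

lemma interarrival_sets [measurable]: "{\<omega>\<in>space M. interarrival N n \<omega> \<le> t} \<in> sets M"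
  using interarrival_measurable[OF cp] by measurable

abbreviation "exponential \<equiv> AE y in \<nu>. exponential_renewal (Q y) N y"

text \<open>The null set may depend on the rational time; the countably many of them are united
  inside.\<close>

lemma exponentialI:
  assumes "\<And>q::rat. 0 < q \<Longrightarrow> AE y in \<nu>. measure (Q y) {\<omega>\<in>space M. interarrival N 1 \<omega> \<le> of_rat q} = 1 - exp (- y * of_rat q)"
  shows exponential
proof -
  have "AE y in \<nu>. \<forall>q::rat. 0 < q \<longrightarrow>
      measure (Q y) {\<omega>\<in>space M. interarrival N 1 \<omega> \<le> of_rat q} = 1 - exp (- y * of_rat q)"
    unfolding AE_all_countable using assms by (auto intro: AE_I2)
  with pos regular show ?thesis
  proof eventually_elim
    case (elim y)
    show ?case
      by (rule regular_renewal_exponentialI[OF cp_Q Q(1) elim(2,1)]) (use elim(3) in \<open>simp add: Q(3)\<close>)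
  qed
qed

text \<open>A zero count at \<open>q\<close> means that the first arrival comes after
  \<open>q\<close>. One point of the Poisson law thus gives the survival function, and both the
  Poisson process condition and the conditional one enter this way.\<close>

lemma exponentialI_zero_count:
  assumes "\<And>q::rat. 0 < q \<Longrightarrow> AE y in \<nu>. measure (Q y) {\<omega>\<in>space M. N (of_rat q) \<omega> = 0} = exp (- y * of_rat q)"
  shows exponential
proof (rule exponentialI)
  fix q :: rat assume q: "0 < q"
  show "AE y in \<nu>. measure (Q y) {\<omega>\<in>space M. interarrival N 1 \<omega> \<le> of_rat q} = 1 - exp (- y * of_rat q)"
    using assms[OF q]
  proof eventually_elim
    case (elim y)
    interpret Qy: prob_space "Q y" by (rule Q)
    have "{\<omega>\<in>space M. N (of_rat q) \<omega> = 0} = space (Q y) - {\<omega>\<in>space M. interarrival N 1 \<omega> \<le> of_rat q}"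
      using count_zero_iff[OF cp, of _ "of_rat q"] q by (auto simp: Q(3))
    then show ?case
      using elim Qy.prob_compl[of "{\<omega>\<in>space M. interarrival N 1 \<omega> \<le> of_rat q}"] by (simp add: Q(2))
  qed
qed

lemma exponential_imp_PP:
  assumes exponential
  shows "AE y in \<nu>. PP (Q y) N y"
  using assms pos regular
proof eventually_elim
  case (elim y)
  show ?case
    by (rule exponential_renewal_imp_PP[OF cp_Q elim(2) Q(1)])
       (use elim in \<open>auto simp: regular_renewal_def exponential_renewal_def\<close>)
qed

lemma PP_imp_exponential:
  assumes "AE y in \<nu>. PP (Q y) N y"
  shows exponential
proof (rule exponentialI_zero_count)
  fix q :: rat assume q: "0 < q"
  show "AE y in \<nu>. measure (Q y) {\<omega>\<in>space M. N (of_rat q) \<omega> = 0} = exp (- y * of_rat q)"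
    using assms pos
  proof eventually_elim
    case (elim y)
    have "distr (Q y) borel (N (of_rat q)) = poisson_law (y * of_rat q)"
      using elim(1) q by (simp add: PP_def)
    then have "measure (distr (Q y) borel (N (of_rat q))) {0} = exp (- y * of_rat q)"
      using elim(2) q by (simp add: measure_poisson_law_zero)
    moreover have "N (of_rat q) -` {0} \<inter> space (Q y) = {\<omega>\<in>space M. N (of_rat q) \<omega> = 0}"
      by (auto simp: Q(3))
    ultimately show ?case
      using count_measurable[OF cp_Q, of "of_rat q" y] q by (simp add: measure_distr)
  qed
qed

lemma indep_interarrivals:
  assumes "regular_renewal (Q y) N y" "finite J" "J \<noteq> {}" "J \<subseteq> {1..}"
    and B: "\<And>j. j \<in> J \<Longrightarrow> B j \<in> sets borel"
  shows "measure (Q y) (\<Inter>j\<in>J. {\<omega>\<in>space M. interarrival N j \<omega> \<in> B j}) =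
    (\<Prod>j\<in>J. measure (Q y) {\<omega>\<in>space M. interarrival N j \<omega> \<in> B j})"
proof -
  interpret Qy: prob_space "Q y" by (rule Q)
  have "Qy.indep_vars (\<lambda>_. borel) (interarrival N) {1..}"
    using assms(1) by (simp add: regular_renewal_def)
  from Qy.indep_varsD[OF this assms(3,2,4) B]
  have "measure (Q y) (\<Inter>j\<in>J. interarrival N j -` B j \<inter> space M) =
    (\<Prod>j\<in>J. measure (Q y) (interarrival N j -` B j \<inter> space M))" by (simp add: Q(3))
  moreover have "interarrival N j -` B j \<inter> space M = {\<omega>\<in>space M. interarrival N j \<omega> \<in> B j}" for j by auto
  ultimately show ?thesis by simp
qed

lemma exponential_imp_MPP_mix:
  assumes exponential
  shows "MPP_mix M N Q \<nu>"
  unfolding MPP_mix_def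
\<comment> \<open>The rate has to be positive everywhere, so nonpositive parameters, which form a
  null set, get the value 1.\<close>
proof (intro conjI exI[of _ "\<lambda>y. if 0 < y then y else 1"] allI impI)
  show "(\<lambda>y::real. if 0 < y then y else 1) \<in> borel_measurable borel" by measurable
  show "0 < (if 0 < y then y else 1)" for y :: real by simp
  show "AE y in \<nu>. prob_space (Q y) \<and> prob_space.indep_vars (Q y) (\<lambda>_. borel) (interarrival N) {1..} \<and>
      (\<forall>n\<ge>1. distr (Q y) borel (interarrival N n) = exp_law (if 0 < y then y else 1))"
    using assms pos regular
    by eventually_elim (auto simp: Q(1) regular_renewal_def exponential_renewal_def)
next
  fix r :: nat and w :: "nat \<Rightarrow> real" assume r: "1 \<le> r"
  let ?E = "\<Inter>k\<in>{1..r}. {\<omega>\<in>space M. interarrival N k \<omega> \<le> w k}"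
  let ?p = "\<lambda>y. \<Prod>k\<in>{1..r}. measure (Q y) {\<omega>\<in>space M. interarrival N k \<omega> \<le> w k}"
  have "prob ?E =
      (\<integral>y. measure (Q y) ?E \<partial>\<nu>)"
    using r by (intro integral_Q[symmetric] sets.finite_INT) auto
  also have "\<dots> = (\<integral>y. ?p y \<partial>\<nu>)"
  proof (rule integral_cong_AE)
    show "AE y in \<nu>. measure (Q y) ?E =
        ?p y"
      using regular
    proof eventually_elim
      case (elim y)
      then show ?case using indep_interarrivals[OF elim, of "{1..r}" "\<lambda>k. {..w k}"] r by simp
    qed
  next
    show "(\<lambda>y. measure (Q y) ?E) \<in> borel_measurable \<nu>"
      using r measurable_Q by (simp add: sets.finite_INT)
    show "?p \<in> borel_measurable \<nu>"
      using measurable_Q by (simp add: borel_measurable_prod)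
  qed
  finally show "prob (\<Inter>k\<in>{1..r}. {\<omega>\<in>space M. interarrival N k \<omega> \<le> w k}) =
      (\<integral>y. (\<Prod>k\<in>{1..r}. measure (Q y) {\<omega>\<in>space M. interarrival N k \<omega> \<le> w k}) \<partial>\<nu>)" .
qed

text \<open>The rate \<open>\<alpha> y\<close> is arbitrary at first. An exponential density tends
  to its rate at 0, and this limit is \<open>y\<close>.\<close>

lemma MPP_mix_imp_exponential:
  assumes "MPP_mix M N Q \<nu>"
  shows exponential
proof -
  from assms obtain \<alpha> where \<alpha>: "\<And>y. 0 < \<alpha> y"
    and AE: "AE y in \<nu>. \<forall>n\<ge>1. distr (Q y) borel (interarrival N n) = exp_law (\<alpha> y)"
    unfolding MPP_mix_def by (auto elim!: AE_mp)
  from AE regular show ?thesis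
  proof eventually_elim
    case (elim y)
    let ?F = "\<lambda>t. measure (Q y) {\<omega>\<in>space (Q y). interarrival N 1 \<omega> \<le> t}"
    have ex: "exponential_renewal (Q y) N (\<alpha> y)" using elim(1) by (simp add: exponential_renewal_def)
    have F: "?F t = 1 - exp (- \<alpha> y * t)" if "0 \<le> t" for t
      by (rule exponential_renewal_cdf[OF cp_Q Q(1) ex \<alpha> that])
    have "deriv ?F t = \<alpha> y * exp (- \<alpha> y * t)" if "0 < t" for t
    proof (rule DERIV_imp_deriv)
      have "((\<lambda>t. 1 - exp (- \<alpha> y * t)) has_real_derivative \<alpha> y * exp (- \<alpha> y * t)) (at t)"
        by (auto intro!: derivative_eq_intros)
      then show "(?F has_real_derivative \<alpha> y * exp (- \<alpha> y * t)) (at t)"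
        by (rule has_field_derivative_transform_within_open[where S = "{0<..}"]) (use that F in auto)
    qed
    then have "eventually (\<lambda>t. \<alpha> y * exp (- \<alpha> y * t) = deriv ?F t) (at_right 0)"
      by (auto simp: eventually_at_right_field intro!: exI[of _ 1])
    moreover have "((\<lambda>t. \<alpha> y * exp (- \<alpha> y * t)) \<longlongrightarrow> \<alpha> y) (at_right 0)"
      by (auto intro!: tendsto_eq_intros)
    ultimately have "(deriv ?F \<longlongrightarrow> \<alpha> y) (at_right 0)" by (rule Lim_transform_eventually[rotated])
    moreover have "(deriv ?F \<longlongrightarrow> y) (at_right 0)" using elim(2) by (simp add: regular_renewal_def)
    ultimately have "\<alpha> y = y" by (rule tendsto_unique[OF trivial_limit_at_right_real])
    then show ?case using ex by simp
  qed
qed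

end

lemma incr_vec_measurable:
  assumes "counting_process M N" "time_grid m t" "0 \<le> h"
  shows "incr_vec N (\<lambda>j. t j + h) m \<in> measurable M (PiM {1..m} (\<lambda>_. borel))"
  unfolding incr_vec_def[abs_def]
  by (intro measurable_restrict incr_measurable assms add_nonneg_nonneg grid_nonneg[OF assms(2)]) auto

lemma poisson_weight_le_1:
  assumes "0 < y" "0 \<le> d"
  shows "poisson_weight y d k \<le> 1"
proof (cases "d = 0")
  case True
  then show ?thesis by (cases k) (simp_all add: poisson_weight_def)
next
  case False
  then have "0 < y * d" using assms by simp
  from pmf_poisson_weight[OF this, of k] show ?thesis by (metis pmf_le_1)
qed

section \<open>The conditional definition and the mixing law\<close>

context regular_mixture
begin

text \<open>Each clause concerns finitely many events at a time, so conditional probabilities can be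
  replaced by kernel probabilities off one null set.\<close>

lemma PP_imp_MPP_Theta:
  assumes "AE y in \<nu>. PP (Q y) N y"
  shows "MPP_Theta M N \<Theta>"
proof -
  have PP: "AE \<omega> in M. PP (Q (\<Theta> \<omega>)) N (\<Theta> \<omega>)"
    by (rule AE_distrD[OF \<Theta> assms])
  have incr_meas: "incr N t j \<in> borel_measurable M" if "time_grid m t" "j \<in> {1..m}" for m t j
    using that grid_nonneg[OF that(1)] by (intro incr_measurable cp) auto
  show ?thesis
    unfolding MPP_Theta_def
  proof (intro conjI allI impI)
    show "AE \<omega> in M. 0 < \<Theta> \<omega>" by (rule AE_distrD[OF \<Theta> pos])
  next
    fix m t assume grid: "time_grid m t"
    show "cond_indep M \<Theta> (incr N t) {1..m}"
      unfolding cond_indep_def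
    proof (intro allI impI)
      fix J :: "nat set" and x :: "nat \<Rightarrow> ereal"
      assume J: "J \<subseteq> {1..m}" "finite J" "J \<noteq> {}"
      let ?E = "\<lambda>j. {\<omega>\<in>space M. incr N t j \<omega> \<le> x j}"
      have E: "?E j \<in> sets M" if "j \<in> J" for j
        using incr_meas[OF grid, of j] that J by (auto intro: borel_measurable_le)
      have "AE \<omega> in M. \<forall>j\<in>J. cprob M \<Theta> (?E j) \<omega> = measure (Q (\<Theta> \<omega>)) (?E j)"
        by (rule AE_finite_allI[OF J(2) AE_cprob_eq_kernel[OF E]])
      moreover have "AE \<omega> in M. cprob M \<Theta> (\<Inter>j\<in>J. ?E j) \<omega> = measure (Q (\<Theta> \<omega>)) (\<Inter>j\<in>J. ?E j)"
        using J E by (intro AE_cprob_eq_kernel sets.finite_INT) auto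
      ultimately show "AE \<omega> in M. cprob M \<Theta> (\<Inter>j\<in>J. ?E j) \<omega> = (\<Prod>j\<in>J. cprob M \<Theta> (?E j) \<omega>)"
        using PP
      proof eventually_elim
        case (elim \<omega>)
        interpret Qy: prob_space "Q (\<Theta> \<omega>)" by (rule Q)
        have "Qy.indep_vars (\<lambda>_. borel) (incr N t) {1..m}"
          using elim(3) grid by (simp add: PP_def)
        from Qy.indep_varsD[OF this J(3,2,1), of "\<lambda>j. {..x j}"]
        have "measure (Q (\<Theta> \<omega>)) (\<Inter>j\<in>J. incr N t j -` {..x j} \<inter> space M) =
            (\<Prod>j\<in>J. measure (Q (\<Theta> \<omega>)) (incr N t j -` {..x j} \<inter> space M))" by (simp add: Q(3))
        moreover have "incr N t j -` {..x j} \<inter> space M = ?E j" for j by auto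
        ultimately show ?case using elim(1,2) by simp
      qed
    qed
  next
    fix m t and h :: real assume grid: "time_grid m t" and h: "0 < h"
    let ?S = "PiM {1..m} (\<lambda>_. borel :: ereal measure)"
    have meas0: "incr_vec N t m \<in> measurable M ?S"
      using incr_vec_measurable[OF cp grid, of 0] by simp
    have meas1: "incr_vec N (\<lambda>j. t j + h) m \<in> measurable M ?S"
      using incr_vec_measurable[OF cp grid, of h] h by simp
    show "cond_law_eq M \<Theta> ?S (incr_vec N t m) (incr_vec N (\<lambda>j. t j + h) m)"
      unfolding cond_law_eq_def
    proof
      fix B assume B: "B \<in> sets ?S"
      show "AE \<omega> in M. cprob M \<Theta> (incr_vec N t m -` B \<inter> space M) \<omega> =
          cprob M \<Theta> (incr_vec N (\<lambda>j. t j + h) m -` B \<inter> space M) \<omega>"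
        using AE_cprob_eq_kernel[OF measurable_sets[OF meas0 B]] AE_cprob_eq_kernel[OF measurable_sets[OF meas1 B]] PP
      proof eventually_elim
        case (elim \<omega>)
        have "distr (Q (\<Theta> \<omega>)) ?S (incr_vec N t m) = distr (Q (\<Theta> \<omega>)) ?S (incr_vec N (\<lambda>j. t j + h) m)"
          using elim(3) grid h by (simp add: PP_def)
        then have "measure (distr (Q (\<Theta> \<omega>)) ?S (incr_vec N t m)) B =
            measure (distr (Q (\<Theta> \<omega>)) ?S (incr_vec N (\<lambda>j. t j + h) m)) B" by simp
        then show ?case
          using elim(1,2) meas0 meas1 B
          by (simp add: measure_distr measurable_cong_sets[OF Q(2) refl] Q(3))
      qed
    qed
  next
    fix t :: real assume t: "0 < t"
    have meas: "N t \<in> borel_measurable M" using count_measurable[OF cp] t by simp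
    show "cond_law M \<Theta> borel (N t) (\<lambda>\<omega>. poisson_law (\<Theta> \<omega> * t))"
      unfolding cond_law_def
    proof
      fix B :: "ereal set" assume B: "B \<in> sets borel"
      show "AE \<omega> in M. cprob M \<Theta> (N t -` B \<inter> space M) \<omega> = measure (poisson_law (\<Theta> \<omega> * t)) B"
        using AE_cprob_eq_kernel[OF measurable_sets[OF meas B]] PP
      proof eventually_elim
        case (elim \<omega>)
        have "distr (Q (\<Theta> \<omega>)) borel (N t) = poisson_law (\<Theta> \<omega> * t)"
          using elim(2) t by (simp add: PP_def)
        then have "measure (distr (Q (\<Theta> \<omega>)) borel (N t)) B = measure (poisson_law (\<Theta> \<omega> * t)) B" by simp
        then show ?case
          using elim(1) meas B by (simp add: measure_distr measurable_cong_sets[OF Q(2) refl] Q(3))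
      qed
    qed
  qed
qed

lemma MPP_Theta_imp_exponential:
  assumes "MPP_Theta M N \<Theta>"
  shows exponential
proof (rule exponentialI_zero_count)
  fix q :: rat assume q: "0 < q"
  let ?E = "{\<omega>\<in>space M. N (of_rat q) \<omega> = 0}"
  have E: "?E = N (of_rat q) -` {0} \<inter> space M" by auto
  have E_sets: "?E \<in> sets M"
    unfolding E using count_measurable[OF cp, of "of_rat q"] q by (intro measurable_sets[of _ _ borel]) auto
  have "cond_law M \<Theta> borel (N (of_rat q)) (\<lambda>\<omega>. poisson_law (\<Theta> \<omega> * of_rat q))"
    using assms q by (simp add: MPP_Theta_def)
  then have "AE \<omega> in M. cprob M \<Theta> ?E \<omega> = measure (poisson_law (\<Theta> \<omega> * of_rat q)) {0}"
    unfolding cond_law_def E by simp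
  then have "AE \<omega> in M. measure (Q (\<Theta> \<omega>)) ?E = exp (- \<Theta> \<omega> * of_rat q)"
    using AE_cprob_eq_kernel[OF E_sets] AE_distrD[OF \<Theta> pos]
  proof eventually_elim
    case (elim \<omega>)
    then show ?case using q by (simp add: measure_poisson_law_zero)
  qed
  \<comment> \<open>An almost sure statement on \<open>M\<close> passes to the law of
    \<open>\<Theta>\<close> because the set of good parameters is Borel.\<close>
  moreover have "{y. measure (Q y) ?E = exp (- y * of_rat q)} \<in> sets borel"
    using borel_measurable_eq[OF measurable_Q[OF E_sets], of "\<lambda>y. exp (- y * of_rat q)"] by simp
  ultimately show "AE y in \<nu>. measure (Q y) ?E = exp (- y * of_rat q)"
    using AE_\<nu>_iff by blast
qed

lemma incr_event: "1 \<le> m \<Longrightarrow> (\<Inter>j\<in>{1..m}. {\<omega>\<in>space M. incr N t j \<omega> = ereal (real (\<kappa> j))}) =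
    {\<omega>\<in>space M. \<forall>j\<in>{1..m}. incr N t j \<omega> = ereal (real (\<kappa> j))}"
  by auto

lemma incr_event_sets:
  assumes grid: "time_grid m t"
  shows "{\<omega>\<in>space M. \<forall>j\<in>{1..m}. incr N t j \<omega> = ereal (real (\<kappa> j))} \<in> sets M"
proof (rule sets.sets_Collect_finite_All)
  fix j assume "j \<in> {1..m}"
  then have "incr N t j \<in> borel_measurable M"
    using grid_nonneg[OF grid] by (intro incr_measurable cp) auto
  then show "{\<omega>\<in>space M. incr N t j \<omega> = ereal (real (\<kappa> j))} \<in> sets M" by measurable
qed simp

lemma exponential_imp_MPP_U:
  assumes exponential
  shows "MPP_U M N \<nu>"
  unfolding MPP_U_def
proof (intro allI impI)
  fix m t and \<kappa> :: "nat \<Rightarrow> nat" assume grid: "time_grid m t"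
  then have m: "1 \<le> m" by (simp add: time_grid_def)
  let ?E = "{\<omega>\<in>space M. \<forall>j\<in>{1..m}. incr N t j \<omega> = ereal (real (\<kappa> j))}"
  let ?w = "\<lambda>y. \<Prod>j\<in>{1..m}. exp (- y * (t j - t (j - 1))) * (y * (t j - t (j - 1))) ^ \<kappa> j / fact (\<kappa> j)"
  have "prob ?E = (\<integral>y. measure (Q y) ?E \<partial>\<nu>)"
    by (rule integral_Q[OF incr_event_sets[OF grid], symmetric])
  also have "\<dots> = (\<integral>y. indicator {0<..} y * ?w y \<partial>\<nu>)"
  proof (rule integral_cong_AE)
    show "(\<lambda>y. measure (Q y) ?E) \<in> borel_measurable \<nu>"
      using measurable_Q[OF incr_event_sets[OF grid]] by simp
    show "(\<lambda>y. indicator {0<..} y * ?w y) \<in> borel_measurable \<nu>" by simp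
    show "AE y in \<nu>. measure (Q y) ?E = indicator {0<..} y * ?w y"
      using assms pos regular
    proof eventually_elim
      case (elim y)
      have "measure (Q y) {\<omega>\<in>space (Q y). \<forall>j\<in>{1..m}. incr N t j \<omega> = ereal (real (\<kappa> j))} =
          (\<Prod>j\<in>{1..m}. poisson_weight y (t j - t (j - 1)) (\<kappa> j))"
        by (rule exponential_renewal_fdd[OF cp_Q elim(2) Q(1) _ _ grid])
           (use elim in \<open>auto simp: regular_renewal_def exponential_renewal_def\<close>)
      then show ?case using elim(2) by (simp add: Q(3) poisson_weight_def)
    qed
  qed
  finally show "prob (\<Inter>j\<in>{1..m}. {\<omega>\<in>space M. incr N t j \<omega> = ereal (real (\<kappa> j))}) =
      (LINT \<theta>:{0<..}|\<nu>. ?w \<theta>)"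
    unfolding incr_event[OF m] by (simp add: set_lebesgue_integral_def)
qed

end

lemma exists_grid_jumps:
  assumes ps: "ps \<noteq> []" "\<forall>(d, k)\<in>set ps. 0 < d"
  obtains t \<kappa> where "time_grid (length ps) t" "grid_jumps t \<kappa> (length ps) = ps"
proof
  define t where "t j = sum_list (map fst (take j ps))" for j
  define \<kappa> where "\<kappa> j = snd (ps ! (j - 1))" for j
  have step: "t (Suc j) = t j + fst (ps ! j)" if "j < length ps" for j
    using that by (simp add: t_def take_Suc_conv_app_nth)
  have "t j < t (Suc j)" if "j < length ps" for j
    using step[OF that] ps(2) nth_mem[OF that] by (auto simp: case_prod_beta)
  then show "time_grid (length ps) t"
    using ps(1) by (simp add: time_grid_def t_def Suc_le_eq)
  show "grid_jumps t \<kappa> (length ps) = ps"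
    by (rule nth_equalityI) (auto simp: grid_jumps_def \<kappa>_def step simp del: upt_Suc)
qed

section \<open>From the mixing law back to the kernels\<close>

context regular_mixture
begin

abbreviation "W_law \<equiv> distr M (PiM UNIV (\<lambda>_::nat. borel)) (\<lambda>\<omega> i. interarrival N (Suc i) \<omega>)"

lemma nn_integral_indicator_pos:
  fixes f :: "real \<Rightarrow> real"
  assumes f [measurable]: "f \<in> borel_measurable borel" and bounds: "\<And>l. 0 < l \<Longrightarrow> 0 \<le> f l" "\<And>l. 0 < l \<Longrightarrow> f l \<le> 1"
  shows "(\<integral>\<^sup>+l. indicator {0<..} l * ennreal (f l) \<partial>\<nu>) = ennreal (\<integral>l. indicator {0<..} l * f l \<partial>\<nu>)"
proof -
  interpret U: prob_space \<nu> by (rule prob_space_distr[OF \<Theta>])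
  have nonneg: "0 \<le> indicator {0<..} l * f l" for l
    using bounds(1)[of l] by (cases "0 < l") simp_all
  have "norm (indicator {0<..} l * f l) \<le> 1" for l
    using bounds[of l] by (cases "0 < l") simp_all
  then have int: "integrable \<nu> (\<lambda>l. indicator {0<..} l * f l)"
    by (intro U.integrable_const_bound[of _ 1] AE_I2) simp_all
  have "(\<integral>\<^sup>+l. indicator {0<..} l * ennreal (f l) \<partial>\<nu>) = (\<integral>\<^sup>+l. ennreal (indicator {0<..} l * f l) \<partial>\<nu>)"
    by (intro nn_integral_cong) (simp add: indicator_def)
  also have "\<dots> = ennreal (\<integral>l. indicator {0<..} l * f l \<partial>\<nu>)"
    by (rule nn_integral_eq_integral[OF int]) (simp add: nonneg)
  finally show ?thesis .
qed

lemma MPP_U_mixed_poisson_sequence: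
  assumes "MPP_U M N \<nu>"
  shows "mixed_poisson_sequence W_law \<nu>"
proof -
  note W_meas = interarrival_seq_measurable[OF cp]
  interpret W: prob_space W_law by (rule prob_space_distr[OF W_meas])
  interpret U: prob_space \<nu> by (rule prob_space_distr[OF \<Theta>])
  show ?thesis
  proof
    have "{w \<in> space (PiM UNIV (\<lambda>_::nat. borel)). \<forall>i. (0::real) < w i} \<in> sets (PiM UNIV (\<lambda>_::nat. borel))"
      by measurable
    then show "AE w in W_law. \<forall>i. 0 < w i"
      by (subst AE_distr_iff[OF W_meas]) (auto intro!: AE_I2 interarrival_pos[OF cp])
  next
    fix ps :: "(real \<times> nat) list" assume ps: "ps \<noteq> []" "\<forall>(d, k)\<in>set ps. 0 < d"
    let ?m = "length ps"
    obtain t \<kappa> where grid: "time_grid ?m t" and grid_ps: "grid_jumps t \<kappa> ?m = ps"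
      using exists_grid_jumps[OF ps] .
    have m: "1 \<le> ?m" using grid by (simp add: time_grid_def)
    have d: "0 \<le> t j - t (j - 1)" if "j \<in> {1..?m}" for j
      using grid_mono[OF grid, of "j - 1" j] that by simp
    let ?E = "{\<omega>\<in>space M. \<forall>j\<in>{1..?m}. incr N t j \<omega> = ereal (real (\<kappa> j))}"
    let ?w = "\<lambda>l. \<Prod>j\<in>{1..?m}. poisson_weight l (t j - t (j - 1)) (\<kappa> j)"
    have w_ps: "(\<Prod>(d, k)\<leftarrow>ps. poisson_weight l d k) = ?w l" for l
      using prod_grid_jumps[of "poisson_weight l" t \<kappa> ?m] unfolding grid_ps .
    have w_meas: "?w \<in> borel_measurable borel"
      unfolding poisson_weight_def by measurable
    have w: "0 \<le> ?w l" "?w l \<le> 1" if "0 < l" for l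
      using that d by (auto intro!: prod_nonneg prod_le_1 poisson_weight_nonneg poisson_weight_le_1)
    have "emeasure W_law {w. jumps 0 0 ps w} = emeasure M ((\<lambda>\<omega> i. interarrival N (Suc i) \<omega>) -` {w. jumps 0 0 ps w} \<inter> space M)"
      using jumps_measurable[of 0 0 ps] by (intro emeasure_distr W_meas) (simp add: pred_def space_PiM)
    also have "(\<lambda>\<omega> i. interarrival N (Suc i) \<omega>) -` {w. jumps 0 0 ps w} \<inter> space M = ?E"
      using incr_eq_iff_jumps[OF cp _ grid, of _ \<kappa>] unfolding grid_ps by auto
    also have "emeasure M ?E = ennreal (LINT \<theta>:{0<..}|\<nu>. ?w \<theta>)"
      using assms grid unfolding MPP_U_def incr_event[OF m, symmetric] emeasure_eq_measure poisson_weight_def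
      by simp
    also have "\<dots> = (\<integral>\<^sup>+l. indicator {0<..} l * ennreal (?w l) \<partial>\<nu>)"
      unfolding set_lebesgue_integral_def real_scaleR_def
      by (rule nn_integral_indicator_pos[OF w_meas w, symmetric])
    finally show "emeasure W_law {w. jumps 0 0 ps w} =
        (\<integral>\<^sup>+l. indicator {0<..} l * ennreal (\<Prod>(d, k)\<leftarrow>ps. poisson_weight l d k) \<partial>\<nu>)"
      unfolding w_ps .
  qed (simp_all add: pos)
qed

definition survival :: "real \<Rightarrow> real \<Rightarrow> real" where
  "survival y s = measure (Q y) {\<omega>\<in>space M. s < interarrival N 1 \<omega>}"

lemma interarrival_greater_sets [measurable]: "{\<omega>\<in>space M. s < interarrival N n \<omega>} \<in> sets M"
  using interarrival_measurable[OF cp] by measurable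

lemma survival_measurable [measurable]: "(\<lambda>y. survival y s) \<in> borel_measurable borel"
  unfolding survival_def by (rule measurable_Q) measurable

lemma survival_bounds: "0 \<le> survival y s" "survival y s \<le> 1"
  using prob_space.prob_le_1[OF Q(1)] by (simp_all add: survival_def)

lemma survival_eq: "survival y s = 1 - measure (Q y) {\<omega>\<in>space (Q y). interarrival N 1 \<omega> \<le> s}"
proof -
  let ?E = "{\<omega>\<in>space M. interarrival N 1 \<omega> \<le> s}"
  interpret Qy: prob_space "Q y" by (rule Q)
  have "{\<omega>\<in>space M. s < interarrival N 1 \<omega>} = space (Q y) - ?E"
    by (auto simp: Q(3))
  also have "measure (Q y) \<dots> = 1 - measure (Q y) ?E"
    by (rule Qy.prob_compl) (simp add: Q(2))
  finally show ?thesis by (simp only: survival_def Q(3))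
qed

lemma measure_box_regular:
  assumes reg: "regular_renewal (Q y) N y" and n: "1 \<le> n"
  shows "measure (Q y) {\<omega>\<in>space M. \<forall>i<n. s i < interarrival N (Suc i) \<omega>} = (\<Prod>i<n. survival y (s i))"
proof -
  have law: "measure (Q y) {\<omega>\<in>space M. u < interarrival N j \<omega>} = survival y u" if "1 \<le> j" for j u
  proof -
    have "distr (Q y) borel (interarrival N j) = distr (Q y) borel (interarrival N 1)"
      using reg that unfolding regular_renewal_def by blast
    then have "measure (distr (Q y) borel (interarrival N j)) {u<..} = measure (distr (Q y) borel (interarrival N 1)) {u<..}"
      by (simp only:)
    then have "measure (Q y) (interarrival N j -` {u<..} \<inter> space M) = measure (Q y) (interarrival N 1 -` {u<..} \<inter> space M)"
      using interarrival_measurable[OF cp_Q] by (simp add: measure_distr Q(3))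
    moreover have "interarrival N j -` {u<..} \<inter> space M = {\<omega>\<in>space M. u < interarrival N j \<omega>}" for j by auto
    ultimately show ?thesis by (simp add: survival_def)
  qed
  have "{\<omega>\<in>space M. \<forall>i<n. s i < interarrival N (Suc i) \<omega>} =
      (\<Inter>j\<in>Suc ` {..<n}. {\<omega>\<in>space M. interarrival N j \<omega> \<in> {s (j - 1)<..}})"
  proof (intro set_eqI iffI)
    fix \<omega> assume \<omega>: "\<omega> \<in> (\<Inter>j\<in>Suc ` {..<n}. {\<omega>\<in>space M. interarrival N j \<omega> \<in> {s (j - 1)<..}})"
    then have "\<omega> \<in> space M" using n by (auto dest!: bspec[of _ _ "0::nat"])
    then show "\<omega> \<in> {\<omega>\<in>space M. \<forall>i<n. s i < interarrival N (Suc i) \<omega>}" using \<omega> by auto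
  qed auto
  also have "measure (Q y) \<dots> = (\<Prod>j\<in>Suc ` {..<n}. measure (Q y) {\<omega>\<in>space M. interarrival N j \<omega> \<in> {s (j - 1)<..}})"
    using n by (intro indep_interarrivals[OF reg]) (auto simp: lessThan_empty_iff)
  also have "\<dots> = (\<Prod>i<n. survival y (s i))"
    by (simp add: prod.reindex law)
  finally show ?thesis .
qed

text \<open>Both sides are the unconditional probability that the first \<open>n\<close>
  interarrival times exceed the bounds: on the left by independence under the kernels, on the right
  by \<open>emeasure_box\<close>.\<close>

lemma integral_survival:
  fixes n :: nat
  assumes "MPP_U M N \<nu>" and n: "1 \<le> n" and s: "\<And>i. i < n \<Longrightarrow> 0 \<le> s i"
  shows "(\<integral>y. (\<Prod>i<n. survival y (s i)) \<partial>\<nu>) = (\<integral>y. indicator {0<..} y * (\<Prod>i<n. exp (- y * s i)) \<partial>\<nu>)"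
proof -
  let ?I = "\<integral>y. (\<Prod>i<n. survival y (s i)) \<partial>\<nu>" and ?J = "\<integral>y. indicator {0<..} y * (\<Prod>i<n. exp (- y * s i)) \<partial>\<nu>"
  interpret mixed_poisson_sequence W_law \<nu> by (rule MPP_U_mixed_poisson_sequence[OF assms(1)])
  note W_meas = interarrival_seq_measurable[OF cp]
  let ?E = "{\<omega>\<in>space M. \<forall>i\<in>{..<n}. s i < interarrival N (Suc i) \<omega>}"
  have E: "?E \<in> sets M" by (rule sets.sets_Collect_finite_All) auto
  have E_eq: "?E = {\<omega>\<in>space M. \<forall>i<n. s i < interarrival N (Suc i) \<omega>}" by auto
  have bound: "0 \<le> (\<Prod>i<n. exp (- y * s i))" "(\<Prod>i<n. exp (- y * s i)) \<le> 1" if "0 < y" for y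
    using that s by (auto intro!: prod_nonneg prod_le_1)
  have "?I = (\<integral>y. measure (Q y) ?E \<partial>\<nu>)"
  proof (rule integral_cong_AE)
    show "AE y in \<nu>. (\<Prod>i<n. survival y (s i)) = measure (Q y) ?E"
      using regular by eventually_elim (simp add: measure_box_regular[OF _ n] E_eq)
  qed (use measurable_Q[OF E] in simp_all)
  also have "\<dots> = prob ?E" by (rule integral_Q[OF E])
  finally have "ennreal ?I = emeasure M ?E"
    by (simp add: emeasure_eq_measure)
  also have "\<dots> = emeasure W_law {w. \<forall>i<n. s i < w i}"
  proof -
    have "{w \<in> space (PiM UNIV (\<lambda>_::nat. borel)). \<forall>i\<in>{..<n}. s i < w i} \<in> sets (PiM UNIV (\<lambda>_::nat. borel))"
      by measurable
    also have "{w \<in> space (PiM UNIV (\<lambda>_::nat. borel)). \<forall>i\<in>{..<n}. s i < w i} = {w. \<forall>i<n. s i < w i}"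
      by (auto simp: space_PiM)
    finally show ?thesis
      by (subst emeasure_distr[OF W_meas]) (auto intro!: arg_cong[where f = "emeasure M"])
  qed
  also have "\<dots> = (\<integral>\<^sup>+l. indicator {0<..} l * ennreal (\<Prod>i<n. exp (- l * s i)) \<partial>\<nu>)"
    by (rule emeasure_box[OF s])
  also have "\<dots> = ennreal ?J"
    by (rule nn_integral_indicator_pos) (use bound in simp_all)
  finally have "ennreal ?I = ennreal ?J" .
  moreover have "0 \<le> ?I"
    by (intro Bochner_Integration.integral_nonneg prod_nonneg ballI survival_bounds)
  moreover have "0 \<le> ?J"
    by (intro Bochner_Integration.integral_nonneg mult_nonneg_nonneg prod_nonneg ballI) simp_all
  ultimately show ?thesis by (simp only: ennreal_inj)
qed

text \<open>The square of \<open>G(s + t) - G(s) G(t)\<close> for the survival function \<open>G\<close> is a combination of products over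
  distinct interarrival times, and its mean is the one for exponential survival functions, hence zero.\<close>

lemma AE_survival_multiplicative:
  assumes U: "MPP_U M N \<nu>" and s: "0 \<le> s" and t: "0 \<le> t"
  shows "AE y in \<nu>. survival y (s + t) = survival y s * survival y t"
proof -
  interpret U: prob_space \<nu> by (rule prob_space_distr[OF \<Theta>])
  let ?a = "\<lambda>y. survival y (s + t) * survival y (s + t)"
  let ?b = "\<lambda>y. survival y (s + t) * survival y s * survival y t"
  let ?c = "\<lambda>y. survival y s * survival y s * survival y t * survival y t"
  let ?e = "\<lambda>y. indicator {0<..} y * exp (- y * (2 * s + 2 * t))"
  have e: "exp (- (y * (s + t))) * exp (- (y * (s + t))) = exp (- (y * (2 * s + 2 * t)))"
      "exp (- (y * (s + t))) * exp (- (y * s)) * exp (- (y * t)) = exp (- (y * (2 * s + 2 * t)))"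
      "exp (- (y * s)) * exp (- (y * s)) * exp (- (y * t)) * exp (- (y * t)) = exp (- (y * (2 * s + 2 * t)))" for y
    by (simp_all add: exp_add[symmetric] algebra_simps)
  have nth_nonneg: "0 \<le> xs ! i" if "\<forall>x\<in>set xs. 0 \<le> x" "i < length xs" for xs :: "real list" and i
    using that nth_mem by blast
  \<comment> \<open>The three terms of the square use two, three and four distinct interarrival
    times. The bounds always add up to \<open>2 * s + 2 * t\<close>, so the means agree and the
    coefficients 1, -2 and 1 cancel.\<close>
  have a: "(\<integral>y. ?a y \<partial>\<nu>) = (\<integral>y. ?e y \<partial>\<nu>)"
    using integral_survival[OF U, of 2 "\<lambda>i. [s + t, s + t] ! i"] s t nth_nonneg[of "[s + t, s + t]"]
    by (simp add: numeral_2_eq_2 e)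
  have b: "(\<integral>y. ?b y \<partial>\<nu>) = (\<integral>y. ?e y \<partial>\<nu>)"
    using integral_survival[OF U, of 3 "\<lambda>i. [s + t, s, t] ! i"] s t nth_nonneg[of "[s + t, s, t]"]
    by (simp add: numeral_3_eq_3 e)
  have c: "(\<integral>y. ?c y \<partial>\<nu>) = (\<integral>y. ?e y \<partial>\<nu>)"
    using integral_survival[OF U, of 4 "\<lambda>i. [s, s, t, t] ! i"] s t nth_nonneg[of "[s, s, t, t]"]
    by (simp add: numeral_eq_Suc e)
  have int: "integrable \<nu> ?a" "integrable \<nu> ?b" "integrable \<nu> ?c"
    by (rule U.integrable_const_bound[of _ 1];
        auto intro!: AE_I2 mult_le_one mult_nonneg_nonneg simp: survival_bounds abs_mult)+
  have sq: "(survival y (s + t) - survival y s * survival y t)\<^sup>2 = ?a y - 2 * ?b y + ?c y" for y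
    by (simp add: power2_eq_square algebra_simps)
  have "(\<integral>y. (survival y (s + t) - survival y s * survival y t)\<^sup>2 \<partial>\<nu>) = 0"
    unfolding sq using int a b c by simp
  moreover have "integrable \<nu> (\<lambda>y. (survival y (s + t) - survival y s * survival y t)\<^sup>2)"
    unfolding sq using int by simp
  ultimately have "AE y in \<nu>. (survival y (s + t) - survival y s * survival y t)\<^sup>2 = 0"
    by (subst (asm) integral_nonneg_eq_0_iff_AE) auto
  then show ?thesis by eventually_elim simp
qed

lemma MPP_U_imp_exponential:
  assumes U: "MPP_U M N \<nu>"
  shows exponential
proof -
  have "AE y in \<nu>. \<forall>s t :: rat. 0 < s \<longrightarrow> 0 < t \<longrightarrow>
      survival y (of_rat s + of_rat t) = survival y (of_rat s) * survival y (of_rat t)"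
    unfolding AE_all_countable
  proof (intro allI)
    fix s t :: rat
    show "AE y in \<nu>. 0 < s \<longrightarrow> 0 < t \<longrightarrow>
        survival y (of_rat s + of_rat t) = survival y (of_rat s) * survival y (of_rat t)"
    proof (cases "0 < s \<and> 0 < t")
      case True
      then have "AE y in \<nu>. survival y (of_rat s + of_rat t) = survival y (of_rat s) * survival y (of_rat t)"
        by (intro AE_survival_multiplicative[OF U]) simp_all
      then show ?thesis by eventually_elim simp
    qed auto
  qed
  with pos regular show ?thesis
  proof eventually_elim
    case (elim y)
    let ?F = "\<lambda>t. measure (Q y) {\<omega>\<in>space (Q y). interarrival N 1 \<omega> \<le> t}"
    have "1 - ?F t = exp (- y * t)" if "0 < t" for t
    proof (rule exponential_functional_equation[OF _ _ _ _ _ that])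
      show "1 - ?F (of_rat s + of_rat t) = (1 - ?F (of_rat s)) * (1 - ?F (of_rat t))"
        if "0 < s" "0 < t" for s t :: rat
        using elim(3) that unfolding survival_eq by blast
    qed (use elim(2) in \<open>simp_all add: regular_renewal_def\<close>)
    then have "?F (of_rat q) = 1 - exp (- y * of_rat q)" if "0 < q" for q :: rat
    proof -
      have "1 - ?F (of_rat q) = exp (- y * of_rat q)"
        using that \<open>\<And>t. 0 < t \<Longrightarrow> 1 - ?F t = exp (- y * t)\<close>[of "of_rat q"] by simp
      then show ?thesis by linarith
    qed
    then show ?case
      by (rule regular_renewal_exponentialI[OF cp_Q Q(1) elim(2,1)])
  qed
qed

theorem characterizations:
  "MPP_Theta M N \<Theta> \<longleftrightarrow> exponential" "MPP_mix M N Q \<nu> \<longleftrightarrow> exponential"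
  "(AE y in \<nu>. PP (Q y) N y) \<longleftrightarrow> exponential" "MPP_U M N \<nu> \<longleftrightarrow> exponential"
  using PP_imp_MPP_Theta MPP_Theta_imp_exponential exponential_imp_PP PP_imp_exponential
    exponential_imp_MPP_mix MPP_mix_imp_exponential exponential_imp_MPP_U MPP_U_imp_exponential by blast+

end

section \<open>The reparametrized disintegration\<close>

text \<open>Along the steps \<open>1 / (n + 1)\<close> the derivative is a limit of difference
  quotients and \<open>p\<close> is a limit of derivatives, so measurability passes through
  sequential limits twice.\<close>

lemma density_limit_measurable:
  fixes F :: "'a \<Rightarrow> real \<Rightarrow> real"
  assumes meas: "\<And>t. (\<lambda>x. F x t) \<in> borel_measurable R"
    and diff: "\<And>x t. x \<in> space R \<Longrightarrow> 0 < t \<Longrightarrow> F x differentiable at t"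
    and lim: "\<And>x. x \<in> space R \<Longrightarrow> (deriv (F x) \<longlongrightarrow> p x) (at_right 0)"
  shows "p \<in> borel_measurable R"
proof -
  have inv_lim: "filterlim (\<lambda>n. inverse (real (Suc n))) (at_right 0) sequentially"
    using LIMSEQ_inverse_real_of_nat by (simp add: filterlim_at)
  have deriv_meas: "(\<lambda>x. deriv (F x) t) \<in> borel_measurable R" if t: "0 < t" for t
  proof (rule borel_measurable_LIMSEQ_real)
    fix x assume "x \<in> space R"
    then have "(F x has_real_derivative deriv (F x) t) (at t)"
      using diff t DERIV_deriv_iff_real_differentiable by blast
    then have "((\<lambda>h. (F x (t + h) - F x t) / h) \<longlongrightarrow> deriv (F x) t) (at 0)"
      by (simp add: DERIV_def)
    then have "((\<lambda>h. (F x (t + h) - F x t) / h) \<longlongrightarrow> deriv (F x) t) (at_right 0)"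
      by (rule filterlim_mono) (simp_all add: at_le)
    from filterlim_compose[OF this inv_lim]
    show "(\<lambda>n. (F x (t + inverse (real (Suc n))) - F x t) / inverse (real (Suc n))) \<longlonglongrightarrow> deriv (F x) t" .
  next
    show "(\<lambda>x. (F x (t + inverse (real (Suc n))) - F x t) / inverse (real (Suc n))) \<in> borel_measurable R" for n
      using meas by (intro borel_measurable_divide borel_measurable_diff) simp_all
  qed
  show ?thesis
  proof (rule borel_measurable_LIMSEQ_real)
    fix x assume "x \<in> space R"
    from filterlim_compose[OF lim[OF this] inv_lim]
    show "(\<lambda>n. deriv (F x) (inverse (real (Suc n)))) \<longlonglongrightarrow> p x" .
  next
    show "(\<lambda>x. deriv (F x) (inverse (real (Suc n)))) \<in> borel_measurable R" for n
      by (rule deriv_meas) simp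
  qed
qed

lemma sets_restrict_borel:
  assumes "E \<in> sets borel"
  shows "A \<in> sets (restrict_space borel E) \<longleftrightarrow> A \<subseteq> E \<and> A \<in> sets borel"
  using assms by (subst sets_restrict_space_iff) auto

lemma restrict_borel_preimage:
  assumes E: "E \<in> sets borel" and f: "f \<in> borel_measurable (restrict_space borel E)" and B: "B \<in> sets borel"
  shows "{x \<in> E. f x \<in> B} \<in> sets borel"
proof -
  have "f -` B \<inter> space (restrict_space borel E) \<in> sets (restrict_space borel E)"
    by (rule measurable_sets[OF f B])
  moreover have "f -` B \<inter> space (restrict_space borel E) = {x \<in> E. f x \<in> B}" by (auto simp: space_restrict_space)
  ultimately show ?thesis using sets_restrict_borel[OF E] by simp
qed

lemma injective_borel_image_subset:
  fixes p :: "real \<Rightarrow> real"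
  assumes p: "p \<in> borel_measurable (restrict_space borel E)" and inj: "inj_on p E"
    and A: "A \<in> sets borel" "A \<subseteq> E"
  shows "p ` A \<in> sets borel"
  using injective_borel_image[OF A(1) measurable_restrict_mono[OF p A(2)] inj_on_subset[OF inj A(2)]] .

text \<open>A superlevel set of \<open>f\<close> after the inverse of \<open>p\<close> is the image
  under \<open>p\<close> of a superlevel set of \<open>f\<close>, up to the complement of the range.
  It is Borel by the theorem on injective images.\<close>

lemma measurable_the_inv_into:
  fixes p f :: "real \<Rightarrow> real"
  assumes E: "E \<in> sets borel" and p: "p \<in> borel_measurable (restrict_space borel E)" and inj: "inj_on p E"
    and f: "f \<in> borel_measurable (restrict_space borel E)"
  shows "(\<lambda>y. if y \<in> p ` E then f (the_inv_into E p y) else c) \<in> borel_measurable borel"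
proof (rule borel_measurableI_greater)
  fix a :: real
  let ?S = "{y \<in> space borel. a < (if y \<in> p ` E then f (the_inv_into E p y) else c)}"
  have "?S =
      p ` {x \<in> E. f x \<in> {a<..}} \<union> (if a < c then - (p ` E) else {})"
  proof (intro set_eqI iffI)
    fix y assume "y \<in> p ` {x \<in> E. f x \<in> {a<..}} \<union> (if a < c then - (p ` E) else {})"
    then show "y \<in> ?S"
      by (auto simp: the_inv_into_f_f[OF inj] inj_on_eq_iff[OF inj] split: if_splits)
  next
    fix y assume y: "y \<in> ?S"
    show "y \<in> p ` {x \<in> E. f x \<in> {a<..}} \<union> (if a < c then - (p ` E) else {})"
    proof (cases "y \<in> p ` E")
      case True
      then obtain x where "x \<in> E" "y = p x" by blast
      then show ?thesis using y by (auto simp: the_inv_into_f_f[OF inj])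
    next
      case False
      then show ?thesis using y by simp
    qed
  qed
  moreover have "p ` {x \<in> E. f x \<in> {a<..}} \<in> sets borel"
    by (rule injective_borel_image_subset[OF p inj restrict_borel_preimage[OF E f]]) auto
  moreover have "- (p ` E) \<in> sets borel"
    using injective_borel_image_subset[OF p inj E] by simp
  ultimately show "?S \<in> sets borel"
    by simp
qed

theorem theorem2:
  fixes M :: "'a measure" and N :: "real \<Rightarrow> 'a \<Rightarrow> ereal"
    and \<Theta> \<Theta>h :: "'a \<Rightarrow> real" and D L0 Lh :: "real set"
    and h ph :: "real \<Rightarrow> real" and K :: "real \<Rightarrow> real measure"
    and P\<theta> Q :: "real \<Rightarrow> 'a measure"
  assumes "prob_space M"
    and "\<Theta> \<in> borel_measurable M" and "\<forall>\<omega>\<in>space M. 0 < \<Theta> \<omega>"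
    and "D \<in> sets borel" and "\<Theta> ` space M \<subseteq> D"
    and "h \<in> borel_measurable (restrict_space borel D)"
    and "counting_process M N"
    and "eMRP M N \<Theta> h K"
    and "disintegration M (distr M borel \<Theta>) D P\<theta>"
    and "consistent M (distr M borel \<Theta>) D P\<theta> \<Theta>"
    and "standing_A M N \<Theta> h P\<theta> D K Lh ph"
    and "L0 \<in> sets borel" and "L0 \<subseteq> D" and "measure (distr M borel \<Theta>) L0 = 0"
    and "inj_on h (D - L0)"
    and "\<Theta>h \<in> borel_measurable M"
    and "\<forall>\<omega>\<in>space M. \<Theta> \<omega> \<in> D - (L0 \<union> Lh) \<longrightarrow> \<Theta>h \<omega> = ph (\<Theta> \<omega>)"
    and "\<forall>y. Q y = (if y \<in> ph ` (D - (L0 \<union> Lh))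
                     then P\<theta> (the_inv_into (D - (L0 \<union> Lh)) ph y) else M)"
  shows "disintegration M (distr M borel \<Theta>h) UNIV Q \<and>
         consistent M (distr M borel \<Theta>h) UNIV Q \<Theta>h \<and>
         (MPP_Theta M N \<Theta>h \<longleftrightarrow> MPP_mix M N Q (distr M borel \<Theta>h)) \<and>
         (MPP_mix M N Q (distr M borel \<Theta>h) \<longleftrightarrow> (AE y in distr M borel \<Theta>h. PP (Q y) N y)) \<and>
         ((AE y in distr M borel \<Theta>h. PP (Q y) N y) \<longleftrightarrow> MPP_U M N (distr M borel \<Theta>h))"
proof -
  interpret consistent_disintegration M \<Theta> D P\<theta>
    by (intro consistent_disintegration.intro consistent_disintegration_axioms.intro assms)
  note \<Theta>h [measurable] = \<open>\<Theta>h \<in> borel_measurable M\<close>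
  note cp = \<open>counting_process M N\<close>
  define E where "E = D - (L0 \<union> Lh)"
  define F where "F \<theta> t = measure (P\<theta> \<theta>) {\<omega>\<in>space M. interarrival N 1 \<omega> \<le> t}" for \<theta> t
  note A = \<open>standing_A M N \<Theta> h P\<theta> D K Lh ph\<close>[unfolded standing_A_def Let_def, folded F_def]
  have Lh: "Lh \<in> sets borel" "measure (distr M borel \<Theta>) Lh = 0" using A by blast+
  have E: "E \<in> sets borel" "E \<subseteq> D" using Lh(1) \<open>L0 \<in> sets borel\<close> D by (auto simp: E_def)
  have law: "distr (P\<theta> \<theta>) borel (interarrival N n) = K (h \<theta>)" if "\<theta> \<in> D" "1 \<le> n" for \<theta> n
    using A that by blast
  have dens: "\<forall>t>0. F \<theta> differentiable at t" "continuous_on {0<..} (deriv (F \<theta>))"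
      "\<forall>t>0. 0 < deriv (F \<theta>) t" "(deriv (F \<theta>) \<longlongrightarrow> ph \<theta>) (at_right 0)" if "\<theta> \<in> E" for \<theta>
    using A that unfolding E_def F_def[abs_def] by blast+
  have ph_pos: "0 < ph \<theta>" if "\<theta> \<in> E" for \<theta> using A that by (auto simp: E_def)
  have inj: "inj_on ph E" using A by (auto simp: E_def intro: inj_on_subset)
  have kernel_E: "(\<lambda>\<theta>. measure (P\<theta> \<theta>) B) \<in> borel_measurable (restrict_space borel E)" if "B \<in> sets M" for B
    using dis that unfolding disintegration_def by (intro measurable_restrict_mono[OF _ E(2)]) blast
  have ph: "ph \<in> borel_measurable (restrict_space borel E)"
  proof (rule density_limit_measurable)
    show "(\<lambda>\<theta>. F \<theta> t) \<in> borel_measurable (restrict_space borel E)" for t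
      unfolding F_def using interarrival_measurable[OF cp] by (intro kernel_E) measurable
  next
    fix \<theta> assume "\<theta> \<in> space (restrict_space borel E)"
    then have "\<theta> \<in> E" by (simp add: space_restrict_space)
    then show "F \<theta> differentiable at t" if "0 < t" for t using dens(1) that by blast
    show "(deriv (F \<theta>) \<longlongrightarrow> ph \<theta>) (at_right 0)" using dens(4) \<open>\<theta> \<in> E\<close> by blast
  qed
  have phE: "ph ` E \<in> sets borel" by (rule injective_borel_image_subset[OF ph inj E(1)]) simp
  have Q_ph: "Q (ph \<theta>) = P\<theta> \<theta>" if "\<theta> \<in> E" for \<theta>
    using assms(18) that by (simp add: E_def[symmetric] the_inv_into_f_f[OF inj])
  have Q_meas: "(\<lambda>y. measure (Q y) B) \<in> borel_measurable borel" if "B \<in> sets M" for B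
  proof -
    have "measure (Q y) B = (if y \<in> ph ` E then measure (P\<theta> (the_inv_into E ph y)) B else prob B)" for y
      using assms(18) by (simp add: E_def)
    then show ?thesis using measurable_the_inv_into[OF E(1) ph inj kernel_E[OF that]] by simp
  qed
  have "AE \<omega> in M. \<Theta> \<omega> \<notin> L" if "L \<in> sets borel" "measure (distr M borel \<Theta>) L = 0" for L
  proof -
    have "prob (\<Theta> -` L \<inter> space M) = 0" using that by (simp add: measure_distr)
    then have "AE \<omega> in M. \<omega> \<notin> \<Theta> -` L \<inter> space M" using that(1) by (subst (asm) prob_eq_0) simp_all
    then show ?thesis using AE_space by eventually_elim simp
  qed
  from this[OF \<open>L0 \<in> sets borel\<close> \<open>measure (distr M borel \<Theta>) L0 = 0\<close>] this[OF Lh]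
  \<comment> \<open>The bridge between the parametrizations: almost surely the new kernel at
    \<open>\<Theta>h\<close> is the old kernel at \<open>\<Theta>\<close>.\<close>
  have AE_E: "AE \<omega> in M. \<omega> \<in> space M \<and> \<Theta> \<omega> \<in> E \<and> \<Theta>h \<omega> = ph (\<Theta> \<omega>) \<and> Q (ph (\<Theta> \<omega>)) = P\<theta> (\<Theta> \<omega>)"
    using AE_space
  proof eventually_elim
    case (elim \<omega>)
    then have "\<Theta> \<omega> \<in> E" using \<Theta>_D by (auto simp: E_def)
    then show ?case using elim(3) assms(17) Q_ph by (auto simp: E_def)
  qed
  have dis_Q: "disintegration M (distr M borel \<Theta>h) UNIV Q"
    unfolding disintegration_def
  proof (intro conjI ballI)
    fix y :: real
    have "prob_space (Q y) \<and> sets (Q y) = sets M"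
    proof (cases "y \<in> ph ` E")
      case True
      then show ?thesis using Q_ph disintegration_prob_space[OF dis] E(2) by auto
    next
      case False
      then show ?thesis using assms(18) \<open>prob_space M\<close> by (simp add: E_def)
    qed
    then show "prob_space (Q y)" "sets (Q y) = sets M" by simp_all
  next
    fix B assume B: "B \<in> sets M"
    show "(\<lambda>y. measure (Q y) B) \<in> borel_measurable (restrict_space borel UNIV)"
      using Q_meas[OF B] by (rule measurable_restrict_space1)
    have "(LINT y:UNIV|distr M borel \<Theta>h. measure (Q y) B) = (\<integral>\<omega>. measure (Q (\<Theta>h \<omega>)) B \<partial>M)"
      by (simp add: set_lebesgue_integral_def integral_distr[OF \<Theta>h Q_meas[OF B]])
    also have "\<dots> = (\<integral>\<omega>. measure (P\<theta> (\<Theta> \<omega>)) B \<partial>M)"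
    proof (rule integral_cong_AE)
      show "AE \<omega> in M. measure (Q (\<Theta>h \<omega>)) B = measure (P\<theta> (\<Theta> \<omega>)) B"
        using AE_E by eventually_elim simp
    qed (use measurable_compose[OF \<Theta>h Q_meas[OF B]] measurable_kernel[OF B] in simp_all)
    also have "\<dots> = prob B" by (rule integral_kernel[OF B])
    finally show "(LINT y:UNIV|distr M borel \<Theta>h. measure (Q y) B) = prob B" .
  qed
  have cons_Q: "consistent M (distr M borel \<Theta>h) UNIV Q \<Theta>h"
    unfolding consistent_def
  proof (intro ballI impI)
    fix B :: "real set" assume B: "B \<in> sets borel"
    \<comment> \<open>Wherever \<open>\<Theta>\<close> lies in this set, \<open>\<Theta>h\<close>
      lies in \<open>B\<close>. Consistency of the old kernels for \<open>?B\<close> thus bounds the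
      new mass below by one.\<close>
    let ?B = "{\<theta> \<in> E. ph \<theta> \<in> B}"
    have hB: "\<Theta>h -` B \<inter> space M \<in> sets M" using measurable_sets[OF \<Theta>h B] .
    have "AE \<omega> in M. \<Theta>h \<omega> \<in> B \<longrightarrow> measure (Q (\<Theta>h \<omega>)) (\<Theta>h -` B \<inter> space M) = 1"
      using AE_E AE_kernel_consistent[OF restrict_borel_preimage[OF E(1) ph B]]
    proof eventually_elim
      case (elim \<omega>)
      show ?case
      proof
        assume "\<Theta>h \<omega> \<in> B"
        interpret R: prob_space "P\<theta> (\<Theta> \<omega>)" using kernel_prob_space elim(1) by blast
        have "R.prob (\<Theta> -` ?B \<inter> space M) = 1" using elim \<open>\<Theta>h \<omega> \<in> B\<close> by simp
        moreover have "R.prob (\<Theta> -` ?B \<inter> space M) \<le> R.prob (\<Theta>h -` B \<inter> space M)"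
          using hB kernel_prob_space(2)[of \<omega>] elim(1) assms(17)
          by (intro R.finite_measure_mono) (auto simp: E_def)
        ultimately show "measure (Q (\<Theta>h \<omega>)) (\<Theta>h -` B \<inter> space M) = 1"
          using R.prob_le_1[of "\<Theta>h -` B \<inter> space M"] elim(1) by simp
      qed
    qed
    moreover have "{y \<in> space borel. y \<in> B \<longrightarrow> measure (Q y) (\<Theta>h -` B \<inter> space M) = 1} \<in> sets borel"
      using B Q_meas[OF hB] by measurable
    ultimately show "AE y in distr M borel \<Theta>h. y \<in> B \<longrightarrow> measure (Q y) (\<Theta>h -` B \<inter> space M) = 1"
      by (subst AE_distr_iff[OF \<Theta>h]) simp_all
  qed
  have AE_phE: "AE y in distr M borel \<Theta>h. y \<in> ph ` E"
  proof (subst AE_distr_iff[OF \<Theta>h])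
    show "AE \<omega> in M. \<Theta>h \<omega> \<in> ph ` E" using AE_E by eventually_elim simp
  qed (use phE in simp)
  \<comment> \<open>Conditional independence given \<open>\<Theta>\<close> is read off the kernels
    for one finite \<open>J\<close> and one choice of rational bounds, with a null set depending on
    both.\<close>
  have fact: "AE y in distr M borel \<Theta>h. measure (Q y) (\<Inter>j\<in>J. {\<omega>\<in>space M. interarrival N j \<omega> \<le> of_rat (q j)}) =
      (\<Prod>j\<in>J. measure (Q y) {\<omega>\<in>space M. interarrival N j \<omega> \<le> of_rat (q j)})"
    if J: "J \<subseteq> {1..}" "finite J" "J \<noteq> {}" for J :: "nat set" and q :: "nat \<Rightarrow> rat"
  proof -
    let ?A = "\<lambda>j. {\<omega>\<in>space M. interarrival N j \<omega> \<le> of_rat (q j)}"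
    have A: "?A j \<in> sets M" for j using interarrival_measurable[OF cp] by measurable
    have AJ: "(\<Inter>j\<in>J. ?A j) \<in> sets M" using J A by (intro sets.finite_INT) auto
    have "cond_indep M \<Theta> (interarrival N) {1..}" using \<open>eMRP M N \<Theta> h K\<close> by (simp add: eMRP_def)
    from this[unfolded cond_indep_def, rule_format, OF J, of "\<lambda>j. of_rat (q j)"]
    have ci: "AE \<omega> in M. cprob M \<Theta> (\<Inter>j\<in>J. ?A j) \<omega> = (\<Prod>j\<in>J. cprob M \<Theta> (?A j) \<omega>)" .
    have cj: "AE \<omega> in M. \<forall>j\<in>J. cprob M \<Theta> (?A j) \<omega> = measure (P\<theta> (\<Theta> \<omega>)) (?A j)"
      by (rule AE_finite_allI[OF J(2) AE_cprob_eq_kernel[OF A]])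
    have "AE \<omega> in M. measure (Q (\<Theta>h \<omega>)) (\<Inter>j\<in>J. ?A j) = (\<Prod>j\<in>J. measure (Q (\<Theta>h \<omega>)) (?A j))"
      using ci cj AE_cprob_eq_kernel[OF AJ] AE_E by eventually_elim simp
    moreover have "{y \<in> space borel. measure (Q y) (\<Inter>j\<in>J. ?A j) = (\<Prod>j\<in>J. measure (Q y) (?A j))} \<in> sets borel"
      by (intro borel_measurable_eq borel_measurable_prod Q_meas A AJ)
    ultimately show ?thesis by (subst AE_distr_iff[OF \<Theta>h]) simp_all
  qed
  let ?fac = "\<lambda>y J q. measure (Q y) (\<Inter>j\<in>J. {\<omega>\<in>space M. interarrival N j \<omega> \<le> of_rat (q j)}) =
      (\<Prod>j\<in>J. measure (Q y) {\<omega>\<in>space M. interarrival N j \<omega> \<le> of_rat (q j)})"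
  let ?JJ = "{J :: nat set. finite J \<and> J \<noteq> {} \<and> J \<subseteq> {1..}}"
  \<comment> \<open>There are countably many finite \<open>J\<close>, and on each countably many
    extensional rational bounds, so a single null set serves all tests.\<close>
  have "AE y in distr M borel \<Theta>h. \<forall>J\<in>?JJ. \<forall>q\<in>PiE J (\<lambda>_. UNIV :: rat set). ?fac y J q"
  proof (subst AE_ball_countable)
    show "countable ?JJ"
      by (rule countable_subset[OF _ countable_Collect_finite]) auto
    show "\<forall>J\<in>?JJ. AE y in distr M borel \<Theta>h. \<forall>q\<in>PiE J (\<lambda>_. UNIV :: rat set). ?fac y J q"
    proof
      fix J :: "nat set" assume J: "J \<in> ?JJ"
      have "countable (PiE J (\<lambda>_. UNIV :: rat set))" using J by (intro countable_PiE) auto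
      then show "AE y in distr M borel \<Theta>h. \<forall>q\<in>PiE J (\<lambda>_. UNIV :: rat set). ?fac y J q"
        using fact J by (simp add: AE_ball_countable)
    qed
  qed
  then have regular: "AE y in distr M borel \<Theta>h. regular_renewal (Q y) N y"
    using AE_phE
  proof eventually_elim
    case (elim y)
    then obtain \<theta> where \<theta>: "\<theta> \<in> E" "y = ph \<theta>" by blast
    have Qy: "Q y = P\<theta> \<theta>" using Q_ph \<theta> by simp
    have ps: "prob_space (Q y)" "sets (Q y) = sets M" "space (Q y) = space M"
      using disintegration_prob_space[OF dis_Q] by simp_all
    have "prob_space.indep_vars (Q y) (\<lambda>_. borel) (interarrival N) {1..}"
    proof (rule prob_space.indep_vars_rat_cdf[OF ps(1)])
      show "interarrival N i \<in> borel_measurable (Q y)" for i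
        using interarrival_measurable[OF cp] by (simp add: measurable_cong_sets[OF ps(2) refl])
    qed (use elim(1) in \<open>auto simp: ps(3)\<close>)
    moreover have F: "(\<lambda>t. measure (Q y) {\<omega>\<in>space (Q y). interarrival N 1 \<omega> \<le> t}) = F \<theta>"
      by (simp add: F_def[abs_def] Qy ps(3)[unfolded Qy])
    moreover have "\<forall>n\<ge>1. distr (Q y) borel (interarrival N n) = distr (Q y) borel (interarrival N 1)"
    proof -
      have "\<theta> \<in> D" using \<theta> E(2) by blast
      then show ?thesis unfolding Qy by (simp add: law)
    qed
    ultimately show ?case
      unfolding regular_renewal_def F using dens[OF \<theta>(1), folded \<theta>(2)] by blast
  qed
  have pos: "AE y in distr M borel \<Theta>h. 0 < y"
    using AE_phE by eventually_elim (auto simp: ph_pos)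
  have "regular_mixture M \<Theta>h Q N"
    by (intro regular_mixture.intro regular_mixture_axioms.intro consistent_disintegration.intro
        consistent_disintegration_axioms.intro \<open>prob_space M\<close> \<Theta>h dis_Q cons_Q cp pos regular) simp_all
  from regular_mixture.characterizations[OF this] show ?thesis
    using dis_Q cons_Q by blast
qed

end
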